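(* For any probabilistic algorithm that list-approximates short programs with parameters $T$, $r$ and $c$: (1) $r \ge 2\log n - \log T - 2\log c - O(1)$. In particular, if $T=n$ and $c = O(\log n)$, then $r \ge \log n - O(\log\log n)$. (2) $c \ge \log(n^2/T) - 2\log\log(n^2/T)$. In particular, if $T = O(n)$, then $c \ge \log n - 2\log\log n - O(1)$. (3) $T = \Omega(n/(c+1))$.
   Context: Fix a universal Turing machine $U$ that is standard: for every machine $V$ there is a polynomial-time computable function $t$ such that, for all $p$, $U(t(p)) = V(p)$ and $|t(p)| = |p| + O(1)$. The Kolmogorov complexity of a string $x$ is $C(x) = \min\{|p| : U(p)=x\}$. A string $p$ with $U(p)=x$ and $|p| \le C(x)+c$ is called a $c$-short program for $x$. $\log$ is base 2, and $n$ denotes the length of the input string $x$. A probabilistic algorithm that list-approximates short programs with parameters $T$, $r$, $c$ is given by a Turing machine $F$ that takes an input $x$ and a sequence $\rho$ (of random bits) and satisfies: (a) $|\rho| = r$ depends only on the length of $x$; (b) for all $x$ and all $\rho$ of length $r$, $F(x,\rho)$ halts and outputs a finite set of strings $L_{x,\rho}$ (called a list); (c) the size $|L_{x,\rho}| = T$ depends only on the length of $x$; (d) for all $x$, at least $1/2$ of the sets $\{L_{x,\rho}\}_{|\rho|=r}$ contain a $c$-short program for $x$. So $T$ is the size of the list, $r$ is the number of random bits used in the construction, and $c$ is the closeness to $C(x)$ of the length of the short program guaranteed to exist in at least half of the lists.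
   Formalization: r is assumed computable in n (else (2), (3) fail, as |ρ| could carry uncomputable advice); the first bound in (2) gets an extra -O(1) and is claimed only where n^2/T >= 2, since as printed it is false or undefined; in (1), log c is read as 0 when c = 0. *)

theory Defs
  imports Complex_Main "HOL-Library.Landau_Symbols"
begin

text \<open>
  Deterministic multi-tape machines. Tapes are infinite in both directions and carry symbols
  coded by natural numbers, with 0 the blank. The states are \<open>0, ..., halt_state\<close>; the
  computation starts in state 0 and stops on reaching \<open>halt_state\<close>.
\<close>

datatype move = MLeft | MStay | MRight

record tm =
  tape_count :: nat
  alphabet_size :: nat
  halt_state :: nat
  transition :: "nat \<Rightarrow> nat list \<Rightarrow> nat \<times> (nat \<times> move) list"

definition wf_tm :: "tm \<Rightarrow> bool" where
  "wf_tm M \<longleftrightarrow> tape_count M \<ge> 1 \<and> alphabet_size M \<ge> 4 \<and>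
     (\<forall>q < halt_state M. \<forall>ss. length ss = tape_count M \<longrightarrow> set ss \<subseteq> {..<alphabet_size M} \<longrightarrow>
        (case transition M q ss of (q', acts) \<Rightarrow>
           q' \<le> halt_state M \<and> length acts = tape_count M \<and>
           fst ` set acts \<subseteq> {..<alphabet_size M}))"

type_synonym tape = "(int \<Rightarrow> nat) \<times> int"
type_synonym config = "nat \<times> tape list"

fun offset :: "move \<Rightarrow> int" where
  "offset MLeft = -1"
| "offset MStay = 0"
| "offset MRight = 1"

fun scan :: "tape \<Rightarrow> nat" where
  "scan (f, h) = f h"

fun act :: "nat \<times> move \<Rightarrow> tape \<Rightarrow> tape" where
  "act (s, m) (f, h) = (f(h := s), h + offset m)"

fun step :: "tm \<Rightarrow> config \<Rightarrow> config" where
  "step M (q, ts) =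
     (if q = halt_state M then (q, ts)
      else case transition M q (map scan ts) of (q', acts) \<Rightarrow> (q', map2 act acts ts))"

definition blank_tape :: tape where
  "blank_tape = ((\<lambda>_. 0), 0)"

definition input_tape :: "nat list \<Rightarrow> tape" where
  "input_tape w = ((\<lambda>i. if 0 \<le> i \<and> i < int (length w) then w ! nat i else 0), 0)"

definition start :: "tm \<Rightarrow> nat list \<Rightarrow> config" where
  "start M w = (0, input_tape w # replicate (tape_count M - 1) blank_tape)"

text \<open>The input is on the first tape. The output is on the last tape: the symbols from cell 0 up
  to, but excluding, the first blank.\<close>

definition holds_word :: "tape \<Rightarrow> nat list \<Rightarrow> bool" where
  "holds_word tp v \<longleftrightarrow>
     (\<forall>i < length v. fst tp (int i) = v ! i \<and> v ! i \<noteq> 0) \<and> fst tp (int (length v)) = 0"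

definition outputs_within :: "tm \<Rightarrow> nat list \<Rightarrow> nat list \<Rightarrow> nat \<Rightarrow> bool" where
  "outputs_within M w v s \<longleftrightarrow>
     (case (step M ^^ s) (start M w) of (q, ts) \<Rightarrow> q = halt_state M \<and> holds_word (last ts) v)"

definition outputs :: "tm \<Rightarrow> nat list \<Rightarrow> nat list \<Rightarrow> bool" where
  "outputs M w v \<longleftrightarrow> (\<exists>s. outputs_within M w v s)"

text \<open>Bits are the symbols 1 and 2; the symbol 3 is a separator.\<close>

definition enc :: "bool list \<Rightarrow> nat list" where
  "enc = map (\<lambda>b. if b then 2 else 1)"

definition enc_pair :: "bool list \<Rightarrow> bool list \<Rightarrow> nat list" where
  "enc_pair x y = enc x @ [3] @ enc y"

definition enc_list :: "bool list list \<Rightarrow> nat list" where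
  "enc_list ws = concat (map (\<lambda>w. enc w @ [3]) ws)"

text \<open>The partial function on binary strings computed by a machine. It is undefined where the
  machine does not halt, or halts with an output that is not a binary string.\<close>

definition tm_fun :: "tm \<Rightarrow> bool list \<Rightarrow> bool list option" where
  "tm_fun M p =
     (if \<exists>x. outputs M (enc p) (enc x) then Some (THE x. outputs M (enc p) (enc x)) else None)"

lemma holds_word_unique:
  assumes "holds_word tp v" and "holds_word tp w"
  shows "v = w"
proof -
  have "length v = length w"
    using assms unfolding holds_word_def by (metis linorder_neqE_nat)
  with assms show ?thesis
    unfolding holds_word_def by (metis nth_equalityI)
qed

lemma step_halted: "fst cf = halt_state M \<Longrightarrow> (step M ^^ s) cf = cf"
  by (induction s) (cases cf; simp)+

lemma outputs_unique:
  assumes "outputs M w u" and "outputs M w v"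
  shows "u = v"
proof -
  have mono: "outputs_within M w x (s + d)" if "outputs_within M w x s" for x s d
  proof -
    have "(step M ^^ (d + s)) (start M w) = (step M ^^ s) (start M w)"
      using that step_halted[of "(step M ^^ s) (start M w)" M d]
      by (auto simp: outputs_within_def funpow_add split: prod.splits)
    with that show ?thesis
      by (simp add: outputs_within_def add.commute)
  qed
  from assms obtain s t where "outputs_within M w u s" "outputs_within M w v t"
    by (auto simp: outputs_def)
  then have "outputs_within M w u (s + t)" "outputs_within M w v (s + t)"
    using mono[of u s t] mono[of v t s] by (simp_all add: add.commute)
  then show ?thesis
    by (auto simp: outputs_within_def split: prod.splits intro: holds_word_unique)
qed

lemma enc_inject: "enc x = enc y \<longleftrightarrow> x = y"
  unfolding enc_def by (rule inj_map_eq_map) (auto intro!: injI split: if_splits)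

lemma tm_fun_eq_Some_iff: "tm_fun M p = Some x \<longleftrightarrow> outputs M (enc p) (enc x)"
proof -
  have "(THE x. outputs M (enc p) (enc x)) = y" if "outputs M (enc p) (enc y)" for y
    using that by (intro the_equality) (auto dest: outputs_unique simp: enc_inject)
  then show ?thesis
    by (auto simp: tm_fun_def)
qed

definition polytime_computable :: "(bool list \<Rightarrow> bool list) \<Rightarrow> bool" where
  "polytime_computable t \<longleftrightarrow>
     (\<exists>M a b. wf_tm M \<and>
        (\<forall>p. outputs_within M (enc p) (enc (t p)) (a * length p ^ b + a)))"

definition computable_nat :: "(nat \<Rightarrow> nat) \<Rightarrow> bool" where
  "computable_nat f \<longleftrightarrow>
     (\<exists>M. wf_tm M \<and> (\<forall>n. tm_fun M (replicate n True) = Some (replicate (f n) True)))"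

definition standard :: "tm \<Rightarrow> bool" where
  "standard U \<longleftrightarrow> wf_tm U \<and>
     (\<forall>V. wf_tm V \<longrightarrow>
        (\<exists>t. polytime_computable t \<and>
             (\<forall>p. tm_fun U (t p) = tm_fun V p) \<and>
             (\<exists>d. \<forall>p. \<bar>int (length (t p)) - int (length p)\<bar> \<le> d)))"

text \<open>For a standard machine the set below is never empty, so the infimum is the minimum.\<close>

definition C :: "tm \<Rightarrow> bool list \<Rightarrow> nat" where
  "C U x = Inf {length p | p. tm_fun U p = Some x}"

definition short_program :: "tm \<Rightarrow> nat \<Rightarrow> bool list \<Rightarrow> bool list \<Rightarrow> bool" where
  "short_program U c p x \<longleftrightarrow> tm_fun U p = Some x \<and> length p \<le> C U x + c"

text \<open>The set of strings written on the output tape; repetitions on the tape do not count.\<close>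

definition outputs_set :: "tm \<Rightarrow> bool list \<Rightarrow> bool list \<Rightarrow> bool list set \<Rightarrow> bool" where
  "outputs_set F x \<rho> L \<longleftrightarrow> (\<exists>ws. outputs F (enc_pair x \<rho>) (enc_list ws) \<and> L = set ws)"

text \<open>
  All three parameters are functions of the input length. The number \<open>r\<close> of random bits is a
  computable function: otherwise the mere length of the random string would hand \<open>F\<close>
  uncomputable advice, e.g. \<open>r n\<close> could code the number of halting programs of length at most
  \<open>n + O(1)\<close>, and \<open>F\<close> could then output a shortest program as a one-element list.
\<close>

definition list_approximates ::
    "tm \<Rightarrow> tm \<Rightarrow> (nat \<Rightarrow> nat) \<Rightarrow> (nat \<Rightarrow> nat) \<Rightarrow> (nat \<Rightarrow> nat) \<Rightarrow> bool" where
  "list_approximates U F T r c \<longleftrightarrow> wf_tm F \<and> computable_nat r \<and>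
     (\<exists>L. (\<forall>x \<rho>. length \<rho> = r (length x) \<longrightarrow>
              outputs_set F x \<rho> (L x \<rho>) \<and> card (L x \<rho>) = T (length x)) \<and>
          (\<forall>x. real (card {\<rho>. length \<rho> = r (length x) \<and>
                           (\<exists>p \<in> L x \<rho>. short_program U (c (length x)) p x)})
               \<ge> 1/2 * real (card {\<rho> :: bool list. length \<rho> = r (length x)})))"

end

theory Submission
  imports Defs "HOL-Library.Nat_Bijection" "HOL-Library.FuncSet"
begin

text \<open>
  For every \<open>m\<close> and every length \<open>n\<close> in \<open>[2m, 4m]\<close> a computable set of candidates of length \<open>n\<close> is
  offered, one string at a time: the next one is offered as soon as the previous one is served,
  that is, has a program of length at most \<open>m\<close>, or programs of length at most \<open>m + c + O(1)\<close> in
  half of its lists. If at most \<open>2 ^ (m + O(1))\<close> candidates can ever be served, then the offered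
  strings form a small enumerable set, so they have complexity at most \<open>m + O(1)\<close>, their lists must
  contain short programs for them, and all candidates get served. Hence there are few candidates.

  For the bound on \<open>T\<close> the candidates are the strings for which fewer than half of the lists have
  an element with length in the band \<open>(m, m + c + O(1)]\<close>; only programs of length at most \<open>m\<close> can
  serve them. So an incompressible string has an element in half of its lists for each of about
  \<open>n / c\<close> disjoint bands.

  For the bounds on \<open>r\<close> and \<open>c\<close> each program \<open>p\<close> gets a price \<open>v p\<close>, and a candidate is a string in
  whose lists no \<open>p\<close> is more frequent than \<open>v p\<close> allows, so that serving it costs programs of a
  certain total weight; the total weight of all programs is \<open>O(2 ^ m)\<close>. Prices are chosen at random
  with tails \<open>4 ^ - i\<close>. A string with light lists (the logarithms of the frequencies add up to at
  most \<open>m / 8\<close>) is then a candidate with probability at least \<open>2 ^ (- m / 4)\<close>, and a blow-up lemma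
  yields one choice of prices that works for all lengths \<open>n\<close> at the same time. Hence some string
  has heavy lists for all relevant \<open>m\<close> in \<open>[n / 4, n / 2]\<close>, and summing over \<open>m\<close> gives the quadratic
  bounds.
\<close>

section \<open>A loop language on registers and its compilation to machines\<close>

text \<open>Neither \<open>c\<close> nor the additive constant of the enumeration is known to the
  machine that enumerates. As \<open>r\<close> and \<open>T\<close> are computable,
  \<open>c n\<close> is replaced by the largest \<open>k < n\<close> for which the claimed
  inequality fails; if it fails for \<open>c n\<close>, this guess is at least \<open>c n\<close>,
  and the rest uses only that it fails for the guess. The constant \<open>e\<close> occurs in the
  candidates, yet must exceed the overhead \<open>a\<close> of enumerating them; so one machine
  serves all \<open>e\<close>, reading \<open>e\<close> in unary, and \<open>e\<close> is fixed
  after \<open>a\<close>. Prices work because a program outputs just one string: served strings are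
  paid for by disjoint sets of programs, so the total weight limits their number. The tails
  \<open>4 ^ - i\<close> are a compromise: the mean of \<open>2 ^ level\<close> is at most 2, yet
  light strings keep probability \<open>2 ^ (- m / 4)\<close>. The good sets for the
  \<open>2 * m + 1\<close> lengths are then too small to intersect for reasons of measure alone. But
  the dimension of the cube is exponential in \<open>m\<close>, and a set of such measure is within
  far fewer than \<open>2 ^ m\<close> coordinates of a typical point; overpaying for those is
  affordable.\<close>

datatype instr = Inc nat | Dec nat | Read nat nat | Write bool | While nat "instr list"

type_synonym state = "(nat \<Rightarrow> nat) \<times> bool list \<times> bool list"

text \<open>\<open>Read a b\<close> consumes the next input bit and increments \<open>a\<close> on a 0 and \<open>b\<close> on a 1. A
  configuration is the list of instructions that are still to be executed, with a state.\<close>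

fun sstep :: "instr list \<times> state \<Rightarrow> instr list \<times> state" where
  "sstep ([], st) = ([], st)"
| "sstep (Inc r # k, s, i, out) = (k, s(r := Suc (s r)), i, out)"
| "sstep (Dec r # k, s, i, out) = (k, s(r := s r - 1), i, out)"
| "sstep (Read a b # k, s, [], out) = (k, s, [], out)"
| "sstep (Read a b # k, s, c # i, out) =
     (k, (if c then s(b := Suc (s b)) else s(a := Suc (s a))), i, out)"
| "sstep (Write c # k, s, i, out) = (k, s, i, out @ [c])"
| "sstep (While r b # k, s, i, out) = (if s r = 0 then k else b @ While r b # k, s, i, out)"

fun regs :: "instr list \<Rightarrow> nat set" where
  "regs [] = {}"
| "regs (Inc r # k) = insert r (regs k)"
| "regs (Dec r # k) = insert r (regs k)"
| "regs (Read a b # k) = insert a (insert b (regs k))"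
| "regs (Write c # k) = regs k"
| "regs (While r b # k) = insert r (regs b \<union> regs k)"

lemma regs_append [simp]: "regs (a @ b) = regs a \<union> regs b"
  by (induction a rule: regs.induct) auto

lemma finite_regs: "finite (regs a)"
  by (induction a rule: regs.induct) auto

text \<open>The continuations that occur while \<open>a\<close> is executed in front of \<open>k\<close>. There are finitely
  many of them; they become the states of the machine.\<close>

fun conts :: "instr list \<Rightarrow> instr list \<Rightarrow> instr list set" where
  "conts [] k = {k}"
| "conts (While r b # a) k =
     insert (While r b # a @ k) (conts b (While r b # a @ k) \<union> conts a k)"
| "conts (j # a) k = insert (j # a @ k) (conts a k)"

lemma finite_conts: "finite (conts a k)"
  by (induction a k rule: conts.induct) auto

lemma conts_self: "a @ k \<in> conts a k"
  by (induction a k rule: conts.induct) auto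

lemma conts_last: "k \<in> conts a k"
  by (induction a k rule: conts.induct) auto

fun succs :: "instr list \<Rightarrow> instr list set" where
  "succs [] = {}"
| "succs (While r b # k) = {k, b @ While r b # k}"
| "succs (j # k) = {k}"

text \<open>Entering a loop prepends its body to the loop itself, and \<open>conts\<close> explores
  the body with exactly that continuation, so no further ones arise.\<close>

lemma conts_closed: "l \<in> conts a k \<Longrightarrow> l \<noteq> k \<Longrightarrow> succs l \<subseteq> conts a k"
proof (induction a k arbitrary: l rule: conts.induct)
  case (2 r b a k)
  from "2.prems" consider "l = While r b # a @ k" | "l \<in> conts b (While r b # a @ k)"
    "l \<noteq> While r b # a @ k" | "l \<in> conts a k"
    by auto
  then show ?case
  proof cases
    case 1
    then show ?thesis
      using conts_self[of a k] conts_self[of b "While r b # a @ k"] by auto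
  next
    case 2
    then show ?thesis using "2.IH"(1) by auto
  next
    case 3
    then show ?thesis using "2.IH"(2) "2.prems" by auto
  qed
qed (auto intro: conts_self)

definition keep :: "nat list \<Rightarrow> (nat \<times> move) list" where
  "keep ss = map (\<lambda>x. (x, MStay)) ss"

definition shift :: "nat list \<Rightarrow> nat \<Rightarrow> move \<Rightarrow> (nat \<times> move) list \<Rightarrow> (nat \<times> move) list" where
  "shift ss j d acts = acts[j := (ss ! j, d)]"

text \<open>Tape 0 carries the input, tape \<open>Suc r\<close> the register \<open>r\<close>, tape
  \<open>Suc K\<close> the output. Scanning 3 on a register tape is the zero test; it also makes
  \<open>Dec\<close> stop at 0.\<close>

fun trans :: "nat \<Rightarrow> instr list \<Rightarrow> nat list \<Rightarrow> instr list \<times> (nat \<times> move) list" where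
  "trans K [] ss = ([], keep ss)"
| "trans K (Inc r # k) ss = (k, shift ss (Suc r) MRight (keep ss))"
| "trans K (Dec r # k) ss =
     (k, if ss ! Suc r = 3 then keep ss else shift ss (Suc r) MLeft (keep ss))"
| "trans K (Read a b # k) ss =
     (k, if ss ! 0 = 1 then shift ss 0 MRight (shift ss (Suc a) MRight (keep ss))
         else if ss ! 0 = 2 then shift ss 0 MRight (shift ss (Suc b) MRight (keep ss))
         else keep ss)"
| "trans K (Write c # k) ss = (k, (keep ss)[Suc K := (if c then 2 else 1, MRight)])"
| "trans K (While r b # k) ss = (if ss ! Suc r = 3 then k else b @ While r b # k, keep ss)"

lemma length_trans [simp]: "length (snd (trans K k ss)) = length ss"
  by (cases "(K, k, ss)" rule: trans.cases) (auto simp: keep_def shift_def)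

lemma trans_symbols:
  assumes "set ss \<subseteq> {..<4}" and "regs k \<subseteq> {..<K}" and "length ss = K + 2"
  shows "fst ` set (snd (trans K k ss)) \<subseteq> {..<4}"
proof -
  have keep: "fst ` set (keep ss) \<subseteq> {..<4}"
    using assms(1) by (auto simp: keep_def)
  have upd: "fst ` set (acts[j := (x, d)]) \<subseteq> {..<4}"
    if "fst ` set acts \<subseteq> {..<4}" "x < 4" for acts j x d
    using that set_update_subset_insert[of acts j "(x, d)"] by fastforce
  have sh: "fst ` set (shift ss j d acts) \<subseteq> {..<4}"
    if "fst ` set acts \<subseteq> {..<4}" "j < K + 2" for acts j d
    unfolding shift_def using assms(1,3) that(2) nth_mem[of j ss]
    by (intro upd[OF that(1)]) (auto simp del: nth_mem)
  show ?thesis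
    using assms(2)
    by (cases "(K, k, ss)" rule: trans.cases) (simp_all add: keep sh upd del: image_subset_iff)
qed

section \<open>Representation of states on tapes\<close>

definition bit_tape :: "bool list \<Rightarrow> int \<Rightarrow> nat" where
  "bit_tape w = fst (input_tape (enc w))"

text \<open>The number is the head position; the content never changes and only marks cell 0, so
  that counting is moving.\<close>

definition reg_tape :: "nat \<Rightarrow> tape" where
  "reg_tape n = ((\<lambda>_. 0)(0 := 3), int n)"

definition rep :: "nat \<Rightarrow> bool list \<Rightarrow> state \<Rightarrow> tape list" where
  "rep K p = (\<lambda>(s, i, out).
     (bit_tape p, int (length p - length i)) # map (\<lambda>r. reg_tape (s r)) [0..<K] @
     [(bit_tape out, int (length out))])"

text \<open>\<open>rep\<close> computes the position of the input head from lengths only; the head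
  is on the next unread bit because the unread input is a suffix of \<open>p\<close>.\<close>

definition readable :: "bool list \<Rightarrow> state \<Rightarrow> bool" where
  "readable p st \<longleftrightarrow> (\<exists>pre. p = pre @ fst (snd st))"

lemma act_same: "act (scan tp, MStay) tp = tp"
  by (cases tp) simp

lemma act_shift: "act (scan tp, d) tp = (fst tp, snd tp + offset d)"
  by (cases tp) simp

lemma bit_tape_snoc: "(bit_tape w)(int (length w) := (if c then 2 else 1)) = bit_tape (w @ [c])"
  by (rule ext) (auto simp: bit_tape_def input_tape_def enc_def nth_append nat_less_iff)

lemma bit_tape_read:
  "bit_tape (pre @ i) (int (length pre)) = (case i of [] \<Rightarrow> 0 | c # _ \<Rightarrow> if c then 2 else 1)"
  by (cases i) (auto simp: bit_tape_def input_tape_def enc_def nth_append)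

lemma length_rep [simp]: "length (rep K p st) = K + 2"
  by (cases st) (simp add: rep_def)

lemma rep_nth:
  "rep K p (s, i, out) ! j =
     (if j = 0 then (bit_tape p, int (length p - length i))
      else if j \<le> K then reg_tape (s (j - 1))
      else if j = Suc K then (bit_tape out, int (length out)) else rep K p (s, i, out) ! j)"
  by (auto simp: rep_def nth_Cons' nth_append)

lemma scan_reg [simp]: "scan (reg_tape n) = (if n = 0 then 3 else 0)"
  by (simp add: reg_tape_def)

lemma map2_act_keep: "map2 act (keep (map scan ts)) ts = ts"
  by (rule nth_equalityI) (auto simp: keep_def act_same)

lemma map2_act_update:
  "map2 act (acts[j := a]) ts = (map2 act acts ts)[j := act a (ts ! j)]"
  if "length acts = length ts"
  using that by (cases "j < length ts") (intro nth_equalityI; auto simp: nth_list_update)+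

lemma map2_act_shift:
  assumes "length acts = length ts" and "j < length ts"
  shows "map2 act (shift (map scan ts) j d acts) ts =
     (map2 act acts ts)[j := (fst (ts ! j), snd (ts ! j) + offset d)]"
  using assms by (simp add: shift_def map2_act_update act_shift)

lemma length_shift [simp]: "length (shift ss j d acts) = length acts"
  by (simp add: shift_def)

lemma rep_upd_reg:
  assumes "r < K"
  shows "(rep K p (s, i, out))[Suc r := reg_tape n] = rep K p (s(r := n), i, out)"
  using assms by (intro nth_equalityI) (auto simp: rep_def nth_list_update nth_append nth_Cons')

lemma rep_upd_in: "(rep K p (s, i, out))[0 := (bit_tape p, int (length p - length i'))] =
    rep K p (s, i', out)"
  by (simp add: rep_def)

lemma rep_upd_read:
  assumes "r < K"
  shows "(rep K (pre @ c # i) (s, c # i, out))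
      [Suc r := reg_tape n, 0 := (bit_tape (pre @ c # i), int (length pre) + 1)] =
    rep K (pre @ c # i) (s(r := n), i, out)"
  using rep_upd_in[of K "pre @ c # i" "s(r := n)" "c # i" out i]
  by (simp add: rep_upd_reg[OF assms] add.commute)

lemma rep_upd_out: "(rep K p (s, i, out))[Suc K := (bit_tape out', int (length out'))] =
    rep K p (s, i, out')"
  by (intro nth_equalityI) (auto simp: rep_def nth_list_update nth_append nth_Cons')

lemma rep_reg [simp]: "r < K \<Longrightarrow> rep K p (s, i, out) ! Suc r = reg_tape (s r)"
  by (subst rep_nth) simp

lemma rep_in [simp]: "rep K p (s, i, out) ! 0 = (bit_tape p, int (length p - length i))"
  by (simp add: rep_def)

lemma rep_out [simp]: "rep K p (s, i, out) ! Suc K = (bit_tape out, int (length out))"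
  by (subst rep_nth) simp

lemma inc_reg: "(fst (reg_tape n), snd (reg_tape n) + 1) = reg_tape (Suc n)"
  by (simp add: reg_tape_def)

lemma dec_reg: "n \<noteq> 0 \<Longrightarrow> (fst (reg_tape n), snd (reg_tape n) - 1) = reg_tape (n - 1)"
  by (simp add: reg_tape_def)

lemma trans_step:
  assumes "regs k \<subseteq> {..<K}" and "readable p st"
  shows "trans K k (map scan (rep K p st)) =
      (fst (sstep (k, st)), snd (trans K k (map scan (rep K p st))))"
    and "map2 act (snd (trans K k (map scan (rep K p st)))) (rep K p st) =
      rep K p (snd (sstep (k, st)))"
    and "readable p (snd (sstep (k, st)))"
proof -
  obtain s i out where st: "st = (s, i, out)" by (cases st)
  with assms(2) obtain pre where p: "p = pre @ i" by (auto simp: readable_def)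
  have len: "length (keep (map scan (rep K p st))) = length (rep K p st)"
    by (simp add: keep_def)
  have in0: "scan (rep K p (s, i, out) ! 0) =
      (case i of [] \<Rightarrow> 0 | c # _ \<Rightarrow> if c then 2 else 1)"
    by (simp add: p bit_tape_read)
  have "prod.fst (trans K k (map scan (rep K p st))) = fst (sstep (k, st)) \<and>
     map2 act (snd (trans K k (map scan (rep K p st)))) (rep K p st) = rep K p (snd (sstep (k, st)))
     \<and> readable p (snd (sstep (k, st)))"
  proof (cases "(k, st)" rule: sstep.cases)
    case (1 st')
    then show ?thesis using assms(2) by (simp add: map2_act_keep)
  next
    case (2 r k' s' i' out')
    then show ?thesis using assms len
      by (simp add: map2_act_shift map2_act_keep inc_reg rep_upd_reg readable_def
          del: prod.collapse)
  next
    case (3 r k' s' i' out')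
    then show ?thesis using assms len
      by (auto simp: map2_act_shift map2_act_keep dec_reg rep_upd_reg readable_def
          fun_upd_idem simp del: prod.collapse One_nat_def)
  next
    case (4 a b k' s' out')
    then show ?thesis using assms in0 st
      by (simp add: map2_act_keep)
  next
    case (5 a b k' s' c i' out')
    have pre: "p = pre @ c # i'" using p 5 st by simp
    show ?thesis using 5 assms len in0 st unfolding pre
      by (auto simp: map2_act_shift map2_act_keep inc_reg rep_upd_read readable_def)
  next
    case (6 c k' s' i' out')
    have "(rep K p (s, i, out))[Suc K := ((bit_tape out)(int (length out) := if c then 2 else 1),
        int (length out) + 1)] = rep K p (s, i, out @ [c])"
      using rep_upd_out[of K p s i out "out @ [c]"] by (simp add: bit_tape_snoc add.commute)
    then show ?thesis using 6 assms len st
      by (simp add: map2_act_update map2_act_keep readable_def)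
  next
    case (7 r b k' s' i' out')
    then show ?thesis using assms
      by (simp add: map2_act_keep readable_def)
  qed
  then show "trans K k (map scan (rep K p st)) =
      (fst (sstep (k, st)), snd (trans K k (map scan (rep K p st))))"
    and "map2 act (snd (trans K k (map scan (rep K p st)))) (rep K p st) =
      rep K p (snd (sstep (k, st)))"
    and "readable p (snd (sstep (k, st)))"
    by (auto intro: prod_eqI)
qed

lemma trans_succs: "k \<noteq> [] \<Longrightarrow> fst (trans K k ss) \<in> succs k"
  by (cases "(K, k, ss)" rule: trans.cases) auto

lemma regs_succs: "l \<in> succs k \<Longrightarrow> regs l \<subseteq> regs k"
  by (cases k rule: succs.cases) auto

text \<open>The states are the finitely many continuations. State 0 is extra: its single step writes
  the zero marker on the register tapes, which start blank. State \<open>Suc (f k)\<close> stands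
  for the continuation \<open>k\<close>.\<close>

theorem compile:
  obtains V where "wf_tm V"
    and "\<And>p t s i out. (sstep ^^ t) (P, (\<lambda>_. 0), p, []) = ([], s, i, out) \<Longrightarrow>
           tm_fun V p = Some out"
proof -
  define K where "K = Suc (Max (insert 0 (regs P)))"
  have K: "regs P \<subseteq> {..<K}"
    using Max_ge[OF finite.insertI[OF finite_regs[of P]], of _ 0]
    by (auto simp: K_def less_Suc_eq_le)
  define Q where "Q = {k \<in> conts P []. regs k \<subseteq> {..<K}}"
  have PQ: "P \<in> Q" "[] \<in> Q"
    using conts_self[of P "[]"] conts_last[of "[]" P] K by (auto simp: Q_def)
  have closed: "succs k \<subseteq> Q" if "k \<in> Q" "k \<noteq> []" for k
    using that conts_closed[of k P "[]"] regs_succs[of _ k] by (fastforce simp: Q_def)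
  have "finite (Q - {[]})" using finite_conts[of P "[]"] by (simp add: Q_def)
  from finite_imp_inj_to_nat_seg[OF this] obtain f0 N where
    f0: "f0 ` (Q - {[]}) = {j. j < (N::nat)}" "inj_on f0 (Q - {[]})" by metis
  \<comment> \<open>The empty continuation gets the largest number, since \<open>wf_tm\<close>
    places the halting state above all others.\<close>
  define f where "f k = (if k = [] then N else f0 k)" for k
  have fN: "f k < N \<longleftrightarrow> k \<noteq> []" if "k \<in> Q" for k
    using that f0(1) by (auto simp: f_def)
  have inj: "inj_on f Q"
  proof (rule inj_onI)
    fix x y
    assume xy: "x \<in> Q" "y \<in> Q" "f x = f y"
    then have "x = [] \<longleftrightarrow> y = []" using fN[of x] fN[of y] by metis
    then show "x = y"
      using xy inj_onD[OF f0(2), of x y] by (cases "x = []") (auto simp: f_def)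
  qed
  have surj: "f ` Q = {..N}"
  proof -
    have "f ` Q = insert N (f0 ` (Q - {[]}))" using PQ by (auto simp: f_def)
    then show ?thesis using f0 by auto
  qed
  define g where "g = inv_into Q f"
  have gf: "g (f k) = k" if "k \<in> Q" for k using inj that by (simp add: g_def)
  have gQ: "g j \<in> Q" "f (g j) = j" if "j \<le> N" for j
    using that surj by (auto simp: g_def inv_into_into f_inv_into_f)
  define init where "init ss = keep (take 1 ss) @ replicate K (3::nat, MStay) @ keep (drop (Suc K) ss)"
    for ss
  define V where "V = \<lparr>tape_count = K + 2, alphabet_size = 4, halt_state = Suc N,
     transition = (\<lambda>q ss. if q = 0 then (Suc (f P), init ss)
        else let a = trans K (g (q - 1)) ss in (Suc (f (prod.fst a)), snd a))\<rparr>"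
  have fle: "f k \<le> N" if "k \<in> Q" for k using that surj by auto
  have wf: "wf_tm V"
    unfolding wf_tm_def
  proof (intro conjI allI impI)
    fix q ss
    assume q: "q < halt_state V" and ss: "length ss = tape_count V" "set ss \<subseteq> {..<alphabet_size V}"
    show "case transition V q ss of (q', acts) \<Rightarrow> q' \<le> halt_state V \<and> length acts = tape_count V \<and>
       fst ` set acts \<subseteq> {..<alphabet_size V}"
    proof (cases "q = 0")
      case True
      have "fst ` set (init ss) \<subseteq> {..<4}"
        using ss(2) by (auto simp: init_def keep_def V_def dest!: in_set_takeD in_set_dropD)
      moreover have "length (init ss) = K + 2"
        using ss(1) by (simp add: init_def keep_def V_def)
      ultimately show ?thesis using True fle[OF PQ(1)] by (simp add: V_def)
    next
      case False
      let ?k = "g (q - 1)"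
      have k: "?k \<in> Q" "?k \<noteq> []"
        using False q gQ[of "q - 1"] fN[of ?k] by (auto simp: V_def)
      then have "fst (trans K ?k ss) \<in> Q" using trans_succs closed by blast
      then show ?thesis
        using False ss fle trans_symbols[of ss ?k K] k by (simp add: V_def Let_def Q_def)
    qed
  qed (simp_all add: V_def)
  have "tm_fun V p = Some out"
    if "(sstep ^^ t) (P, (\<lambda>_. 0), p, []) = ([], s, i, out)" for p t s i out
  proof -
    have st0: "step V (start V (enc p)) = (Suc (f P), rep K p ((\<lambda>_. 0), p, []))"
    proof -
      have r: "rep K p ((\<lambda>_. 0), p, []) =
          input_tape (enc p) # replicate K (reg_tape 0) @ [blank_tape]"
        by (auto simp: rep_def map_replicate_const bit_tape_def input_tape_def blank_tape_def enc_def)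
      have *: "map scan (input_tape (enc p) # replicate (Suc K) blank_tape) =
         scan (input_tape (enc p)) # replicate (Suc K) 0"
        by (simp add: blank_tape_def)
      have i: "init (scan (input_tape (enc p)) # replicate (Suc K) 0) =
         (scan (input_tape (enc p)), MStay) # replicate K (3, MStay) @ [(0, MStay)]"
        by (simp add: init_def keep_def drop_Cons' flip: replicate_Suc)
          (cases K; simp)
      have r2: "replicate (Suc K) blank_tape = replicate K blank_tape @ [blank_tape]"
        by (metis replicate_append_same replicate_Suc)
      have z: "map2 act (replicate K (3, MStay) @ [(0, MStay)]) (replicate K blank_tape @ [blank_tape])
         = replicate K (reg_tape 0) @ [blank_tape]"
        by (simp add: zip_replicate blank_tape_def reg_tape_def map_replicate fun_upd_idem)
      have tr: "transition V 0 ss = (Suc (f P), init ss)" for ss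
        by (simp add: V_def)
      have "start V (enc p) = (0, input_tape (enc p) # replicate (Suc K) blank_tape)"
        by (simp add: start_def V_def)
      moreover have "halt_state V \<noteq> 0" by (simp add: V_def)
      ultimately have "step V (start V (enc p)) = (Suc (f P), map2 act
         (init (map scan (input_tape (enc p) # replicate (Suc K) blank_tape)))
           (input_tape (enc p) # replicate (Suc K) blank_tape))"
        by (simp add: tr)
      then show ?thesis unfolding * unfolding i r2 r by (simp only: list.map zip_Cons_Cons z
          prod.case act_same)
    qed
    have steps: "(step V ^^ t) (Suc (f P), rep K p ((\<lambda>_. 0), p, [])) =
        (Suc (f (fst ((sstep ^^ t) (P, (\<lambda>_. 0), p, [])))),
          rep K p (snd ((sstep ^^ t) (P, (\<lambda>_. 0), p, [])))) \<and>
        fst ((sstep ^^ t) (P, (\<lambda>_. 0), p, [])) \<in> Q \<and>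
        readable p (snd ((sstep ^^ t) (P, (\<lambda>_. 0), p, [])))" for t
    proof (induction t)
      case 0
      then show ?case using PQ by (simp add: readable_def)
    next
      case (Suc t)
      obtain k st where kst: "(sstep ^^ t) (P, (\<lambda>_. 0), p, []) = (k, st)" by (meson surj_pair)
      with Suc have k: "k \<in> Q" "readable p st" by auto
      have kK: "regs k \<subseteq> {..<K}" using k by (simp add: Q_def)
      show ?case
      proof (cases "k = []")
        case True
        then show ?thesis using Suc kst by (simp add: f_def V_def)
      next
        case False
        note ts = trans_step[OF kK k(2)]
        have "fst (sstep (k, st)) \<in> succs k"
          using trans_succs[OF False, of K "map scan (rep K p st)"] by (subst (asm) ts(1)) simp
        then have "fst (sstep (k, st)) \<in> Q" using closed k False by blast
        moreover have "step V (Suc (f k), rep K p st) =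
          (Suc (f (fst (sstep (k, st)))), rep K p (snd (sstep (k, st))))"
        proof -
          have "transition V (Suc (f k)) (map scan (rep K p st)) =
            (Suc (f (fst (sstep (k, st)))), snd (trans K k (map scan (rep K p st))))"
            by (simp add: V_def gf[OF k(1)] Let_def) (subst ts(1), simp)
          moreover have "Suc (f k) \<noteq> halt_state V" using fN[OF k(1)] False by (simp add: V_def)
          ultimately show ?thesis by (simp add: ts(2))
        qed
        ultimately show ?thesis using Suc kst ts(3) by simp
      qed
    qed
    have "(step V ^^ Suc t) (start V (enc p)) = (Suc N, rep K p (s, i, out))"
      using steps[of t] that st0 by (simp add: funpow_swap1 f_def)
    moreover have "holds_word (last (rep K p (s, i, out))) (enc out)"
      by (auto simp: rep_def holds_word_def bit_tape_def input_tape_def enc_def)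
    ultimately have "outputs_within V (enc p) (enc out) (Suc t)"
      unfolding outputs_within_def by (simp add: V_def)
    then show ?thesis by (auto simp: tm_fun_eq_Some_iff outputs_def)
  qed
  with wf show ?thesis by (rule that)
qed

text \<open>Quantifying over every continuation \<open>k\<close> makes executions compose:
  \<open>run_append\<close> merely concatenates step sequences.\<close>

definition run :: "instr list \<Rightarrow> state \<Rightarrow> state \<Rightarrow> bool" where
  "run c st st' \<longleftrightarrow> (\<forall>k. \<exists>t. (sstep ^^ t) (c @ k, st) = (k, st'))"

definition prun :: "instr list \<Rightarrow> (nat \<Rightarrow> nat) \<Rightarrow> (nat \<Rightarrow> nat) \<Rightarrow> bool" where
  "prun c s s' \<longleftrightarrow> (\<forall>i out. run c (s, i, out) (s', i, out))"

lemma run_Nil: "run [] s s"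
  unfolding run_def by (intro allI exI[of _ 0]) simp

lemma run_Nil_eq: "s = t \<Longrightarrow> run [] s t"
  by (simp add: run_Nil)

lemma run_append: "run a s t \<Longrightarrow> run b t u \<Longrightarrow> run (a @ b) s u"
  unfolding run_def
proof
  fix k
  assume "\<forall>k. \<exists>n. (sstep ^^ n) (a @ k, s) = (k, t)" "\<forall>k. \<exists>n. (sstep ^^ n) (b @ k, t) = (k, u)"
  then obtain n m where "(sstep ^^ n) (a @ (b @ k), s) = (b @ k, t)" "(sstep ^^ m) (b @ k, t) = (k, u)"
    by metis
  then have "(sstep ^^ (m + n)) ((a @ b) @ k, s) = (k, u)" by (simp add: funpow_add)
  then show "\<exists>n. (sstep ^^ n) ((a @ b) @ k, s) = (k, u)" by blast
qed

lemma run_step: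
  assumes "\<And>k. sstep (c @ k, s) = (b @ k, t)" and "run b t u"
  shows "run c s u"
  unfolding run_def
proof
  fix k
  obtain n where "(sstep ^^ n) (b @ k, t) = (k, u)" using assms(2) unfolding run_def by blast
  then have "(sstep ^^ Suc n) (c @ k, s) = (k, u)" by (simp add: assms(1) funpow_swap1)
  then show "\<exists>n. (sstep ^^ n) (c @ k, s) = (k, u)" by blast
qed

lemma run_Inc: "run k (s(r := Suc (s r)), i, out) u \<Longrightarrow> run (Inc r # k) (s, i, out) u"
  by (rule run_step) auto

lemma run_Dec: "run k (s(r := s r - 1), i, out) u \<Longrightarrow> run (Dec r # k) (s, i, out) u"
  by (rule run_step) auto

lemma run_Write: "run k (s, i, out @ [c]) u \<Longrightarrow> run (Write c # k) (s, i, out) u"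
  by (rule run_step) auto

lemma run_Read_Nil: "run k (s, [], out) u \<Longrightarrow> run (Read a b # k) (s, [], out) u"
  by (rule run_step) auto

lemma run_Read_Cons:
  "run k (if c then s(b := Suc (s b)) else s(a := Suc (s a)), i, out) u \<Longrightarrow>
   run (Read a b # k) (s, c # i, out) u"
  by (rule run_step) auto

lemma run_While_0: "s r = 0 \<Longrightarrow> run k (s, i, out) u \<Longrightarrow> run (While r b # k) (s, i, out) u"
  by (rule run_step) auto

lemma run_While_1:
  "s r \<noteq> 0 \<Longrightarrow> run (b @ While r b # k) (s, i, out) u \<Longrightarrow> run (While r b # k) (s, i, out) u"
  by (rule run_step) auto

lemma prun_Nil: "s = t \<Longrightarrow> prun [] s t"
  by (simp add: prun_def run_Nil)

lemma prun_append: "prun a s t \<Longrightarrow> prun b t u \<Longrightarrow> prun (a @ b) s u"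
  unfolding prun_def using run_append by blast

lemma prun_Inc: "prun k (s(r := Suc (s r))) u \<Longrightarrow> prun (Inc r # k) s u"
  by (simp add: prun_def run_Inc)

lemma prun_Dec: "prun k (s(r := s r - 1)) u \<Longrightarrow> prun (Dec r # k) s u"
  by (simp add: prun_def run_Dec)

lemma prun_While_0: "s r = 0 \<Longrightarrow> prun k s u \<Longrightarrow> prun (While r b # k) s u"
  by (simp add: prun_def run_While_0)

lemma prun_While_1: "s r \<noteq> 0 \<Longrightarrow> prun (b @ While r b # k) s u \<Longrightarrow> prun (While r b # k) s u"
  by (simp add: prun_def run_While_1)

lemma prun_eq: "prun c s t \<Longrightarrow> t = u \<Longrightarrow> prun c s u"
  by simp

text \<open>The invariant has to determine the whole state on exit, so that the final state
  \<open>t\<close> can be named in advance.\<close>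

lemma prun_loop:
  assumes "\<And>s. I s \<Longrightarrow> s r \<noteq> 0 \<Longrightarrow> \<exists>s'. prun b s s' \<and> I s' \<and> m s' < (m s :: nat)"
    and "I s" and "\<And>s. I s \<Longrightarrow> s r = 0 \<Longrightarrow> s = t"
  shows "prun [While r b] s t"
  using assms(2)
proof (induction "m s" arbitrary: s rule: less_induct)
  case less
  show ?case
  proof (cases "s r = 0")
    case True
    then show ?thesis using assms(3) less.prems by (intro prun_While_0 prun_Nil) auto
  next
    case False
    then obtain s' where s': "prun b s s'" "I s'" "m s' < m s"
      using assms(1) less.prems by blast
    then have "prun [While r b] s' t" using less.hyps by blast
    with s' False show ?thesis by (intro prun_While_1) (auto intro: prun_append)
  qed
qed

section \<open>Arithmetic on registers\<close>

definition mv :: "nat \<Rightarrow> nat \<Rightarrow> instr list" where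
  "mv a b = [While a [Dec a, Inc b]]"

lemma prun_mv: "a \<noteq> b \<Longrightarrow> prun (mv a b) s (s(b := s b + s a, a := 0))"
  unfolding mv_def
proof (rule prun_loop[where m = "\<lambda>t. t a" and
      I = "\<lambda>t. t a + t b = s a + s b \<and> (\<forall>j. j \<noteq> a \<longrightarrow> j \<noteq> b \<longrightarrow> t j = s j)"])
  fix t
  assume "a \<noteq> b" "t a + t b = s a + s b \<and> (\<forall>j. j \<noteq> a \<longrightarrow> j \<noteq> b \<longrightarrow> t j = s j)" "t a \<noteq> 0"
  then show "\<exists>s'. prun [Dec a, Inc b] t s' \<and>
     (s' a + s' b = s a + s b \<and> (\<forall>j. j \<noteq> a \<longrightarrow> j \<noteq> b \<longrightarrow> s' j = s j)) \<and> s' a < t a"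
    by (intro exI[of _ "t(a := t a - 1, b := Suc (t b))"] conjI prun_Dec prun_Inc prun_Nil) auto
qed (auto simp: fun_eq_iff)

definition clr :: "nat \<Rightarrow> instr list" where
  "clr a = [While a [Dec a]]"

lemma prun_clr: "prun (clr a) s (s(a := 0))"
  unfolding clr_def
proof (rule prun_loop[where m = "\<lambda>t. t a" and I = "\<lambda>t. \<forall>j. j \<noteq> a \<longrightarrow> t j = s j"])
  fix t
  assume "\<forall>j. j \<noteq> a \<longrightarrow> t j = s j" "t a \<noteq> 0"
  then show "\<exists>s'. prun [Dec a] t s' \<and> (\<forall>j. j \<noteq> a \<longrightarrow> s' j = s j) \<and> s' a < t a"
    by (intro exI[of _ "t(a := t a - 1)"] conjI prun_Dec prun_Nil) auto
qed (auto simp: fun_eq_iff)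

lemma prun_add2:
  assumes "a \<noteq> b" "a \<noteq> c" "b \<noteq> c"
  shows "prun [While a [Dec a, Inc b, Inc c]] s (s(b := s b + s a, c := s c + s a, a := 0))"
proof (rule prun_loop[where m = "\<lambda>t. t a" and
      I = "\<lambda>t. t a + t b = s a + s b \<and> t a + t c = s a + s c \<and>
        (\<forall>j. j \<noteq> a \<longrightarrow> j \<noteq> b \<longrightarrow> j \<noteq> c \<longrightarrow> t j = s j)"])
  fix t
  assume "t a + t b = s a + s b \<and> t a + t c = s a + s c \<and>
        (\<forall>j. j \<noteq> a \<longrightarrow> j \<noteq> b \<longrightarrow> j \<noteq> c \<longrightarrow> t j = s j)" "t a \<noteq> 0"
  then show "\<exists>s'. prun [Dec a, Inc b, Inc c] t s' \<and> (s' a + s' b = s a + s b \<and> s' a + s' c = s a + s c \<and>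
        (\<forall>j. j \<noteq> a \<longrightarrow> j \<noteq> b \<longrightarrow> j \<noteq> c \<longrightarrow> s' j = s j)) \<and> s' a < t a"
    using assms
    by (intro exI[of _ "t(a := t a - 1, b := Suc (t b), c := Suc (t c))"] conjI prun_Dec prun_Inc
        prun_Nil) auto
qed (auto simp: fun_eq_iff)

definition cp :: "nat \<Rightarrow> nat \<Rightarrow> nat \<Rightarrow> instr list" where
  "cp a b t = [While a [Dec a, Inc b, Inc t]] @ mv t a"

lemma prun_cp:
  assumes "a \<noteq> b" "a \<noteq> t" "b \<noteq> t" "s t = 0"
  shows "prun (cp a b t) s (s(b := s b + s a))"
proof -
  have "prun (cp a b t) s (s(b := s b + s a, t := s t + s a, a := 0, a := 0 + (s t + s a), t := 0))"
    unfolding cp_def using assms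
    by (intro prun_append[OF prun_add2] prun_eq[OF prun_mv]) simp_all
  then show ?thesis apply (rule prun_eq) using assms by (simp add: fun_eq_iff)
qed

definition mkpair :: "nat \<Rightarrow> instr list" where
  "mkpair b = [While b [Dec b, Inc (b + 1), Inc (b + 2)]] @
     [While (b + 1) (cp (b + 1) (b + 2) (b + 3) @ [Dec (b + 1)])] @ mv (b + 2) b"

text \<open>By \<open>prod_encode (x, y) = triangle (x + y) + x\<close>: the first loop forms
  \<open>x + y\<close> and keeps a copy of \<open>x\<close>, to which the second adds
  \<open>x + y\<close>, \<open>x + y - 1\<close>, down to 1.\<close>

lemma prun_mkpair:
  assumes "\<forall>j > b + 1. s j = 0"
  shows "prun (mkpair b) s (s(b := prod_encode (s b, s (b + 1)), b + 1 := 0))"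
  unfolding mkpair_def
proof (intro prun_append)
  let ?t = "s(b + 1 := s (b + 1) + s b, b + 2 := s b, b := 0)"
  show "prun [While b [Dec b, Inc (b + 1), Inc (b + 2)]] s ?t"
    by (rule prun_eq[OF prun_add2]) (use assms in \<open>simp_all add: fun_eq_iff\<close>)
  let ?u = "s(b + 1 := 0, b + 2 := triangle (s b + s (b + 1)) + s b, b := 0)"
  show "prun [While (b + 1) (cp (b + 1) (b + 2) (b + 3) @ [Dec (b + 1)])] ?t ?u"
  proof (rule prun_loop[where m = "\<lambda>t. t (b + 1)" and
        I = "\<lambda>t. t (b + 2) + triangle (t (b + 1)) = triangle (s b + s (b + 1)) + s b \<and>
           (\<forall>j. j \<noteq> b + 1 \<longrightarrow> j \<noteq> b + 2 \<longrightarrow> t j = ?u j)"])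
    fix t
    assume t: "t (b + 2) + triangle (t (b + 1)) = triangle (s b + s (b + 1)) + s b \<and>
           (\<forall>j. j \<noteq> b + 1 \<longrightarrow> j \<noteq> b + 2 \<longrightarrow> t j = ?u j)" "t (b + 1) \<noteq> 0"
    then obtain k where k: "t (b + 1) = Suc k" using not0_implies_Suc by blast
    have "t (b + 3) = 0" using t assms by simp
    let ?v = "t(b + 2 := t (b + 2) + Suc k, b + 1 := k)"
    have "prun (cp (b + 1) (b + 2) (b + 3) @ [Dec (b + 1)]) t ?v"
      by (rule prun_append[OF prun_cp prun_Dec[OF prun_Nil]])
        (use \<open>t (b + 3) = 0\<close> k in \<open>simp_all add: fun_eq_iff\<close>)
    with t k show "\<exists>s'. prun (cp (b + 1) (b + 2) (b + 3) @ [Dec (b + 1)]) t s' \<and>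
       (s' (b + 2) + triangle (s' (b + 1)) = triangle (s b + s (b + 1)) + s b \<and>
           (\<forall>j. j \<noteq> b + 1 \<longrightarrow> j \<noteq> b + 2 \<longrightarrow> s' j = ?u j)) \<and> s' (b + 1) < t (b + 1)"
      by (intro exI[of _ ?v] conjI) (simp_all add: triangle_Suc)
  qed (use assms in \<open>auto simp: fun_eq_iff add.commute\<close>)
  show "prun (mv (b + 2) b) ?u (s(b := prod_encode (s b, s (b + 1)), b + 1 := 0))"
    by (rule prun_eq[OF prun_mv]) (use assms in \<open>auto simp: fun_eq_iff prod_encode_def\<close>)
qed

text \<open>Replaces the pair in the registers \<open>x\<close> and \<open>x + 1\<close> by the pair with the next code.\<close>

definition next_pair :: "nat \<Rightarrow> instr list" where
  "next_pair x = Inc (x + 2) # While (x + 1) ([Dec (x + 1), Inc x, Dec (x + 2)] @ mv (x + 1) (x + 3)) #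
     While (x + 2) ([Dec (x + 2)] @ mv x (x + 3) @ [Inc (x + 3)]) # mv (x + 3) (x + 1)"

text \<open>Register \<open>x + 2\<close> is the flag of an if-else: it is set first and cleared by
  the first branch, and the second branch runs only if it is still set.\<close>

lemma prun_next_pair:
  assumes "s (x + 2) = 0" "s (x + 3) = 0"
  shows "prun (next_pair x) s (if s (x + 1) = 0 then s(x := 0, x + 1 := Suc (s x))
     else s(x := Suc (s x), x + 1 := s (x + 1) - 1))"
proof (cases "s (x + 1) = 0")
  case True
  let ?t = "s(x := 0, x + 3 := Suc (s x))"
  have "prun ([Dec (x + 2)] @ mv x (x + 3) @ [Inc (x + 3)]) (s(x + 2 := Suc 0)) ?t"
    unfolding append_Cons append_Nil
    by (rule prun_Dec, rule prun_append[OF prun_mv prun_Inc[OF prun_Nil]])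
      (use assms in \<open>simp_all add: fun_eq_iff\<close>)
  moreover have "prun (While (x + 2) ([Dec (x + 2)] @ mv x (x + 3) @ [Inc (x + 3)]) #
      mv (x + 3) (x + 1)) ?t (s(x := 0, x + 1 := Suc (s x)))"
    by (rule prun_While_0[OF _ prun_eq[OF prun_mv]])
      (use assms True in \<open>simp_all add: fun_eq_iff\<close>)
  ultimately have "prun (While (x + 2) ([Dec (x + 2)] @ mv x (x + 3) @ [Inc (x + 3)]) #
      mv (x + 3) (x + 1)) (s(x + 2 := Suc 0)) (s(x := 0, x + 1 := Suc (s x)))"
    using prun_While_1[OF _ prun_append] by simp
  then show ?thesis
    unfolding next_pair_def using True assms by (simp add: prun_Inc prun_While_0)
next
  case False
  let ?t = "s(x := Suc (s x), x + 1 := 0, x + 3 := s (x + 1) - 1)"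
  have "prun ([Dec (x + 1), Inc x, Dec (x + 2)] @ mv (x + 1) (x + 3)) (s(x + 2 := Suc 0)) ?t"
    unfolding append_Cons append_Nil
    by (rule prun_Dec, rule prun_Inc, rule prun_Dec, rule prun_eq[OF prun_mv])
      (use assms in \<open>simp_all add: fun_eq_iff\<close>)
  moreover have "prun (While (x + 1) ([Dec (x + 1), Inc x, Dec (x + 2)] @ mv (x + 1) (x + 3)) #
     While (x + 2) ([Dec (x + 2)] @ mv x (x + 3) @ [Inc (x + 3)]) # mv (x + 3) (x + 1)) ?t
     (s(x := Suc (s x), x + 1 := s (x + 1) - 1))"
    by (rule prun_While_0[OF _ prun_While_0[OF _ prun_eq[OF prun_mv]]])
      (use assms in \<open>simp_all add: fun_eq_iff\<close>)
  ultimately have "prun (next_pair x) s (s(x := Suc (s x), x + 1 := s (x + 1) - 1))"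
    unfolding next_pair_def using False assms
      prun_Inc[OF prun_While_1[OF _ prun_append], of s "x + 2" "x + 1"] by simp
  then show ?thesis using False by simp
qed

lemma prod_encode_next:
  "prod_encode (if y = 0 then (0, Suc x) else (Suc x, y - 1)) = Suc (prod_encode (x, y))"
  by (cases y) (auto simp: prod_encode_def)

definition unpair :: "nat \<Rightarrow> instr list" where
  "unpair b = [While b (Dec b # next_pair (b + 1))] @ mv (b + 1) b @ mv (b + 2) (b + 1)"

text \<open>Decoding by counting: the pair (0, 0) has code 0, and the next pair is taken as often as
  the code says.\<close>

lemma prun_unpair:
  assumes "\<forall>j > b. s j = 0"
  shows "prun (unpair b) s (s(b := fst (prod_decode (s b)), b + 1 := snd (prod_decode (s b))))"
  unfolding unpair_def
proof (intro prun_append)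
  let ?x = "fst (prod_decode (s b))" and ?y = "snd (prod_decode (s b))"
  have n: "s b = prod_encode (?x, ?y)" by simp
  let ?t = "s(b := 0, b + 1 := ?x, b + 2 := ?y)"
  show "prun [While b (Dec b # next_pair (b + 1))] s ?t"
  proof (rule prun_loop[where m = "\<lambda>t. t b" and
        I = "\<lambda>t. prod_encode (t (b + 1), t (b + 2)) + t b = s b \<and>
           (\<forall>j. j \<noteq> b \<longrightarrow> j \<noteq> b + 1 \<longrightarrow> j \<noteq> b + 2 \<longrightarrow> t j = s j)"])
    fix t
    assume t: "prod_encode (t (b + 1), t (b + 2)) + t b = s b \<and>
           (\<forall>j. j \<noteq> b \<longrightarrow> j \<noteq> b + 1 \<longrightarrow> j \<noteq> b + 2 \<longrightarrow> t j = s j)" "t b \<noteq> 0"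
    let ?t = "t(b := t b - 1)"
    let ?u = "if t (b + 2) = 0 then ?t(b + 1 := 0, b + 2 := Suc (t (b + 1)))
       else ?t(b + 1 := Suc (t (b + 1)), b + 2 := t (b + 2) - 1)"
    have "prun (next_pair (b + 1)) ?t ?u"
      by (rule prun_eq[OF prun_next_pair]) (use t assms in auto)
    then have "prun (Dec b # next_pair (b + 1)) t ?u" by (rule prun_Dec)
    moreover have "prod_encode (?u (b + 1), ?u (b + 2)) = Suc (prod_encode (t (b + 1), t (b + 2)))"
      using prod_encode_next[of "t (b + 2)" "t (b + 1)"] by (auto split: if_splits)
    ultimately show "\<exists>s'. prun (Dec b # next_pair (b + 1)) t s' \<and>
       (prod_encode (s' (b + 1), s' (b + 2)) + s' b = s b \<and>
           (\<forall>j. j \<noteq> b \<longrightarrow> j \<noteq> b + 1 \<longrightarrow> j \<noteq> b + 2 \<longrightarrow> s' j = s j)) \<and> s' b < t b"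
      using t by (intro exI[of _ ?u]) auto
  next
    show "prod_encode (s (b + 1), s (b + 2)) + s b = s b \<and>
           (\<forall>j. j \<noteq> b \<longrightarrow> j \<noteq> b + 1 \<longrightarrow> j \<noteq> b + 2 \<longrightarrow> s j = s j)"
      using assms by (simp add: prod_encode_def)
  next
    fix t
    assume t: "prod_encode (t (b + 1), t (b + 2)) + t b = s b \<and>
           (\<forall>j. j \<noteq> b \<longrightarrow> j \<noteq> b + 1 \<longrightarrow> j \<noteq> b + 2 \<longrightarrow> t j = s j)" "t b = 0"
    then have "prod_decode (s b) = (t (b + 1), t (b + 2))"
      by (metis add.right_neutral prod_encode_inverse)
    then show "t = ?t" using t by (simp_all add: fun_eq_iff)
  qed
  show "prun (mv (b + 1) b) ?t (s(b := ?x, b + 1 := 0, b + 2 := ?y))"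
    by (rule prun_eq[OF prun_mv]) (simp_all add: fun_eq_iff)
  show "prun (mv (b + 2) (b + 1)) (s(b := ?x, b + 1 := 0, b + 2 := ?y))
      (s(b := fst (prod_decode (s b)), b + 1 := snd (prod_decode (s b))))"
    by (rule prun_eq[OF prun_mv]) (use assms in \<open>simp_all add: fun_eq_iff\<close>)
qed

subsection \<open>Functions computed in place\<close>

text \<open>The argument and the value are in register \<open>b\<close>; the registers above it are scratch space,
  zero before and after.\<close>

definition computes :: "nat \<Rightarrow> instr list \<Rightarrow> (nat \<Rightarrow> nat) \<Rightarrow> bool" where
  "computes b c f \<longleftrightarrow> (\<forall>s. (\<forall>j > b. s j = 0) \<longrightarrow> prun c s (s(b := f (s b))))"

definition cfun :: "(nat \<Rightarrow> nat) \<Rightarrow> bool" where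
  "cfun f \<longleftrightarrow> (\<forall>b. \<exists>c. computes b c f)"

lemma cfun_zero: "cfun (\<lambda>_. 0)"
  unfolding cfun_def computes_def using prun_clr by blast

lemma cfun_id: "cfun (\<lambda>x. x)"
  unfolding cfun_def computes_def using prun_Nil by (metis fun_upd_triv)

lemma cfun_Suc: "cfun Suc"
  unfolding cfun_def computes_def using prun_Inc[OF prun_Nil[OF refl]] by blast

lemma cfun_pred: "cfun (\<lambda>x. x - 1)"
  unfolding cfun_def computes_def using prun_Dec[OF prun_Nil[OF refl]] by blast

lemma computesD:
  assumes "computes b c f" and "\<forall>j > b. s j = 0" and "t = s(b := f (s b))"
  shows "prun c s t"
  using assms by (auto simp: computes_def)

lemma cfun_comp:
  assumes "cfun f" "cfun g"
  shows "cfun (\<lambda>x. f (g x))"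
  unfolding cfun_def
proof
  fix b
  from assms obtain c d where c: "computes b c f" and d: "computes b d g"
    unfolding cfun_def by blast
  have "prun (d @ c) s (s(b := f (g (s b))))" if s: "\<forall>j > b. s j = 0" for s
  proof (rule prun_append)
    show "prun d s (s(b := g (s b)))" by (rule computesD[OF d s refl])
    show "prun c (s(b := g (s b))) (s(b := f (g (s b))))"
      by (rule computesD[OF c]) (use s in simp_all)
  qed
  then have "computes b (d @ c) (\<lambda>x. f (g x))" by (simp add: computes_def)
  then show "\<exists>c. computes b c (\<lambda>x. f (g x))" by blast
qed

lemma cfun_pair:
  assumes "cfun f" "cfun g"
  shows "cfun (\<lambda>x. prod_encode (f x, g x))"
  unfolding cfun_def
proof
  fix b
  from assms obtain c d where c: "computes (b + 1) c f" and d: "computes (b + 1) d g"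
    unfolding cfun_def by blast
  have "computes b (cp b (b + 1) (b + 2) @ c @ mv b (b + 2) @ mv (b + 1) b @ mv (b + 2) (b + 1) @
     d @ mkpair b) (\<lambda>x. prod_encode (f x, g x))" (is "computes b ?p _")
    unfolding computes_def
  proof (intro allI impI)
    fix s :: "nat \<Rightarrow> nat"
    assume s: "\<forall>j > b. s j = 0"
    let ?x = "s b"
    show "prun ?p s (s(b := prod_encode (f ?x, g ?x)))"
    proof (intro prun_append)
      show "prun (cp b (b + 1) (b + 2)) s (s(b + 1 := ?x))"
        by (rule prun_eq[OF prun_cp]) (use s in auto)
      show "prun c (s(b + 1 := ?x)) (s(b + 1 := f ?x))"
        by (rule computesD[OF c]) (use s in auto)
      show "prun (mv b (b + 2)) (s(b + 1 := f ?x)) (s(b + 1 := f ?x, b + 2 := ?x, b := 0))"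
        by (rule prun_eq[OF prun_mv]) (use s in auto)
      show "prun (mv (b + 1) b) (s(b + 1 := f ?x, b + 2 := ?x, b := 0)) (s(b + 2 := ?x, b := f ?x))"
        by (rule prun_eq[OF prun_mv]) (use s in \<open>simp_all add: fun_eq_iff\<close>)
      show "prun (mv (b + 2) (b + 1)) (s(b + 2 := ?x, b := f ?x)) (s(b + 1 := ?x, b := f ?x))"
        by (rule prun_eq[OF prun_mv]) (use s in \<open>simp_all add: fun_eq_iff\<close>)
      show "prun d (s(b + 1 := ?x, b := f ?x)) (s(b + 1 := g ?x, b := f ?x))"
        by (rule computesD[OF d]) (use s in \<open>simp_all add: fun_eq_iff\<close>)
      show "prun (mkpair b) (s(b + 1 := g ?x, b := f ?x)) (s(b := prod_encode (f ?x, g ?x)))"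
        by (rule prun_eq[OF prun_mkpair]) (use s in \<open>simp_all add: fun_eq_iff\<close>)
    qed
  qed
  then show "\<exists>c. computes b c (\<lambda>x. prod_encode (f x, g x))" by blast
qed

lemma cfun_fst: "cfun (\<lambda>x. fst (prod_decode x))"
  unfolding cfun_def
proof
  fix b
  have "computes b (unpair b @ clr (b + 1)) (\<lambda>x. fst (prod_decode x))"
    unfolding computes_def
    by (intro allI impI, rule prun_append[OF prun_unpair prun_eq[OF prun_clr]])
      (simp_all add: fun_eq_iff)
  then show "\<exists>c. computes b c (\<lambda>x. fst (prod_decode x))" by blast
qed

lemma cfun_snd: "cfun (\<lambda>x. snd (prod_decode x))"
  unfolding cfun_def
proof
  fix b
  have "computes b (unpair b @ clr b @ mv (b + 1) b) (\<lambda>x. snd (prod_decode x))"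
    unfolding computes_def
    by (intro allI impI,
        rule prun_append[OF prun_unpair prun_append[OF prun_clr prun_eq[OF prun_mv]]])
      (simp_all add: fun_eq_iff)
  then show "\<exists>c. computes b c (\<lambda>x. snd (prod_decode x))" by blast
qed

lemma cfun_iterate:
  assumes "cfun f"
  shows "cfun (\<lambda>x. (f ^^ fst (prod_decode x)) (snd (prod_decode x)))"
  unfolding cfun_def
proof
  fix b
  from assms obtain c where c: "computes (b + 1) c f"
    unfolding cfun_def by blast
  have "computes b (unpair b @ [While b (Dec b # c)] @ mv (b + 1) b)
     (\<lambda>x. (f ^^ fst (prod_decode x)) (snd (prod_decode x)))"
    unfolding computes_def
  proof (intro allI impI)
    fix s :: "nat \<Rightarrow> nat"
    assume s: "\<forall>j > b. s j = 0"
    let ?n = "fst (prod_decode (s b))" and ?y = "snd (prod_decode (s b))"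
    let ?s = "s(b := fst (prod_decode (s b)), b + 1 := snd (prod_decode (s b)))"
    let ?t = "s(b := 0, b + 1 := (f ^^ ?n) ?y)"
    have 1: "prun [While b (Dec b # c)] ?s ?t"
    proof (rule prun_loop[where m = "\<lambda>t. t b" and I = "\<lambda>t. (f ^^ t b) (t (b + 1)) = (f ^^ ?n) ?y \<and>
         (\<forall>j. j \<noteq> b \<longrightarrow> j \<noteq> b + 1 \<longrightarrow> t j = s j)"])
      fix t
      assume t: "(f ^^ t b) (t (b + 1)) = (f ^^ ?n) ?y \<and>
         (\<forall>j. j \<noteq> b \<longrightarrow> j \<noteq> b + 1 \<longrightarrow> t j = s j)" "t b \<noteq> 0"
      then obtain k where k: "t b = Suc k" using not0_implies_Suc by blast
      let ?u = "t(b := k, b + 1 := f (t (b + 1)))"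
      have "prun (Dec b # c) t ?u"
        by (rule prun_Dec[OF computesD[OF c]]) (use s t k in auto)
      then show "\<exists>s'. prun (Dec b # c) t s' \<and> ((f ^^ s' b) (s' (b + 1)) = (f ^^ ?n) ?y \<and>
         (\<forall>j. j \<noteq> b \<longrightarrow> j \<noteq> b + 1 \<longrightarrow> s' j = s j)) \<and> s' b < t b"
        using t k by (intro exI[of _ ?u]) (auto simp: funpow_swap1)
    qed (simp_all add: fun_eq_iff)
    have 2: "prun (mv (b + 1) b) ?t (s(b := (f ^^ ?n) ?y))"
      by (rule prun_eq[OF prun_mv]) (use s in \<open>simp_all add: fun_eq_iff\<close>)
    show "prun (unpair b @ [While b (Dec b # c)] @ mv (b + 1) b) s (s(b := (f ^^ ?n) ?y))"
      by (rule prun_append[OF prun_unpair[OF s] prun_append[OF 1 2]])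
  qed
  then show "\<exists>c. computes b c (\<lambda>x. (f ^^ fst (prod_decode x)) (snd (prod_decode x)))" by blast
qed

text \<open>Stated about single runs instead of \<open>cfun\<close>, because the search may diverge
  for other arguments; machines computing partial functions need this form.\<close>

lemma search:
  assumes "cfun f"
  shows "\<exists>c. \<forall>s. (\<forall>j > b. s j = 0) \<longrightarrow> (\<exists>y. f (prod_encode (s b, y)) = 0) \<longrightarrow>
    prun c s (s(b := (LEAST y. f (prod_encode (s b, y)) = 0)))"
proof -
  from assms obtain c where c: "computes (b + 2) c f"
    unfolding cfun_def by blast
  define T where "T = cp b (b + 2) (b + 4) @ cp (b + 1) (b + 3) (b + 4) @ mkpair (b + 2) @ c"
  have T: "prun T s (s(b + 2 := f (prod_encode (s b, s (b + 1)))))" if "\<forall>j > b + 1. s j = 0" for s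
    unfolding T_def
  proof (intro prun_append)
    show "prun (cp b (b + 2) (b + 4)) s (s(b + 2 := s b))"
      by (rule prun_eq[OF prun_cp]) (use that in auto)
    show "prun (cp (b + 1) (b + 3) (b + 4)) (s(b + 2 := s b)) (s(b + 2 := s b, b + 3 := s (b + 1)))"
      by (rule prun_eq[OF prun_cp]) (use that in auto)
    show "prun (mkpair (b + 2)) (s(b + 2 := s b, b + 3 := s (b + 1)))
        (s(b + 2 := prod_encode (s b, s (b + 1))))"
      by (rule prun_eq[OF prun_mkpair]) (use that in \<open>simp_all add: fun_eq_iff\<close>)
    show "prun c (s(b + 2 := prod_encode (s b, s (b + 1))))
        (s(b + 2 := f (prod_encode (s b, s (b + 1)))))"
      by (rule computesD[OF c]) (use that in auto)
  qed
  have "prun (T @ [While (b + 2) (clr (b + 2) @ Inc (b + 1) # T)] @ clr b @ mv (b + 1) b) s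
     (s(b := (LEAST y. f (prod_encode (s b, y)) = 0)))"
    if s: "\<forall>j > b. s j = 0" and ex: "\<exists>y. f (prod_encode (s b, y)) = 0" for s
  proof (intro prun_append)
    define L where "L = (LEAST y. f (prod_encode (s b, y)) = 0)"
    have L: "f (prod_encode (s b, L)) = 0" using ex unfolding L_def by (rule LeastI_ex)
    have min: "L = n" if "f (prod_encode (s b, n)) = 0" "\<forall>y<n. f (prod_encode (s b, y)) \<noteq> 0" for n
      unfolding L_def using that by (intro Least_equality) (auto simp: not_less[symmetric])
    let ?s = "s(b + 2 := f (prod_encode (s b, 0)))"
    show "prun T s ?s" by (rule prun_eq[OF T]) (use s in auto)
    show "prun [While (b + 2) (clr (b + 2) @ Inc (b + 1) # T)] ?s (s(b + 1 := L))"
    proof (rule prun_loop[where m = "\<lambda>t. L - t (b + 1)" and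
          I = "\<lambda>t. t (b + 2) = f (prod_encode (s b, t (b + 1))) \<and>
            (\<forall>y < t (b + 1). f (prod_encode (s b, y)) \<noteq> 0) \<and>
            (\<forall>j. j \<noteq> b + 2 \<longrightarrow> j \<noteq> b + 1 \<longrightarrow> t j = s j)"])
      fix t
      assume t: "t (b + 2) = f (prod_encode (s b, t (b + 1))) \<and>
            (\<forall>y < t (b + 1). f (prod_encode (s b, y)) \<noteq> 0) \<and>
            (\<forall>j. j \<noteq> b + 2 \<longrightarrow> j \<noteq> b + 1 \<longrightarrow> t j = s j)" "t (b + 2) \<noteq> 0"
      let ?v = "t(b + 2 := 0, b + 1 := Suc (t (b + 1)))"
      let ?u = "?v(b + 2 := f (prod_encode (s b, Suc (t (b + 1)))))"
      have "prun T ?v ?u" by (rule prun_eq[OF T]) (use t s in auto)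
      then have "prun (Inc (b + 1) # T) (t(b + 2 := 0)) ?u" by (intro prun_Inc) simp
      then have "prun (clr (b + 2) @ Inc (b + 1) # T) t ?u" by (rule prun_append[OF prun_clr])
      moreover have "t (b + 1) < L"
        using t L by (metis linorder_neqE_nat)
      ultimately show "\<exists>s'. prun (clr (b + 2) @ Inc (b + 1) # T) t s' \<and>
         (s' (b + 2) = f (prod_encode (s b, s' (b + 1))) \<and>
            (\<forall>y < s' (b + 1). f (prod_encode (s b, y)) \<noteq> 0) \<and>
            (\<forall>j. j \<noteq> b + 2 \<longrightarrow> j \<noteq> b + 1 \<longrightarrow> s' j = s j)) \<and> L - s' (b + 1) < L - t (b + 1)"
        using t by (intro exI[of _ ?u]) (auto simp: less_Suc_eq)
    next
      fix t
      assume t: "t (b + 2) = f (prod_encode (s b, t (b + 1))) \<and>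
            (\<forall>y < t (b + 1). f (prod_encode (s b, y)) \<noteq> 0) \<and>
            (\<forall>j. j \<noteq> b + 2 \<longrightarrow> j \<noteq> b + 1 \<longrightarrow> t j = s j)" "t (b + 2) = 0"
      then have "L = t (b + 1)" by (intro min) auto
      have "t j = (s(b + 1 := L)) j" for j
        using t s \<open>L = t (b + 1)\<close> by (cases "j = b + 2") auto
      then show "t = s(b + 1 := L)" by blast
    qed (use s in auto)
    show "prun (clr b) (s(b + 1 := L)) (s(b + 1 := L, b := 0))"
      by (rule prun_eq[OF prun_clr]) simp
    show "prun (mv (b + 1) b) (s(b + 1 := L, b := 0))
        (s(b := (LEAST y. f (prod_encode (s b, y)) = 0)))"
      by (rule prun_eq[OF prun_mv]) (use s in \<open>auto simp: fun_eq_iff L_def\<close>)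
  qed
  then show ?thesis by blast
qed

lemma cfun_Least:
  assumes "cfun f" and "\<And>x. \<exists>y. f (prod_encode (x, y)) = 0"
  shows "cfun (\<lambda>x. LEAST y. f (prod_encode (x, y)) = 0)"
  unfolding cfun_def
proof
  fix b
  from search[OF assms(1)] obtain c where "\<forall>s. (\<forall>j > b. s j = 0) \<longrightarrow>
    (\<exists>y. f (prod_encode (s b, y)) = 0) \<longrightarrow>
    prun c s (s(b := (LEAST y. f (prod_encode (s b, y)) = 0)))" ..
  then have "computes b c (\<lambda>x. LEAST y. f (prod_encode (x, y)) = 0)"
    using assms(2) unfolding computes_def by blast
  then show "\<exists>c. computes b c (\<lambda>x. LEAST y. f (prod_encode (x, y)) = 0)" by blast
qed

subsection \<open>Input and output\<close>

lemma run_eq: "run c s t \<Longrightarrow> t = u \<Longrightarrow> run c s u"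
  by simp

definition bits_code :: "bool list \<Rightarrow> nat" where
  "bits_code w = list_encode (map of_bool w)"

lemma cfun_const: "cfun (\<lambda>_. n)"
proof (induction n)
  case (Suc n)
  then show ?case using cfun_comp[OF cfun_Suc, of "\<lambda>_. n"] by simp
qed (rule cfun_zero)

lemma bits_code_Cons: "bits_code (c # w) = Suc (prod_encode (of_bool c, bits_code w))"
  by (simp add: bits_code_def)

text \<open>The most recent bit is the head of the list, so the input is stored in reversed order.\<close>

lemma read_all:
  "\<exists>c. \<forall>s p out. (\<forall>j \<ge> b. s j = 0) \<longrightarrow>
     run c (s, p, out) (s(b := bits_code (rev p)), [], out)"
proof -
  have *: "cfun (\<lambda>x. Suc (prod_encode (n, x)))" for n
    by (rule cfun_comp[OF cfun_Suc cfun_pair[OF cfun_const cfun_id]])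
  obtain c0 where c0: "computes b c0 (\<lambda>x. Suc (prod_encode (0, x)))"
    using *[of 0] unfolding cfun_def by blast
  obtain c1 where c1: "computes b c1 (\<lambda>x. Suc (prod_encode (1, x)))"
    using *[of 1] unfolding cfun_def by blast
  \<comment> \<open>Register \<open>b + 1\<close> keeps the loop alive. It is cleared before each
    bit, as \<open>c0\<close> and \<open>c1\<close> need all registers above \<open>b\<close> to be
    0, and set again only if a bit was read, so the loop ends with the input.\<close>
  define B where "B = [Dec (b + 1), Read (b + 2) (b + 3),
      While (b + 2) (Dec (b + 2) # c0 @ [Inc (b + 1)]),
      While (b + 3) (Dec (b + 3) # c1 @ [Inc (b + 1)])]"
  have push: "prun (Dec r # cc @ [Inc (b + 1)]) (s(r := 1)) (s(b := f (s b), b + 1 := 1))"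
    if "computes b cc f" "\<forall>j > b. s j = 0" "r > b" for s cc f r
    by (rule prun_Dec[OF prun_append[where t = "s(b := f (s b))",
          OF computesD[OF that(1)] prun_Inc[OF prun_Nil]]])
      (use that in \<open>simp_all add: fun_eq_iff\<close>)
  have "run [While (b + 1) B] (s(b := bits_code w, b + 1 := 1), p, out)
       (s(b := bits_code (rev p @ w)), [], out)" if s: "\<forall>j \<ge> b. s j = 0" for s p w out
  proof (induction p arbitrary: w)
    case Nil
    have "run B (s(b := bits_code w, b + 1 := 1), [], out) (s(b := bits_code w), [], out)"
    proof -
      have *: "s(b := bits_code w, b + 1 := 1, b + 1 := (s(b := bits_code w, b + 1 := 1)) (b + 1) - 1)
          = s(b := bits_code w)"
        using s by (simp_all add: fun_eq_iff)
      show ?thesis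
        unfolding B_def
        apply (rule run_Dec, rule run_Read_Nil)
        unfolding *
        by (rule run_While_0[OF _ run_While_0[OF _ run_Nil]]) (use s in simp_all)
    qed
    then have "run (B @ [While (b + 1) B]) (s(b := bits_code w, b + 1 := 1), [], out)
        (s(b := bits_code w), [], out)"
      by (rule run_append[OF _ run_While_0[OF _ run_Nil]]) (use s in simp)
    then have "run [While (b + 1) B] (s(b := bits_code w, b + 1 := 1), [], out)
        (s(b := bits_code w), [], out)"
      by (rule run_While_1[rotated]) simp
    then show ?case by (simp only: rev.simps append_Nil)
  next
    case (Cons a p)
    let ?s = "s(b := bits_code w)"
    have z: "\<forall>j > b. ?s j = 0" using s by auto
    have pr: "prun (While r (Dec r # cc @ [Inc (b + 1)]) # k) (?s(r := 1)) u"
      if "computes b cc f" "r > b + 1" "prun k (s(b := f (bits_code w), b + 1 := 1)) u"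
      for cc f k r u
    proof (rule prun_While_1)
      have *: "prun (Dec r # cc @ [Inc (b + 1)]) (?s(r := 1))
          (?s(b := f (bits_code w), b + 1 := 1))"
        by (rule prun_eq[OF push[OF that(1) z]]) (use that(2) in \<open>simp_all add: fun_eq_iff\<close>)
      have "prun (While r (Dec r # cc @ [Inc (b + 1)]) # k) (s(b := f (bits_code w), b + 1 := 1)) u"
        by (rule prun_While_0) (use that(2,3) s in auto)
      then have "prun (While r (Dec r # cc @ [Inc (b + 1)]) # k)
          (?s(b := f (bits_code w), b + 1 := 1)) u"
        by (simp only: fun_upd_upd)
      with * show "prun ((Dec r # cc @ [Inc (b + 1)]) @
          While r (Dec r # cc @ [Inc (b + 1)]) # k) (?s(r := 1)) u"
        by (rule prun_append)
    qed simp
    let ?t = "s(b := bits_code (a # w), b + 1 := 1)"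
    have rest: "prun [While (b + 2) (Dec (b + 2) # c0 @ [Inc (b + 1)]),
        While (b + 3) (Dec (b + 3) # c1 @ [Inc (b + 1)])]
        (if a then ?s(b + 3 := 1) else ?s(b + 2 := 1)) ?t"
    proof (cases a)
      case True
      have "prun [While (b + 3) (Dec (b + 3) # c1 @ [Inc (b + 1)])] (?s(b + 3 := 1)) ?t"
        by (rule pr[OF c1 _ prun_Nil]) (use True in \<open>simp_all add: bits_code_Cons\<close>)
      then show ?thesis unfolding if_P[OF True] by (rule prun_While_0[rotated]) (use s in simp)
    next
      case False
      have *: "prun [While (b + 3) (Dec (b + 3) # c1 @ [Inc (b + 1)])] ?t ?t"
        by (rule prun_While_0[OF _ prun_Nil]) (use s in auto)
      show ?thesis unfolding if_not_P[OF False]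
        by (rule pr[OF c0]) (use * False in \<open>simp_all add: bits_code_Cons\<close>)
    qed
    have e1: "s(b := bits_code w, b + 1 := 1,
        b + 1 := (s(b := bits_code w, b + 1 := 1)) (b + 1) - 1) = ?s"
      using s by (simp add: fun_eq_iff)
    have e2: "?s(b + 3 := Suc (?s (b + 3))) = ?s(b + 3 := 1)"
      "?s(b + 2 := Suc (?s (b + 2))) = ?s(b + 2 := 1)"
      using s by (simp_all add: fun_eq_iff)
    have "run B (s(b := bits_code w, b + 1 := 1), a # p, out) (?t, p, out)"
      unfolding B_def
      apply (rule run_Dec)
      unfolding e1
      apply (rule run_Read_Cons)
      unfolding e2
      using rest unfolding prun_def by blast
    then have "run [While (b + 1) B] (s(b := bits_code w, b + 1 := 1), a # p, out)
        (s(b := bits_code (rev p @ a # w)), [], out)"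
      by (rule run_While_1[OF _ run_append[OF _ Cons.IH[of "a # w"]], rotated]) simp
    then show ?case by (simp only: rev.simps append_assoc append_Cons append_Nil)
  qed
  note loop = this[of _ "[]", simplified append_Nil2]
  have "run (Inc (b + 1) # [While (b + 1) B]) (s, p, out) (s(b := bits_code (rev p)), [], out)"
    if s: "\<forall>j \<ge> b. s j = 0" for s p out
  proof (rule run_Inc)
    have "s(b + 1 := Suc (s (b + 1))) = s(b := bits_code [], b + 1 := 1)"
      using s by (simp add: fun_eq_iff bits_code_def)
    then show "run [While (b + 1) B] (s(b + 1 := Suc (s (b + 1))), p, out)
        (s(b := bits_code (rev p)), [], out)"
      using loop[OF s] by (simp only:)
  qed
  then show ?thesis by blast
qed

lemma write_all:
  "\<exists>c. \<forall>s w i out. (\<forall>j > b. s j = 0) \<longrightarrow> s b = bits_code w \<longrightarrow>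
     run c (s, i, out) (s(b := 0), i, out @ w)"
proof -
  \<comment> \<open>Register \<open>b + 2\<close> is the flag of an if-else on the bit in
    \<open>b\<close>: writing a 1 clears it, otherwise a 0 is written.\<close>
  define B where "B = Dec b # unpair b @ [Inc (b + 2), While b [Dec b, Write True, Dec (b + 2)],
     While (b + 2) [Dec (b + 2), Write False]] @ mv (b + 1) b"
  have "run [While b B] (s, i, out) (s(b := 0), i, out @ w)"
    if "\<forall>j > b. s j = 0" "s b = bits_code w" for s i out w
    using that
  proof (induction w arbitrary: s out)
    case Nil
    then have "s b = 0" by (simp add: bits_code_def)
    then have "s(b := 0) = s" by auto
    then show ?case using \<open>s b = 0\<close> by (auto intro: run_While_0 run_Nil)
  next
    case (Cons a w)
    let ?h = "s(b := of_bool a, b + 1 := bits_code w)"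
    have s: "s(b := s b - 1) = s(b := prod_encode (of_bool a, bits_code w))"
      using Cons.prems by (simp add: bits_code_Cons)
    have "prun (unpair b) (s(b := prod_encode (of_bool a, bits_code w))) ?h"
      by (rule prun_eq[OF prun_unpair]) (use Cons.prems in auto)
    then have 1: "run (unpair b) (s(b := s b - 1), i, out) (?h, i, out)"
      unfolding s by (simp add: prun_def)
    have 2: "run [Inc (b + 2), While b [Dec b, Write True, Dec (b + 2)],
        While (b + 2) [Dec (b + 2), Write False]] (?h, i, out)
        (s(b := 0, b + 1 := bits_code w), i, out @ [a])"
    proof (cases a)
      case True
      show ?thesis unfolding append_Cons append_Nil
        apply (rule run_Inc, rule run_While_1)
         apply (use True in simp)
        apply (simp only: append_Cons append_Nil)
        apply (rule run_Dec, rule run_Write, rule run_Dec, rule run_While_0)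
         apply (use True in simp)
        apply (rule run_While_0)
         apply (use Cons.prems in simp)
        apply (rule run_Nil_eq)
        apply (use True Cons.prems in \<open>simp add: fun_eq_iff\<close>)
        done
    next
      case False
      show ?thesis unfolding append_Cons append_Nil
        apply (rule run_Inc, rule run_While_0)
         apply (use False in simp)
        apply (rule run_While_1)
         apply (use Cons.prems in simp)
        apply (simp only: append_Cons append_Nil)
        apply (rule run_Dec, rule run_Write, rule run_While_0)
         apply (use Cons.prems in simp)
        apply (rule run_Nil_eq)
        apply (use False Cons.prems in \<open>simp add: fun_eq_iff\<close>)
        done
    qed
    have 3: "run (mv (b + 1) b) (s(b := 0, b + 1 := bits_code w), i, out @ [a])
       (s(b := bits_code w), i, out @ [a])"
    proof -
      have "prun (mv (b + 1) b) (s(b := 0, b + 1 := bits_code w)) (s(b := bits_code w))"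
        by (rule prun_eq[OF prun_mv]) (use Cons.prems in \<open>simp_all add: fun_eq_iff\<close>)
      then show ?thesis by (simp add: prun_def)
    qed
    have "run B (s, i, out) (s(b := bits_code w), i, out @ [a])"
      unfolding B_def by (rule run_Dec, rule run_append[OF 1], rule run_append[OF 2 3])
    moreover have "run [While b B] (s(b := bits_code w), i, out @ [a])
        (s(b := bits_code w, b := 0), i, (out @ [a]) @ w)"
      by (rule Cons.IH) (use Cons.prems in simp_all)
    ultimately have "run (B @ [While b B]) (s, i, out) (s(b := 0), i, out @ a # w)"
      using run_append[of B "(s, i, out)" _ "[While b B]"] by simp
    moreover have "s b \<noteq> 0" using Cons.prems by (simp add: bits_code_Cons)
    ultimately show ?case by (rule run_While_1[rotated])
  qed
  then show ?thesis by blast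
qed

text \<open>Kleene's normal form: an unbounded search followed by a total function of the input and
  the result. The code is that of the reversed input because of \<open>read_all\<close>.\<close>

theorem machine_of_search:
  assumes "cfun f" and "cfun g"
  obtains V where "wf_tm V"
    and "\<And>p w. \<exists>y. f (prod_encode (bits_code (rev p), y)) = 0 \<Longrightarrow>
      g (prod_encode (bits_code (rev p), LEAST y. f (prod_encode (bits_code (rev p), y)) = 0)) =
        bits_code w \<Longrightarrow> tm_fun V p = Some w"
proof -
  from read_all[of 0] obtain R where R: "\<forall>s p out. (\<forall>j \<ge> 0. s j = 0) \<longrightarrow>
     run R (s, p, out) (s(0 := bits_code (rev p)), [], out)" ..
  from search[OF assms(1), of 1] obtain S where S: "\<forall>s. (\<forall>j > 1. s j = 0) \<longrightarrow>
    (\<exists>y. f (prod_encode (s 1, y)) = 0) \<longrightarrow>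
    prun S s (s(1 := (LEAST y. f (prod_encode (s 1, y)) = 0)))" ..
  from assms(2) obtain G where G: "computes 0 G g" unfolding cfun_def by blast
  from write_all[of 0] obtain W where W: "\<forall>s w i out. (\<forall>j > 0. s j = 0) \<longrightarrow>
     s 0 = bits_code w \<longrightarrow> run W (s, i, out) (s(0 := 0), i, out @ w)" ..
  define P where "P = R @ (cp 0 1 2 @ S @ mkpair 0 @ G) @ W"
  obtain V where V: "wf_tm V"
    "\<And>p t s i out. (sstep ^^ t) (P, (\<lambda>_. 0), p, []) = ([], s, i, out) \<Longrightarrow> tm_fun V p = Some out"
    using compile[of P] by metis
  have "tm_fun V p = Some w" if ex: "\<exists>y. f (prod_encode (bits_code (rev p), y)) = 0"
    and w: "g (prod_encode (bits_code (rev p), LEAST y. f (prod_encode (bits_code (rev p), y)) = 0)) =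
        bits_code w" for p w
  proof -
    let ?z = "\<lambda>_::nat. 0::nat"
    let ?p = "bits_code (rev p)"
    let ?y = "LEAST y. f (prod_encode (?p, y)) = 0"
    have "run P (?z, p, []) (?z(0 := 0), [], [] @ w)"
      unfolding P_def
    proof (rule run_append[OF _ run_append])
      show "run R (?z, p, []) (?z(0 := ?p), [], [])" by (rule R[rule_format]) simp
      have "prun (cp 0 1 2 @ S @ mkpair 0 @ G) (?z(0 := ?p)) (?z(0 := bits_code w))"
      proof (intro prun_append)
        show "prun (cp 0 1 2) (?z(0 := ?p)) (?z(0 := ?p, 1 := ?p))"
          by (rule prun_eq[OF prun_cp]) auto
        show "prun S (?z(0 := ?p, 1 := ?p)) (?z(0 := ?p, 1 := ?y))"
          by (rule prun_eq[OF S[rule_format]]) (use ex in simp_all)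
        show "prun (mkpair 0) (?z(0 := ?p, 1 := ?y)) (?z(0 := prod_encode (?p, ?y)))"
          by (rule prun_eq[OF prun_mkpair]) (simp_all add: fun_eq_iff)
        show "prun G (?z(0 := prod_encode (?p, ?y))) (?z(0 := bits_code w))"
          by (rule computesD[OF G]) (use w in auto)
      qed
      then show "run (cp 0 1 2 @ S @ mkpair 0 @ G) (?z(0 := ?p), [], []) (?z(0 := bits_code w), [], [])"
        by (simp add: prun_def)
      show "run W (?z(0 := bits_code w), [], []) (?z(0 := 0), [], [] @ w)"
        by (rule run_eq[OF W[rule_format]]) (simp_all add: fun_eq_iff)
    qed
    then obtain t where "(sstep ^^ t) (P @ [], ?z, p, []) = ([], ?z(0 := 0), [], [] @ w)"
      unfolding run_def by blast
    then show ?thesis using V(2) by simp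
  qed
  with V(1) show ?thesis by (rule that)
qed

section \<open>Computable functions between encoded types\<close>

class cod =
  fixes cd :: "'a \<Rightarrow> nat" and dc :: "nat \<Rightarrow> 'a"
  assumes dc_cd [simp]: "dc (cd x) = x"

lemma cd_inject [simp]: "cd x = cd y \<longleftrightarrow> x = y"
  by (metis dc_cd)

instantiation nat :: cod
begin
definition "cd_nat (n::nat) = n"
definition "dc_nat (n::nat) = n"
instance by standard (simp add: cd_nat_def dc_nat_def)
end

instantiation bool :: cod
begin
definition "cd_bool b = (of_bool b :: nat)"
definition "dc_bool n \<longleftrightarrow> n \<noteq> (0::nat)"
instance by standard (simp add: cd_bool_def dc_bool_def)
end

instantiation prod :: (cod, cod) cod
begin
definition "cd_prod p = prod_encode (cd (fst p), cd (snd p))"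
definition "dc_prod n = (dc (fst (prod_decode n)), dc (snd (prod_decode n)))"
instance by standard (simp add: cd_prod_def dc_prod_def)
end

instantiation list :: (cod) cod
begin
definition "cd_list xs = list_encode (map cd xs)"
definition "dc_list n = map dc (list_decode n)"
instance by standard (simp add: cd_list_def dc_list_def comp_def)
end

lemma cd_Pair: "cd (x, y) = prod_encode (cd x, cd y)"
  by (simp add: cd_prod_def)

lemma cd_Nil [simp]: "cd [] = 0"
  by (simp add: cd_list_def)

lemma cd_Cons: "cd (x # xs) = Suc (prod_encode (cd x, cd xs))"
  by (simp add: cd_list_def)

lemma cd_nat [simp]: "cd (n::nat) = n"
  by (simp add: cd_nat_def)

lemma cd_bool [simp]: "cd b = of_bool b"
  by (simp add: cd_bool_def)

text \<open>\<open>F\<close> is unconstrained on numbers that are not codes, so the closure rules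
  need no test for codes.\<close>

definition computable :: "('a::cod \<Rightarrow> 'b::cod) \<Rightarrow> bool" where
  "computable f \<longleftrightarrow> (\<exists>F. cfun F \<and> (\<forall>x. F (cd x) = cd (f x)))"

lemma computableI: "cfun F \<Longrightarrow> (\<And>x. F (cd x) = cd (f x)) \<Longrightarrow> computable f"
  unfolding computable_def by blast

lemma computable_comp:
  assumes "computable f" and "computable g"
  shows "computable (\<lambda>x. f (g x))"
proof -
  obtain F where F: "cfun F" "\<And>x. F (cd x) = cd (f x)" using assms(1) unfolding computable_def by blast
  obtain G where G: "cfun G" "\<And>x. G (cd x) = cd (g x)" using assms(2) unfolding computable_def by blast
  show ?thesis by (rule computableI[OF cfun_comp[OF F(1) G(1)]]) (simp add: F(2) G(2))
qed

named_theorems comp_intros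

lemma computable_const [comp_intros]: "computable (\<lambda>_. c)"
  by (rule computableI[OF cfun_const]) simp

lemma computable_id [comp_intros]: "computable (\<lambda>x. x)"
  by (rule computableI[OF cfun_id]) simp

lemma computable_Pair [comp_intros]:
  assumes "computable f" and "computable g"
  shows "computable (\<lambda>x. (f x, g x))"
proof -
  obtain F where F: "cfun F" "\<And>x. F (cd x) = cd (f x)" using assms(1) unfolding computable_def by blast
  obtain G where G: "cfun G" "\<And>x. G (cd x) = cd (g x)" using assms(2) unfolding computable_def by blast
  show ?thesis by (rule computableI[OF cfun_pair[OF F(1) G(1)]]) (simp add: F(2) G(2) cd_Pair)
qed

lemma computable_fst [comp_intros]: "computable f \<Longrightarrow> computable (\<lambda>x. fst (f x))"
  by (rule computable_comp[of fst], rule computableI[OF cfun_fst]) (simp_all add: cd_prod_def)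

lemma computable_snd [comp_intros]: "computable f \<Longrightarrow> computable (\<lambda>x. snd (f x))"
  by (rule computable_comp[of snd], rule computableI[OF cfun_snd]) (simp_all add: cd_prod_def)

lemma computable_Suc [comp_intros]: "computable f \<Longrightarrow> computable (\<lambda>x. Suc (f x))"
  by (rule computable_comp[of Suc], rule computableI[OF cfun_Suc]) simp_all

lemma computable_pred: "computable (\<lambda>n::nat. n - 1)"
  by (rule computableI[OF cfun_pred]) simp

lemma computable_cd [comp_intros]: "computable f \<Longrightarrow> computable (\<lambda>x. cd (f x))"
  by (rule computable_comp[of cd], rule computableI[OF cfun_id]) simp_all

lemma computable_comp2:
  assumes "computable (\<lambda>p. h (fst p) (snd p))" and "computable f" and "computable g"
  shows "computable (\<lambda>x. h (f x) (g x))"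
  using computable_comp[OF assms(1) computable_Pair[OF assms(2,3)]] by simp

lemma computable_comp3:
  assumes "computable (\<lambda>p. h (fst p) (fst (snd p)) (snd (snd p)))"
    and "computable f" and "computable g" and "computable k"
  shows "computable (\<lambda>x. h (f x) (g x) (k x))"
  using computable_comp[OF assms(1) computable_Pair[OF assms(2) computable_Pair[OF assms(3,4)]]]
  by simp

text \<open>Branching by iteration: the map from \<open>(a, b)\<close> to \<open>(b, b)\<close>,
  applied \<open>h x\<close> times, leaves the first component alone exactly if
  \<open>h x = 0\<close>.\<close>

lemma cfun_if:
  assumes "cfun h" and "cfun f" and "cfun g"
  shows "cfun (\<lambda>x. if h x = 0 then f x else g x)"
proof -
  let ?S = "\<lambda>q. prod_encode (snd (prod_decode q), snd (prod_decode q))"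
  have *: "(?S ^^ n) (prod_encode (a, b)) = prod_encode (if n = 0 then a else b, b)" for n a b
    by (induction n) auto
  have "cfun (\<lambda>x. fst (prod_decode ((?S ^^ fst (prod_decode (prod_encode (h x, prod_encode (f x, g x)))))
     (snd (prod_decode (prod_encode (h x, prod_encode (f x, g x))))))))"
    by (rule cfun_comp[OF cfun_fst], rule cfun_comp[OF cfun_iterate])
      (rule cfun_pair[OF cfun_snd cfun_snd], rule cfun_pair[OF assms(1) cfun_pair[OF assms(2,3)]])
  moreover have "fst (prod_decode ((?S ^^ n) (prod_encode (a, b)))) = (if n = 0 then a else b)" for n a b
    unfolding * by simp
  ultimately show ?thesis by simp
qed

lemma computable_if [comp_intros]:
  assumes "computable b" and "computable f" and "computable g"
  shows "computable (\<lambda>x. if b x then f x else g x)"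
proof -
  obtain B where B: "cfun B" "\<And>x. B (cd x) = cd (b x)" using assms(1) unfolding computable_def by blast
  obtain F where F: "cfun F" "\<And>x. F (cd x) = cd (f x)" using assms(2) unfolding computable_def by blast
  obtain G where G: "cfun G" "\<And>x. G (cd x) = cd (g x)" using assms(3) unfolding computable_def by blast
  show ?thesis by (rule computableI[OF cfun_if[OF B(1) G(1) F(1)]]) (simp add: B(2) F(2) G(2))
qed

lemma computable_case_list [comp_intros]:
  assumes "computable xs" and "computable a"
    and "computable (\<lambda>p. g (fst p) (fst (snd p)) (snd (snd p)))"
  shows "computable (\<lambda>x. case xs x of [] \<Rightarrow> a x | y # ys \<Rightarrow> g x y ys)"
proof -
  obtain X where X: "cfun X" "\<And>x. X (cd x) = cd (xs x)" using assms(1) unfolding computable_def by blast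
  obtain A where A: "cfun A" "\<And>x. A (cd x) = cd (a x)" using assms(2) unfolding computable_def by blast
  obtain G where G: "cfun G" "\<And>p. G (cd p) = cd (g (fst p) (fst (snd p)) (snd (snd p)))"
    using assms(3) unfolding computable_def by blast
  have "cfun (\<lambda>x. if X x = 0 then A x else G (prod_encode (x, X x - 1)))"
    by (intro cfun_if X(1) A(1) cfun_comp[OF G(1)] cfun_pair cfun_id cfun_comp[OF cfun_pred])
  then show ?thesis
  proof (rule computableI)
    fix x
    show "(if X (cd x) = 0 then A (cd x) else G (prod_encode (cd x, X (cd x) - 1))) =
        cd (case xs x of [] \<Rightarrow> a x | y # ys \<Rightarrow> g x y ys)"
    proof (cases "xs x")
      case (Cons y ys)
      then show ?thesis using G(2)[of "(x, y, ys)"] by (simp add: X(2) cd_Cons cd_Pair)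
    qed (simp add: X(2) A(2))
  qed
qed

lemma computable_funpow [comp_intros]:
  fixes f :: "'a::cod \<Rightarrow> 'b::cod \<Rightarrow> 'b"
  assumes "computable (\<lambda>p. f (fst p) (snd p))" and "computable n" and "computable a"
  shows "computable (\<lambda>x. (f x ^^ n x) (a x))"
proof -
  obtain F where F: "cfun F" "\<And>p. F (cd p) = cd (f (fst p) (snd p))"
    using assms(1) unfolding computable_def by blast
  obtain N where N: "cfun N" "\<And>x. N (cd x) = n x" using assms(2)
    unfolding computable_def by (metis cd_nat)
  obtain A where A: "cfun A" "\<And>x. A (cd x) = cd (a x)" using assms(3) unfolding computable_def by blast
  let ?S = "\<lambda>q. prod_encode (fst (prod_decode q), F q)"
  have S: "(?S ^^ k) (prod_encode (cd x, cd y)) = prod_encode (cd x, cd ((f x ^^ k) y))" for k x y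
  proof (induction k)
    case (Suc k)
    then show ?case using F(2)[of "(x, (f x ^^ k) y)"] by (simp add: cd_Pair)
  qed simp
  have "cfun (\<lambda>x. snd (prod_decode ((?S ^^ fst (prod_decode (prod_encode (N x, prod_encode (x, A x)))))
     (snd (prod_decode (prod_encode (N x, prod_encode (x, A x))))))))"
    by (rule cfun_comp[OF cfun_snd], rule cfun_comp[OF cfun_iterate])
      (rule cfun_pair[OF cfun_fst F(1)], rule cfun_pair[OF N(1) cfun_pair[OF cfun_id A(1)]])
  then show ?thesis by (rule computableI) (simp add: S N(2) A(2))
qed

text \<open>Allows a fold to be iterated as often as the code of the list says; the surplus
  iterations on the empty list change nothing.\<close>

lemma length_le_cd: "length xs \<le> cd xs"
proof (induction xs)
  case (Cons x xs)
  have "cd xs \<le> prod_encode (cd x, cd xs)" by (rule le_prod_encode_2)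
  with Cons show ?case by (simp add: cd_Cons)
qed simp

lemma computable_foldl [comp_intros]:
  assumes "computable (\<lambda>p. g (fst p) (fst (snd p)) (snd (snd p)))"
    and "computable a" and "computable xs"
  shows "computable (\<lambda>x. foldl (g x) (a x) (xs x))"
proof -
  define h where "h x st = (case fst st of [] \<Rightarrow> st | y # ys \<Rightarrow> (ys, g x (snd st) y))" for x st
  have h_simps: "h x ([], b) = ([], b)" "h x (y # ys, b) = (ys, g x b y)" for x y ys b
    by (simp_all add: h_def)
  have h: "(h x ^^ k) (ys, b) = (drop k ys, foldl (g x) b (take k ys))" for x k ys b
  proof (induction k arbitrary: ys b)
    case (Suc k)
    then show ?case
      unfolding funpow_Suc_right comp_apply by (cases ys) (simp_all add: h_simps)
  qed simp
  have "computable (\<lambda>p. h (fst p) (snd p))"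
    unfolding h_def
  proof (intro comp_intros)
    show "computable (\<lambda>p. g (fst (fst p)) (snd (snd (fst p))) (fst (snd p)))"
      by (rule computable_comp3[OF assms(1)]; intro comp_intros)
  qed
  then have "computable (\<lambda>x. snd ((h x ^^ cd (xs x)) (xs x, a x)))"
    by (intro comp_intros assms)
  then show ?thesis by (simp add: h length_le_cd)
qed

lemma computable_add [comp_intros]:
  assumes "computable f" and "computable (g :: 'a::cod \<Rightarrow> nat)"
  shows "computable (\<lambda>x. f x + g x)"
proof -
  have "(Suc ^^ n) m = m + n" for n m by (induction n) auto
  moreover have "computable (\<lambda>x. (Suc ^^ g x) (f x))" by (intro comp_intros assms)
  ultimately show ?thesis by (simp add: add.commute)
qed

lemma computable_diff [comp_intros]:
  assumes "computable f" and "computable (g :: 'a::cod \<Rightarrow> nat)"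
  shows "computable (\<lambda>x. f x - g x)"
proof -
  have "((\<lambda>n::nat. n - 1) ^^ n) m = m - n" for n m by (induction n) auto
  moreover have "computable (\<lambda>x. ((\<lambda>n::nat. n - 1) ^^ g x) (f x))"
    by (intro comp_intros assms computable_comp[OF computable_pred])
  ultimately show ?thesis by simp
qed

lemma computable_mult [comp_intros]:
  assumes "computable f" and "computable (g :: 'a::cod \<Rightarrow> nat)"
  shows "computable (\<lambda>x. f x * g x)"
proof -
  have "((\<lambda>s. s + m) ^^ n) 0 = m * n" for n m :: nat by (induction n) auto
  moreover have "computable (\<lambda>x. ((\<lambda>s. s + f x) ^^ g x) 0)"
    by (intro comp_intros computable_comp[OF assms(1)] assms)
  ultimately show ?thesis by simp
qed

lemma computable_power [comp_intros]:
  assumes "computable f" and "computable (g :: 'a::cod \<Rightarrow> nat)"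
  shows "computable (\<lambda>x. f x ^ g x :: nat)"
proof -
  have "((\<lambda>s. s * m) ^^ n) 1 = m ^ n" for n m :: nat by (induction n) (auto simp: mult.commute)
  moreover have "computable (\<lambda>x. ((\<lambda>s. s * f x) ^^ g x) 1)"
    by (intro comp_intros computable_comp[OF assms(1)] assms)
  ultimately show ?thesis by simp
qed

lemma computable_not [comp_intros]:
  assumes "computable b"
  shows "computable (\<lambda>x. \<not> b x)"
proof -
  have "(\<lambda>x. \<not> b x) = (\<lambda>x. if b x then False else True)" by auto
  moreover have "computable (\<lambda>x. if b x then False else True)" by (intro comp_intros assms)
  ultimately show ?thesis by (simp only:)
qed

lemma computable_conj [comp_intros]:
  assumes "computable b" and "computable c"
  shows "computable (\<lambda>x. b x \<and> c x)"
proof -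
  have "(\<lambda>x. b x \<and> c x) = (\<lambda>x. if b x then c x else False)" by auto
  moreover have "computable (\<lambda>x. if b x then c x else False)" by (intro comp_intros assms)
  ultimately show ?thesis by (simp only:)
qed

lemma computable_disj [comp_intros]:
  assumes "computable b" and "computable c"
  shows "computable (\<lambda>x. b x \<or> c x)"
proof -
  have "(\<lambda>x. b x \<or> c x) = (\<lambda>x. if b x then True else c x)" by auto
  moreover have "computable (\<lambda>x. if b x then True else c x)" by (intro comp_intros assms)
  ultimately show ?thesis by (simp only:)
qed

lemma computable_imp [comp_intros]:
  assumes "computable b" and "computable c"
  shows "computable (\<lambda>x. b x \<longrightarrow> c x)"
proof -
  have "(\<lambda>x. b x \<longrightarrow> c x) = (\<lambda>x. if b x then c x else True)" by auto
  moreover have "computable (\<lambda>x. if b x then c x else True)" by (intro comp_intros assms)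
  ultimately show ?thesis by (simp only:)
qed

lemma computable_is_zero: "computable (\<lambda>n::nat. n = 0)"
proof (rule computableI)
  show "cfun (\<lambda>n. if n = 0 then 1 else 0)" by (intro cfun_if cfun_id cfun_const)
qed auto

lemma computable_le [comp_intros]:
  assumes "computable f" and "computable (g :: 'a::cod \<Rightarrow> nat)"
  shows "computable (\<lambda>x. f x \<le> g x)"
  using computable_comp[OF computable_is_zero computable_diff[OF assms]] by simp

lemma computable_less [comp_intros]:
  assumes "computable f" and "computable (g :: 'a::cod \<Rightarrow> nat)"
  shows "computable (\<lambda>x. f x < g x)"
  using computable_not[OF computable_le[OF assms(2,1)]] by (simp add: not_le)

lemma computable_eq [comp_intros]:
  assumes "computable f" and "computable g"
  shows "computable (\<lambda>x. f x = g x)"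
proof -
  have "computable (\<lambda>x. cd (f x) \<le> cd (g x) \<and> cd (g x) \<le> cd (f x))"
    by (intro comp_intros assms)
  moreover have "cd (f x) \<le> cd (g x) \<and> cd (g x) \<le> cd (f x) \<longleftrightarrow> f x = g x" for x
    by (metis cd_inject order_antisym order_refl)
  ultimately show ?thesis by simp
qed

lemma computable_Cons [comp_intros]:
  assumes "computable f" and "computable g"
  shows "computable (\<lambda>x. f x # g x)"
proof -
  obtain F where F: "cfun F" "\<And>x. F (cd x) = cd (f x)" using assms(1) unfolding computable_def by blast
  obtain G where G: "cfun G" "\<And>x. G (cd x) = cd (g x)" using assms(2) unfolding computable_def by blast
  show ?thesis
    by (rule computableI[OF cfun_comp[OF cfun_Suc cfun_pair[OF F(1) G(1)]]])
      (simp add: F(2) G(2) cd_Cons)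
qed

lemma computable_rev [comp_intros]:
  fixes xs :: "'a::cod \<Rightarrow> 'b::cod list"
  assumes "computable xs"
  shows "computable (\<lambda>x. rev (xs x))"
proof -
  have "foldl (\<lambda>a y. y # a) b ys = rev ys @ b" for b ys :: "'b list" by (induction ys arbitrary: b) auto
  moreover have "computable (\<lambda>x. foldl (\<lambda>a y. y # a) [] (xs x))" by (intro comp_intros assms)
  ultimately show ?thesis by simp
qed

lemma computable_foldr [comp_intros]:
  assumes "computable (\<lambda>p. g (fst p) (snd (snd p)) (fst (snd p)))"
    and "computable a" and "computable xs"
  shows "computable (\<lambda>x. foldr (g x) (xs x) (a x))"
  unfolding foldr_conv_foldl by (intro comp_intros assms)

lemma computable_map [comp_intros]:
  fixes xs :: "'a::cod \<Rightarrow> 'b::cod list" and g :: "'a \<Rightarrow> 'b \<Rightarrow> 'c::cod"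
  assumes "computable (\<lambda>p. g (fst p) (snd p))" and "computable xs"
  shows "computable (\<lambda>x. map (g x) (xs x))"
proof -
  have "foldr (\<lambda>y a. h y # a) ys [] = map h ys" for h :: "'b \<Rightarrow> 'c" and ys by (induction ys) auto
  moreover have "computable (\<lambda>x. foldr (\<lambda>y a. g x y # a) (xs x) [])"
    by (intro comp_intros computable_comp2[OF assms(1)] assms)
  ultimately show ?thesis by simp
qed

lemma computable_filter [comp_intros]:
  fixes xs :: "'a::cod \<Rightarrow> 'b::cod list"
  assumes "computable (\<lambda>p. g (fst p) (snd p))" and "computable xs"
  shows "computable (\<lambda>x. filter (g x) (xs x))"
proof -
  have "foldr (\<lambda>y a. if h y then y # a else a) ys [] = filter h ys" for h and ys :: "'b list"
    by (induction ys) auto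
  moreover have "computable (\<lambda>x. foldr (\<lambda>y a. if g x y then y # a else a) (xs x) [])"
    by (intro comp_intros computable_comp2[OF assms(1)] assms)
  ultimately show ?thesis by simp
qed

lemma computable_append [comp_intros]:
  fixes xs :: "'a::cod \<Rightarrow> 'b::cod list"
  assumes "computable xs" and "computable ys"
  shows "computable (\<lambda>x. xs x @ ys x)"
proof -
  have "foldr (#) as bs = as @ bs" for as bs :: "'b list" by (induction as) auto
  moreover have "computable (\<lambda>x. foldr (#) (xs x) (ys x))" by (intro comp_intros assms)
  ultimately show ?thesis by simp
qed

lemma computable_concat [comp_intros]:
  fixes xs :: "'a::cod \<Rightarrow> 'b::cod list list"
  assumes "computable xs"
  shows "computable (\<lambda>x. concat (xs x))"
proof -
  have "foldr (@) as [] = concat as" for as :: "'b list list" by (induction as) auto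
  moreover have "computable (\<lambda>x. foldr (@) (xs x) [])" by (intro comp_intros assms)
  ultimately show ?thesis by simp
qed

lemma computable_length [comp_intros]:
  fixes xs :: "'a::cod \<Rightarrow> 'b::cod list"
  assumes "computable xs"
  shows "computable (\<lambda>x. length (xs x))"
proof -
  have "foldr (\<lambda>_. Suc) as 0 = length as" for as :: "'b list" by (induction as) auto
  moreover have "computable (\<lambda>x. foldr (\<lambda>_. Suc) (xs x) 0)" by (intro comp_intros assms)
  ultimately show ?thesis by simp
qed

lemma computable_sum_list [comp_intros]:
  assumes "computable (xs :: 'a::cod \<Rightarrow> nat list)"
  shows "computable (\<lambda>x. sum_list (xs x))"
proof -
  have "foldr (+) as 0 = sum_list as" for as :: "nat list" by (induction as) auto
  moreover have "computable (\<lambda>x. foldr (+) (xs x) 0)" by (intro comp_intros assms)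
  ultimately show ?thesis by simp
qed

lemma computable_Bex [comp_intros]:
  fixes xs :: "'a::cod \<Rightarrow> 'b::cod list"
  assumes "computable (\<lambda>p. g (fst p) (snd p))" and "computable xs"
  shows "computable (\<lambda>x. \<exists>y \<in> set (xs x). g x y)"
proof -
  have "foldr (\<lambda>y a. h y \<or> a) ys False \<longleftrightarrow> (\<exists>y \<in> set ys. h y)" for h and ys :: "'b list" by (induction ys) auto
  moreover have "computable (\<lambda>x. foldr (\<lambda>y a. g x y \<or> a) (xs x) False)"
    by (intro comp_intros computable_comp2[OF assms(1)] assms)
  ultimately show ?thesis by simp
qed

lemma computable_Ball [comp_intros]:
  assumes "computable (\<lambda>p. g (fst p) (snd p))" and "computable xs"
  shows "computable (\<lambda>x. \<forall>y \<in> set (xs x). g x y)"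
proof -
  have "computable (\<lambda>x. \<not> (\<exists>y \<in> set (xs x). \<not> g x y))" by (intro comp_intros assms)
  then show ?thesis by simp
qed

lemma computable_mem [comp_intros]:
  assumes "computable f" and "computable xs"
  shows "computable (\<lambda>x. f x \<in> set (xs x))"
proof -
  have "computable (\<lambda>x. \<exists>y \<in> set (xs x). f x = y)"
    by (intro comp_intros computable_comp[OF assms(1)] assms)
  then show ?thesis by simp
qed

lemma computable_remdups [comp_intros]:
  fixes xs :: "'a::cod \<Rightarrow> 'b::cod list"
  assumes "computable xs"
  shows "computable (\<lambda>x. remdups (xs x))"
proof -
  have "foldr (\<lambda>y a. if y \<in> set a then a else y # a) ys [] = remdups ys" for ys :: "'b list"
  proof (induction ys)
    case (Cons y ys)
    show ?case by (simp add: Cons.IH)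
  qed simp
  moreover have "computable (\<lambda>x. foldr (\<lambda>y a. if y \<in> set a then a else y # a) (xs x) [])"
    by (intro comp_intros assms)
  ultimately show ?thesis by simp
qed

lemma computable_upt [comp_intros]:
  assumes "computable f" and "computable g"
  shows "computable (\<lambda>x. [f x..<g x])"
proof -
  have *: "((\<lambda>a. a @ [m + length a]) ^^ k) [] = [m..<m + k]" for m k :: nat
    by (induction k) auto
  have "((\<lambda>a. a @ [m + length a]) ^^ (n - m)) [] = [m..<n]" for m n :: nat
    unfolding * by (cases "m \<le> n") auto
  moreover have "computable (\<lambda>x. ((\<lambda>a. a @ [f x + length a]) ^^ (g x - f x)) [])"
    by (intro comp_intros computable_comp[OF assms(1)] assms)
  ultimately show ?thesis by simp
qed

lemma computable_div [comp_intros]: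
  assumes "computable f" and "computable (g :: 'a::cod \<Rightarrow> nat)"
  shows "computable (\<lambda>x. f x div g x)"
proof -
  have "length (filter (\<lambda>k. Suc k * b \<le> a) [0..<a]) = a div b" if "b > 0" for a b :: nat
  proof -
    have iff: "Suc k * b \<le> a \<longleftrightarrow> k < a div b" for k
      using less_eq_div_iff_mult_less_eq[OF that, of "Suc k" a] by (simp only: Suc_le_eq)
    have "set (filter (\<lambda>k. Suc k * b \<le> a) [0..<a]) = {..<a div b}"
      unfolding iff using div_le_dividend[of a b] by (auto simp del: div_le_dividend)
    then show ?thesis
      using distinct_card[of "filter (\<lambda>k. Suc k * b \<le> a) [0..<a]"]
      by (simp only: distinct_filter distinct_upt card_lessThan)
  qed
  then have "(if b = 0 then 0 else length (filter (\<lambda>k. Suc k * b \<le> a) [0..<a])) = a div b"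
    for a b :: nat by simp
  moreover have "computable (\<lambda>x. if g x = 0 then 0 else
      length (filter (\<lambda>k. Suc k * g x \<le> f x) [0..<f x]))"
    by (intro comp_intros computable_comp[OF assms(1)] computable_comp[OF assms(2)] assms)
  ultimately show ?thesis by simp
qed

lemma computable_mod [comp_intros]:
  assumes "computable f" and "computable (g :: 'a::cod \<Rightarrow> nat)"
  shows "computable (\<lambda>x. f x mod g x)"
proof -
  have "computable (\<lambda>x. f x - f x div g x * g x)" by (intro comp_intros assms)
  then show ?thesis by (simp add: minus_div_mult_eq_mod)
qed

text \<open>Unbounded search needs total functions on codes, hence codes are normalized first.\<close>

class ncod = cod +
  assumes cfun_norm: "cfun (\<lambda>n. cd (dc n :: 'a))"

lemma computable_norm: "computable (\<lambda>n. cd (dc n :: 'a::ncod))"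
  by (rule computableI[OF cfun_norm]) simp

instance nat :: ncod
  by standard (simp add: cd_nat_def dc_nat_def cfun_id)

instance bool :: ncod
proof
  have "cfun (\<lambda>n. if n = 0 then 0 else 1)" by (intro cfun_if cfun_id cfun_const)
  moreover have "(\<lambda>n. if n = 0 then 0 else 1) = (\<lambda>n. cd (dc n :: bool))"
    by (auto simp: cd_bool_def dc_bool_def)
  ultimately show "cfun (\<lambda>n. cd (dc n :: bool))" by (simp only:)
qed

instance prod :: (ncod, ncod) ncod
proof
  have "cfun (\<lambda>n. prod_encode (cd (dc (fst (prod_decode n)) :: 'a), cd (dc (snd (prod_decode n)) :: 'b)))"
    by (rule cfun_pair; rule cfun_comp[OF cfun_norm]; rule cfun_fst cfun_snd)
  then show "cfun (\<lambda>n. cd (dc n :: 'a \<times> 'b))"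
    by (simp add: cd_prod_def dc_prod_def)
qed

instance list :: (ncod) ncod
proof
  have "computable (\<lambda>xs. map (\<lambda>k. cd (dc k :: 'a)) xs)"
    by (intro comp_intros computable_comp[OF computable_norm])
  then obtain F where F: "cfun F" "\<And>xs. F (cd xs) = cd (map (\<lambda>k. cd (dc k :: 'a)) xs)"
    unfolding computable_def by blast
  have "F n = cd (dc n :: 'a list)" for n
    using F(2)[of "list_decode n"] by (simp add: cd_list_def dc_list_def cd_nat_def[abs_def] comp_def)
  then have "F = (\<lambda>n. cd (dc n :: 'a list))" by blast
  with F(1) show "cfun (\<lambda>n. cd (dc n :: 'a list))" by (simp only:)
qed

lemma computable_dc: "computable (dc :: nat \<Rightarrow> 'a::ncod)"
  by (rule computableI[OF cfun_norm]) simp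

lemma computable_Least:
  fixes R :: "'a::ncod \<Rightarrow> nat \<Rightarrow> bool"
  assumes "computable (\<lambda>p. R (fst p) (snd p))" and "\<And>x. \<exists>n. R x n"
  shows "computable (\<lambda>x. LEAST n. R x n)"
proof -
  obtain F where F: "cfun F" "\<And>p. F (cd p) = cd (\<not> R (fst p) (snd p))"
    using computable_not[OF assms(1)] unfolding computable_def by blast
  have R: "F (prod_encode (cd x, n)) = 0 \<longleftrightarrow> R x n" for x n
    using F(2)[of "(x, n)"] by (simp add: cd_Pair)
  define G where "G = (\<lambda>q. F (prod_encode (cd (dc (fst (prod_decode q)) :: 'a), snd (prod_decode q))))"
  have "cfun G"
    unfolding G_def
    by (intro cfun_comp[OF F(1)] cfun_pair cfun_comp[OF cfun_norm] cfun_fst cfun_snd)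
  moreover have G: "G (prod_encode (c, n)) = 0 \<longleftrightarrow> R (dc c) n" for c n
    by (simp add: G_def R)
  ultimately have "cfun (\<lambda>x. LEAST y. G (prod_encode (x, y)) = 0)"
    by (intro cfun_Least) (simp_all add: assms(2))
  then show ?thesis
    by (rule computableI) (simp add: G)
qed

text \<open>Turns mere existence into a computable choice, the first code of a witness. Values of
  machines, the lists and later the prices become computable in this way.\<close>

lemma computable_choice:
  fixes R :: "'a::ncod \<Rightarrow> 'b::ncod \<Rightarrow> bool"
  assumes "computable (\<lambda>p. R (fst p) (snd p))" and "\<And>x. \<exists>y. R x y"
  shows "\<exists>f. computable f \<and> (\<forall>x. R x (f x))"
proof -
  have ex: "\<exists>n. R x (dc n)" for x by (metis assms(2) dc_cd)
  have "computable (\<lambda>x. LEAST n. R x (dc n))"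
    by (intro computable_Least ex computable_comp2[OF assms(1)] comp_intros
        computable_comp[OF computable_dc])
  then have "computable (\<lambda>x. dc (LEAST n. R x (dc n)) :: 'b)"
    by (rule computable_comp[OF computable_dc])
  moreover have "R x (dc (LEAST n. R x (dc n)))" for x using ex by (rule LeastI_ex)
  ultimately show ?thesis by blast
qed

section \<open>Simulation of machines\<close>

text \<open>Meant for the transition function of a machine, an arbitrary function that matters at
  finitely many arguments only.\<close>

lemma computable_finite_table:
  fixes g :: "'a::cod \<Rightarrow> 'b::cod"
  assumes "finite D"
  obtains f where "computable f" and "\<And>x. x \<in> D \<Longrightarrow> f x = g x"
proof -
  have "\<exists>f. computable f \<and> (\<forall>x \<in> D. f x = g x)"
    using assms
  proof induction
    case empty
    show ?case by (intro exI[of _ "\<lambda>_. undefined"]) (simp add: computable_const)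
  next
    case (insert a D)
    then obtain f where f: "computable f" "\<forall>x \<in> D. f x = g x" by blast
    have "computable (\<lambda>x. if x = a then g a else f x)" by (intro comp_intros f(1))
    with f(2) show ?case by (intro exI[of _ "\<lambda>x. if x = a then g a else f x"]) auto
  qed
  then show ?thesis using that by blast
qed

lemma computable_zip [comp_intros]:
  fixes xs :: "'a::cod \<Rightarrow> 'b::cod list" and ys :: "'a \<Rightarrow> 'c::cod list"
  assumes "computable xs" and "computable ys"
  shows "computable (\<lambda>x. zip (xs x) (ys x))"
proof -
  let ?g = "\<lambda>st x. case snd st of [] \<Rightarrow> st | y # zs \<Rightarrow> (fst st @ [(x, y)], zs)"
  have Nil: "foldl ?g (acc, []) us = (acc, [])" for acc :: "('b \<times> 'c) list" and us
    by (induction us) auto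
  have "fst (foldl ?g (acc, vs) us) = acc @ zip us vs" for acc :: "('b \<times> 'c) list" and us vs
  proof (induction us arbitrary: acc vs)
    case (Cons u us)
    then show ?case by (cases vs) (simp_all add: Nil)
  qed simp
  moreover have "computable (\<lambda>x. fst (foldl ?g ([], ys x) (xs x)))"
    by (intro comp_intros assms)
  ultimately show ?thesis by simp
qed

fun look :: "(nat \<times> nat) list \<Rightarrow> nat \<Rightarrow> nat" where
  "look [] p = 0"
| "look (e # h) p = (if fst e = p then snd e else look h p)"

lemma computable_look [comp_intros]:
  assumes "computable h" and "computable p"
  shows "computable (\<lambda>x. look (h x) (p x))"
proof -
  have "foldr (\<lambda>e a. if fst e = q then snd e else a) es 0 = look es q" for es q
    by (induction es) auto
  moreover have "computable (\<lambda>x. foldr (\<lambda>e a. if fst e = p x then snd e else a) (h x) 0)"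
    by (intro comp_intros computable_comp[OF assms(2)] assms)
  ultimately show ?thesis by simp
qed

lemma int_encode_nonneg: "int_encode (int n) = 2 * n"
  by (simp add: int_encode_def sum_encode_def)

lemma int_encode_neg: "int_encode (- 1 - int n) = Suc (2 * n)"
  by (simp add: int_encode_def sum_encode_def)

text \<open>\<open>int_encode\<close> maps nonnegative integers to even and negative ones to odd
  numbers. The step from -1 to 0 is \<open>1 - 2 = 0\<close>, by truncated subtraction; only the
  step from 0 to -1 needs a case of its own in \<open>down\<close>.\<close>

definition up :: "nat \<Rightarrow> nat" where
  "up n = (if n mod 2 = 0 then n + 2 else n - 2)"

definition down :: "nat \<Rightarrow> nat" where
  "down n = (if n mod 2 = 0 then if n = 0 then 1 else n - 2 else n + 2)"

lemma up: "int_encode (i + 1) = up (int_encode i)"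
proof (cases i)
  case (nonneg n)
  then show ?thesis using int_encode_nonneg[of n] int_encode_nonneg[of "Suc n"]
    by (simp add: up_def add.commute)
next
  case (neg n)
  then have i: "i = - 1 - int n" by simp
  show ?thesis
  proof (cases n)
    case 0
    then show ?thesis using i int_encode_neg[of 0] int_encode_nonneg[of 0] by (simp add: up_def)
  next
    case (Suc k)
    then have "i + 1 = - 1 - int k" using i by simp
    then show ?thesis unfolding i
      using int_encode_neg[of n] int_encode_neg[of k] Suc by (simp add: up_def mod_Suc)
  qed
qed

lemma down: "int_encode (i - 1) = down (int_encode i)"
proof (cases i)
  case (nonneg n)
  show ?thesis
  proof (cases n)
    case 0
    then show ?thesis using nonneg int_encode_neg[of 0] int_encode_nonneg[of 0]
      by (simp add: down_def)
  next
    case (Suc k)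
    then have "i - 1 = int k" using nonneg by simp
    then show ?thesis unfolding nonneg
      using int_encode_nonneg[of n] int_encode_nonneg[of k] Suc by (simp add: down_def)
  qed
next
  case (neg n)
  then have i: "i = - 1 - int n" "i - 1 = - 1 - int (Suc n)" by simp_all
  show ?thesis unfolding i(2) unfolding i(1)
    using int_encode_neg[of n] int_encode_neg[of "Suc n"] by (simp add: down_def mod_Suc)
qed

fun move_code :: "move \<Rightarrow> nat" where
  "move_code MLeft = 0"
| "move_code MStay = 1"
| "move_code MRight = 2"

text \<open>A tape is represented by the history of its writes, latest first, and the head position;
  cells are numbered by \<open>int_encode\<close>.\<close>

type_synonym ctape = "(nat \<times> nat) list \<times> nat"

definition tape_rel :: "tape \<Rightarrow> ctape \<Rightarrow> bool" where
  "tape_rel tp c \<longleftrightarrow> snd c = int_encode (snd tp) \<and> (\<forall>i. fst tp i = look (fst c) (int_encode i))"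

definition cact :: "nat \<times> nat \<Rightarrow> ctape \<Rightarrow> ctape" where
  "cact a c = ((snd c, fst a) # fst c,
     if snd a = 0 then down (snd c) else if snd a = 1 then snd c else up (snd c))"

lemma tape_rel_act:
  assumes "tape_rel tp c"
  shows "tape_rel (act (s, m) tp) (cact (s, move_code m) c)"
proof (cases tp)
  case (Pair f h)
  with assms show ?thesis
    by (cases m) (auto simp: tape_rel_def cact_def up down int_encode_eq)
qed

lemma tape_rel_scan: "tape_rel tp c \<Longrightarrow> scan tp = look (fst c) (snd c)"
  by (cases tp) (simp add: tape_rel_def)

definition in_hist :: "nat list \<Rightarrow> (nat \<times> nat) list" where
  "in_hist w = zip (map (\<lambda>i. 2 * i) [0..<length w]) w"

lemma look_map_eq: "inj k \<Longrightarrow> look (map (\<lambda>i. (k i, g i)) xs) (k j) = (if j \<in> set xs then g j else 0)"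
  by (induction xs) (simp_all add: inj_eq eq_commute[of _ j])

lemma look_map_other: "q \<notin> range k \<Longrightarrow> look (map (\<lambda>i. (k i, g i)) xs) q = 0"
  by (induction xs) auto

lemma tape_rel_input: "tape_rel (input_tape w) (in_hist w, 0)"
proof -
  have h: "in_hist w = map (\<lambda>i. (2 * i, w ! i)) [0..<length w]"
    unfolding in_hist_def by (rule nth_equalityI) auto
  have "fst (input_tape w) i = look (in_hist w) (int_encode i)" for i
  proof (cases i)
    case (nonneg n)
    have "look (in_hist w) (2 * n) = (if n \<in> set [0..<length w] then w ! n else 0)"
      unfolding h by (rule look_map_eq) (auto intro: injI)
    then show ?thesis using nonneg by (simp add: input_tape_def int_encode_nonneg)
  next
    case (neg n)
    then have i: "i = - 1 - int n" by simp
    have "look (in_hist w) (Suc (2 * n)) = 0"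
    proof -
      have "Suc (2 * n) \<noteq> 2 * k" for k by presburger
      then show ?thesis unfolding h by (intro look_map_other) blast
    qed
    then show ?thesis using i by (simp add: input_tape_def int_encode_neg)
  qed
  moreover have "int_encode 0 = 0" using int_encode_nonneg[of 0] by simp
  moreover have "snd (input_tape w) = 0" by (simp add: input_tape_def)
  ultimately show ?thesis by (simp add: tape_rel_def)
qed

lemma tape_rel_blank: "tape_rel blank_tape ([], 0)"
  using int_encode_nonneg[of 0] by (simp add: tape_rel_def blank_tape_def)

lemma holds_word_look:
  assumes "tape_rel tp c"
  shows "holds_word tp v \<longleftrightarrow> map (\<lambda>i. look (fst c) (2 * i)) [0..<length v] = v \<and> 0 \<notin> set v \<and>
    look (fst c) (2 * length v) = 0"
proof -
  have l: "fst tp (int i) = look (fst c) (2 * i)" for i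
    using assms by (simp add: tape_rel_def int_encode_nonneg)
  show ?thesis
  proof -
    have A: "map (\<lambda>i. look (fst c) (2 * i)) [0..<length v] = v \<longleftrightarrow>
        (\<forall>i < length v. look (fst c) (2 * i) = v ! i)"
      by (subst list_eq_iff_nth_eq) simp
    have B: "0 \<notin> set v \<longleftrightarrow> (\<forall>i < length v. v ! i \<noteq> 0)"
      by (simp only: in_set_conv_nth) metis
    show ?thesis unfolding holds_word_def l A B by metis
  qed
qed

text \<open>Symbols below 4 belong to every alphabet. With such an input all tape symbols stay in
  the alphabet, which is the last conjunct of \<open>rel\<close>, and the finite transition table on
  \<open>D\<close> suffices.\<close>

lemma computable_outputs_within:
  assumes "wf_tm M"
  obtains f where "computable (\<lambda>q. f (fst q) (fst (snd q)) (snd (snd q)))"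
    and "\<And>w v s. set w \<subseteq> {..<4} \<Longrightarrow> f w v s \<longleftrightarrow> outputs_within M w v s"
proof -
  define H where "H = halt_state M"
  define K where "K = tape_count M"
  define A where "A = alphabet_size M"
  have K: "K \<ge> 1" and A: "A \<ge> 4" using assms by (auto simp: wf_tm_def K_def A_def)
  define D where "D = {..<H} \<times> {ss. set ss \<subseteq> {..<A} \<and> length ss = K}"
  have "finite D" unfolding D_def by (intro finite_cartesian_product finite_lists_length_eq) auto
  define g where "g x = (case transition M (fst x) (snd x) of (q', acts) \<Rightarrow>
     (q', map (\<lambda>a. (fst a, move_code (snd a))) acts))" for x
  obtain tr where tr: "computable tr" "\<And>x. x \<in> D \<Longrightarrow> tr x = g x"
    using computable_finite_table[OF \<open>finite D\<close>, of g] by blast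
  define scans where "scans ts = map (\<lambda>c. look (fst c) (snd c)) ts" for ts :: "ctape list"
  define cstep where "cstep cf = (if fst cf = H then cf
     else (fst (tr (fst cf, scans (snd cf))),
       map (\<lambda>p. cact (fst p) (snd p)) (zip (snd (tr (fst cf, scans (snd cf)))) (snd cf))))"
    for cf :: "nat \<times> ctape list"
  define cstart where "cstart w = (0::nat, (in_hist w, 0::nat) # map (\<lambda>_. ([], 0)) [0..<K - 1])"
    for w
  define f where "f w v s = (let cf = (cstep ^^ s) (cstart w) in fst cf = H \<and>
     (case rev (snd cf) of [] \<Rightarrow> False | c # _ \<Rightarrow>
       map (\<lambda>i. look (fst c) (2 * i)) [0..<length v] = v \<and> 0 \<notin> set v \<and>
       look (fst c) (2 * length v) = 0))" for w v :: "nat list" and s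
  have "computable (\<lambda>q. f (fst q) (fst (snd q)) (snd (snd q)))"
    unfolding f_def Let_def cstart_def cstep_def scans_def cact_def in_hist_def up_def down_def
    by (intro comp_intros computable_comp[OF tr(1)])
  moreover have "f w v s \<longleftrightarrow> outputs_within M w v s" if w: "set w \<subseteq> {..<4}" for w v s
  proof -
    define rel where "rel cf cc \<longleftrightarrow> fst cc = fst cf \<and> fst cf \<le> H \<and> length (snd cf) = K \<and>
       list_all2 tape_rel (snd cf) (snd cc) \<and> (\<forall>tp \<in> set (snd cf). \<forall>i. fst tp i < A)"
      for cf :: config and cc :: "nat \<times> ctape list"
    have rel0: "rel (start M w) (cstart w)"
    proof -
      have "fst (input_tape w) i < A" for i
      proof -
        have "w ! n < A" if "n < length w" for n using w that A nth_mem[of n w] by fastforce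
        then show ?thesis using A by (auto simp: input_tape_def nat_less_iff)
      qed
      moreover have "fst blank_tape i < A" for i using A by (simp add: blank_tape_def)
      moreover have "list_all2 tape_rel (replicate n blank_tape) (map (\<lambda>_. ([], 0)) [0..<n])" for n
        by (auto simp: list_all2_conv_all_nth tape_rel_blank)
      ultimately show ?thesis
        using K by (auto simp: rel_def start_def cstart_def K_def tape_rel_input)
    qed
    have rels: "rel (step M cf) (cstep cc)" if r: "rel cf cc" for cf cc
    proof (cases "fst cf = H")
      case True
      then show ?thesis using r by (cases cf) (auto simp: cstep_def rel_def H_def)
    next
      case False
      obtain q ts cts where cf: "cf = (q, ts)" "cc = (q, cts)"
        using r by (cases cf, cases cc) (auto simp: rel_def)
      have q: "q < H" and len: "length ts = K" and ts: "list_all2 tape_rel ts cts"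
        and sym: "\<forall>tp \<in> set ts. \<forall>i. fst tp i < A"
        using r False by (auto simp: rel_def cf)
      have sc: "scans cts = map scan ts"
      proof (rule nth_equalityI)
        show "length (scans cts) = length (map scan ts)"
          using list_all2_lengthD[OF ts] by (simp add: scans_def)
        fix i
        assume "i < length (scans cts)"
        then have "i < length cts" "i < length ts"
          using list_all2_lengthD[OF ts] by (simp_all add: scans_def)
        then show "scans cts ! i = map scan ts ! i"
          using tape_rel_scan[OF list_all2_nthD[OF ts]] by (simp add: scans_def)
      qed
      have scA: "scan tp < A" if "tp \<in> set ts" for tp using sym that by (cases tp) auto
      have inD: "(q, map scan ts) \<in> D" using q len scA by (auto simp: D_def)
      obtain q' acts where t: "transition M q (map scan ts) = (q', acts)" by fastforce
      have wf: "q' \<le> H" "length acts = K" "fst ` set acts \<subseteq> {..<A}"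
      proof -
        have "set (map scan ts) \<subseteq> {..<A}" "length (map scan ts) = K" using scA len by auto
        then have "case transition M q (map scan ts) of (q', acts) \<Rightarrow> q' \<le> H \<and> length acts = K \<and>
            fst ` set acts \<subseteq> {..<A}"
          using assms q unfolding wf_tm_def H_def K_def A_def by simp
        then show "q' \<le> H" "length acts = K" "fst ` set acts \<subseteq> {..<A}" by (simp_all add: t)
      qed
      have c: "cstep cc = (q', map (\<lambda>p. cact (fst p) (snd p))
          (zip (map (\<lambda>a. (fst a, move_code (snd a))) acts) cts))"
        using q by (simp add: cstep_def cf sc tr(2)[OF inD] g_def t)
      have s: "step M cf = (q', map2 act acts ts)"
        using q t by (simp add: cf H_def)
      have "list_all2 tape_rel (map2 act acts ts) (map (\<lambda>p. cact (fst p) (snd p))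
          (zip (map (\<lambda>a. (fst a, move_code (snd a))) acts) cts))"
      proof (rule list_all2_all_nthI)
        show "length (map2 act acts ts) = length (map (\<lambda>p. cact (fst p) (snd p))
            (zip (map (\<lambda>a. (fst a, move_code (snd a))) acts) cts))"
          using list_all2_lengthD[OF ts] by simp
        fix i
        assume "i < length (map2 act acts ts)"
        then have i: "i < length acts" "i < length ts" "i < length cts"
          using list_all2_lengthD[OF ts] by simp_all
        show "tape_rel (map2 act acts ts ! i) (map (\<lambda>p. cact (fst p) (snd p))
            (zip (map (\<lambda>a. (fst a, move_code (snd a))) acts) cts) ! i)"
          using tape_rel_act[OF list_all2_nthD[OF ts i(2)], of "fst (acts ! i)" "snd (acts ! i)"] i
          by simp
      qed
      moreover have "fst tp i < A" if tp: "tp \<in> set (map2 act acts ts)" for tp i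
      proof -
        from tp obtain z where "z \<in> set (zip acts ts)" "tp = (case z of (a, t) \<Rightarrow> act a t)"
          unfolding set_map by blast
        then obtain a tp0 where a: "(a, tp0) \<in> set (zip acts ts)" "tp = act a tp0"
          by (metis case_prod_beta prod.collapse)
        then have "fst a < A" "fst tp0 i < A" for i
          using wf(3) sym by (auto dest: set_zip_leftD set_zip_rightD)
        then show ?thesis unfolding a(2) by (cases a; cases tp0) auto
      qed
      ultimately show ?thesis using wf len by (simp add: rel_def c s)
    qed
    have "rel ((step M ^^ n) (start M w)) ((cstep ^^ n) (cstart w))" for n
      by (induction n) (auto intro: rel0 rels)
    then have r: "rel ((step M ^^ s) (start M w)) ((cstep ^^ s) (cstart w))" .
    obtain q ts cts where cf: "(step M ^^ s) (start M w) = (q, ts)"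
      "(cstep ^^ s) (cstart w) = (q, cts)"
    proof (rule that)
      show "(step M ^^ s) (start M w) = (fst ((step M ^^ s) (start M w)), snd ((step M ^^ s) (start M w)))"
        by simp
      show "(cstep ^^ s) (cstart w) = (fst ((step M ^^ s) (start M w)), snd ((cstep ^^ s) (cstart w)))"
        using r by (simp add: rel_def prod_eq_iff)
    qed
    then have ts: "list_all2 tape_rel ts cts" "length ts = K" using r by (auto simp: rel_def)
    then have "ts \<noteq> []" "cts \<noteq> []" using K by (auto dest: list_all2_lengthD)
    then have rv: "rev cts = last cts # rev (butlast cts)"
      by (cases cts rule: rev_cases) simp_all
    have "tape_rel (last ts) (last cts)"
      using list_all2_nthD[OF ts(1), of "length ts - 1"] list_all2_lengthD[OF ts(1)] \<open>ts \<noteq> []\<close> \<open>cts \<noteq> []\<close>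
      by (simp add: last_conv_nth)
    then show ?thesis
      unfolding f_def Let_def cf fst_conv snd_conv rv list.case outputs_within_def prod.case H_def
      by (simp add: holds_word_look)
  qed
  ultimately show ?thesis using that by blast
qed

section \<open>Values and lists found by searching for running times\<close>

lemma computable_enc [comp_intros]:
  assumes "computable x"
  shows "computable (\<lambda>p. enc (x p))"
  unfolding enc_def by (intro comp_intros assms)

lemma enc_symbols: "set (enc x) \<subseteq> {1, 2}"
  by (auto simp: enc_def)

lemma enc_list_Cons: "enc_list (w # ws) = enc w @ 3 # enc_list ws"
  by (simp add: enc_list_def)

lemma enc_separator:
  assumes "enc x @ 3 # u = enc y @ 3 # v"
  shows "x = y \<and> u = v"
proof -
  have "takeWhile (\<lambda>s. s \<noteq> 3) (enc z @ 3 # r) = enc z" for z r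
    using enc_symbols[of z] by (subst takeWhile_append2) auto
  with assms have "enc x = enc y" by metis
  with assms show ?thesis by (simp add: enc_inject)
qed

lemma enc_list_inject: "enc_list ws = enc_list vs \<Longrightarrow> ws = vs"
proof (induction ws arbitrary: vs)
  case Nil
  then show ?case by (cases vs) (auto simp: enc_list_def)
next
  case (Cons w ws)
  then obtain v us where "vs = v # us" by (cases vs) (auto simp: enc_list_def)
  with Cons.prems enc_separator[of w _ v] Cons.IH show ?case
    by (auto simp: enc_list_Cons)
qed

lemma enc_pair_symbols: "set (enc_pair x y) \<subseteq> {..<4}"
  using enc_symbols[of x] enc_symbols[of y] by (auto simp: enc_pair_def)

text \<open>The search is for a pair of a value and a running time; \<open>outputs_unique\<close>
  makes every pair found correct.\<close>

lemma computable_of_tm: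
  assumes "computable_nat r"
  shows "computable r"
proof -
  from assms obtain M where M: "wf_tm M"
    "\<And>n. tm_fun M (replicate n True) = Some (replicate (r n) True)"
    unfolding computable_nat_def by blast
  obtain f where f: "computable (\<lambda>q. f (fst q) (fst (snd q)) (snd (snd q)))"
    "\<And>w v s. set w \<subseteq> {..<4} \<Longrightarrow> f w v s \<longleftrightarrow> outputs_within M w v s"
    using computable_outputs_within[OF M(1)] by blast
  let ?u = "\<lambda>n::nat. map (\<lambda>_. True) [0..<n]"
  have u: "?u n = replicate n True" for n by (simp add: map_replicate_const)
  have sym: "set (enc x) \<subseteq> {..<4}" for x using enc_symbols[of x] by auto
  define R where "R n ks = f (enc (?u n)) (enc (?u (fst ks))) (snd ks)" for n and ks :: "nat \<times> nat"
  have R: "R n ks \<longleftrightarrow> outputs_within M (enc (replicate n True)) (enc (replicate (fst ks) True)) (snd ks)"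
    for n ks unfolding R_def f(2)[OF sym] u ..
  have "computable (\<lambda>p. R (fst p) (snd p))"
    unfolding R_def by (intro computable_comp3[OF f(1)] comp_intros)
  moreover have "\<exists>ks. R n ks" for n
    using M(2)[of n] unfolding R by (auto simp: tm_fun_eq_Some_iff outputs_def)
  ultimately obtain h where h: "computable h" "\<And>n. R n (h n)"
    using computable_choice by blast
  have "fst (h n) = r n" for n
  proof -
    have "tm_fun M (replicate n True) = Some (replicate (fst (h n)) True)"
      using h(2)[of n] unfolding R tm_fun_eq_Some_iff outputs_def by blast
    then show ?thesis using M(2)[of n] by simp
  qed
  moreover have "computable (\<lambda>n. fst (h n))" by (intro computable_fst h(1))
  ultimately show ?thesis by simp
qed

lemma computable_run:
  assumes "wf_tm U"
  obtains R where "computable (\<lambda>q. R (fst q) (fst (snd q)) (snd (snd q)))"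
    and "\<And>p x. tm_fun U p = Some x \<longleftrightarrow> (\<exists>s::nat. R p x s)"
proof -
  obtain f where f: "computable (\<lambda>q. f (fst q) (fst (snd q)) (snd (snd q)))"
    "\<And>w v s. set w \<subseteq> {..<4} \<Longrightarrow> f w v s \<longleftrightarrow> outputs_within U w v s"
    using computable_outputs_within[OF assms] by blast
  have sym: "set (enc x) \<subseteq> {..<4}" for x using enc_symbols[of x] by auto
  show ?thesis
  proof (rule that[of "\<lambda>p x s. f (enc p) (enc x) s"])
    show "computable (\<lambda>q. f (enc (fst q)) (enc (fst (snd q))) (snd (snd q)))"
      by (intro computable_comp3[OF f(1)] comp_intros)
    show "tm_fun U p = Some x \<longleftrightarrow> (\<exists>s. f (enc p) (enc x) s)" for p x
      by (simp add: f(2)[OF sym] tm_fun_eq_Some_iff outputs_def)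
  qed
qed

lemma computable_lists:
  assumes "list_approximates U F T r c"
  obtains lst :: "bool list \<Rightarrow> bool list \<Rightarrow> bool list list"
  where "computable (\<lambda>q. lst (fst q) (snd q))"
    and "\<And>x \<rho>. distinct (lst x \<rho>)"
    and "\<And>x \<rho>. length \<rho> = r (length x) \<Longrightarrow> length (lst x \<rho>) = T (length x)"
    and "\<And>x. 2 * card {\<rho>. length \<rho> = r (length x) \<and>
      (\<exists>p \<in> set (lst x \<rho>). short_program U (c (length x)) p x)} \<ge> 2 ^ r (length x)"
proof -
  from assms obtain L where wf: "wf_tm F" and r: "computable_nat r" and
    L: "\<And>x \<rho>. length \<rho> = r (length x) \<Longrightarrow> outputs_set F x \<rho> (L x \<rho>) \<and> card (L x \<rho>) = T (length x)"
    and half: "\<And>x. real (card {\<rho>. length \<rho> = r (length x) \<and>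
                           (\<exists>p \<in> L x \<rho>. short_program U (c (length x)) p x)})
               \<ge> 1/2 * real (card {\<rho> :: bool list. length \<rho> = r (length x)})"
    unfolding list_approximates_def by blast
  obtain f where f: "computable (\<lambda>q. f (fst q) (fst (snd q)) (snd (snd q)))"
    "\<And>w v s. set w \<subseteq> {..<4} \<Longrightarrow> f w v s \<longleftrightarrow> outputs_within F w v s"
    using computable_outputs_within[OF wf] by blast
  \<comment> \<open>The guard keeps the search total, as halting is guaranteed only for random
    strings of the right length; it is decidable because \<open>r\<close> is computable.\<close>
  define R where "R x y \<longleftrightarrow> (length (snd x) = r (length (fst x)) \<longrightarrow>
     f (enc_pair (fst x) (snd x)) (enc_list (fst y)) (snd y))"
    for x :: "bool list \<times> bool list" and y :: "bool list list \<times> nat"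
  have "computable (\<lambda>p. R (fst p) (snd p))"
    unfolding R_def enc_pair_def enc_list_def
    by (intro computable_imp computable_comp3[OF f(1)] comp_intros computable_comp[OF computable_of_tm[OF r]])
  moreover have "\<exists>y. R x y" for x
    using L[of "snd x" "fst x"] f(2)[OF enc_pair_symbols]
    by (fastforce simp: R_def outputs_set_def outputs_def)
  ultimately obtain h where h: "computable h" "\<And>x. R x (h x)"
    using computable_choice by blast
  define lst where "lst x \<rho> = remdups (fst (h (x, \<rho>)))" for x \<rho>
  have c: "computable (\<lambda>q. lst (fst q) (snd q))"
    unfolding lst_def by (intro comp_intros computable_comp[OF h(1)])
  have set_lst: "set (lst x \<rho>) = L x \<rho>" if len: "length \<rho> = r (length x)" for x \<rho>
  proof -
    have "outputs F (enc_pair x \<rho>) (enc_list (fst (h (x, \<rho>))))"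
      using h(2)[of "(x, \<rho>)"] len f(2)[OF enc_pair_symbols] by (auto simp: R_def outputs_def)
    moreover obtain ws where "outputs F (enc_pair x \<rho>) (enc_list ws)" "L x \<rho> = set ws"
      using L[OF len] by (auto simp: outputs_set_def)
    ultimately show ?thesis using outputs_unique enc_list_inject by (metis lst_def set_remdups)
  qed
  show ?thesis
  proof (rule that[of lst])
    show "computable (\<lambda>q. lst (fst q) (snd q))" by (rule c)
    show d: "distinct (lst x \<rho>)" for x \<rho> by (simp add: lst_def)
    show "length (lst x \<rho>) = T (length x)" if "length \<rho> = r (length x)" for x \<rho>
      using distinct_card[OF d, of x \<rho>] set_lst[OF that] L[OF that] by simp
    show "2 * card {\<rho>. length \<rho> = r (length x) \<and>
      (\<exists>p \<in> set (lst x \<rho>). short_program U (c (length x)) p x)} \<ge> 2 ^ r (length x)" for x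
    proof -
      have "card {\<rho> :: bool list. length \<rho> = r (length x)} = 2 ^ r (length x)"
        using card_lists_length_eq[of "UNIV :: bool set" "r (length x)"] by simp
      moreover have "{\<rho>. length \<rho> = r (length x) \<and>
          (\<exists>p \<in> set (lst x \<rho>). short_program U (c (length x)) p x)} =
        {\<rho>. length \<rho> = r (length x) \<and> (\<exists>p \<in> L x \<rho>. short_program U (c (length x)) p x)}"
        using set_lst by auto
      ultimately have "real (2 * card {\<rho>. length \<rho> = r (length x) \<and>
          (\<exists>p \<in> set (lst x \<rho>). short_program U (c (length x)) p x)}) \<ge> real (2 ^ r (length x))"
        using half[of x] by simp
      then show ?thesis by (simp only: of_nat_le_iff)
    qed
  qed
qed

section \<open>Complexity of the elements of small enumerable sets\<close>

lemma bits_code_eq_cd: "bits_code w = cd w"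
proof -
  have "(cd :: bool \<Rightarrow> nat) = of_bool" by (rule ext) simp
  then show ?thesis by (simp add: bits_code_def cd_list_def)
qed

lemma machine_exists:
  fixes R :: "bool list \<Rightarrow> nat \<Rightarrow> bool" and h :: "bool list \<Rightarrow> nat \<Rightarrow> bool list"
  assumes "computable (\<lambda>q. R (fst q) (snd q))" and "computable (\<lambda>q. h (fst q) (snd q))"
  obtains V where "wf_tm V"
    and "\<And>p. \<exists>y. R p y \<Longrightarrow> tm_fun V p = Some (h p (LEAST y. R p y))"
proof -
  have "computable (\<lambda>q. \<not> R (rev (fst q)) (snd q))"
    by (intro computable_not computable_comp2[OF assms(1)] comp_intros)
  then obtain F where F: "cfun F" "\<And>q. F (cd q) = cd (\<not> R (rev (fst q)) (snd q))"
    unfolding computable_def by blast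
  have "computable (\<lambda>q. h (rev (fst q)) (snd q))"
    by (intro computable_comp2[OF assms(2)] comp_intros)
  then obtain G where G: "cfun G" "\<And>q. G (cd q) = cd (h (rev (fst q)) (snd q))"
    unfolding computable_def by blast
  have F': "F (prod_encode (bits_code (rev p), y)) = 0 \<longleftrightarrow> R p y" for p y
    using F(2)[of "(rev p, y)"] by (simp add: cd_Pair bits_code_eq_cd)
  have G': "G (prod_encode (bits_code (rev p), y)) = bits_code (h p y)" for p y
    using G(2)[of "(rev p, y)"] by (simp add: cd_Pair bits_code_eq_cd)
  obtain V where V: "wf_tm V"
    "\<And>p w. \<exists>y. F (prod_encode (bits_code (rev p), y)) = 0 \<Longrightarrow>
      G (prod_encode (bits_code (rev p), LEAST y. F (prod_encode (bits_code (rev p), y)) = 0)) =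
        bits_code w \<Longrightarrow> tm_fun V p = Some w"
    by (rule machine_of_search[OF F(1) G(1)]) (rule that; assumption)
  show ?thesis
  proof (rule that[OF V(1)])
    fix p
    assume "\<exists>y. R p y"
    then show "tm_fun V p = Some (h p (LEAST y. R p y))"
      by (intro V(2)) (simp_all add: F' G')
  qed
qed

lemma C_le: "tm_fun U p = Some x \<Longrightarrow> C U x \<le> length p"
  unfolding C_def by (intro cInf_lower) auto

lemma standardE:
  assumes "standard U" and "wf_tm V"
  obtains d where "\<And>p x. tm_fun V p = Some x \<Longrightarrow> C U x \<le> length p + d"
proof -
  from assms obtain t d where t: "\<And>p. tm_fun U (t p) = tm_fun V p"
    "\<And>p. \<bar>int (length (t p)) - int (length p)\<bar> \<le> d"
    unfolding standard_def by blast
  have "C U x \<le> length p + nat d" if "tm_fun V p = Some x" for p x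
    using C_le[of U "t p" x] t(1)[of p] t(2)[of p] that by simp
  then show ?thesis using that by blast
qed

text \<open>The identity machine yields a program for every string, so the infimum is over a
  nonempty set.\<close>

lemma C_attained:
  assumes "standard U"
  obtains p where "tm_fun U p = Some x" and "length p = C U x"
proof -
  obtain V where V: "wf_tm V"
    "\<And>p. \<exists>y. True \<Longrightarrow> tm_fun V p = Some ((\<lambda>p y. p) p (LEAST y::nat. True))"
    by (rule machine_exists[of "\<lambda>_ _. True" "\<lambda>p _. p"]) (intro comp_intros, intro comp_intros, blast)
  from assms V(1) obtain t where "\<And>p. tm_fun U (t p) = tm_fun V p"
    unfolding standard_def by blast
  then have "tm_fun U (t x) = Some x" using V(2) by simp
  then have "{length p | p. tm_fun U p = Some x} \<noteq> {}" by blast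
  from Inf_nat_def1[OF this] show ?thesis using that by (auto simp: C_def)
qed

text \<open>Programs have the form \<open>replicate e True @ False # q\<close>. The index
  \<open>q\<close> is padded to \<open>m + e\<close> bits, so its length reveals \<open>m\<close> at
  no cost, and only \<open>e\<close> has to be written down.\<close>

definition parse_step :: "(bool \<times> nat) \<times> (nat \<times> nat) \<Rightarrow> bool \<Rightarrow> (bool \<times> nat) \<times> (nat \<times> nat)" where
  "parse_step st b = (if fst (fst st) then if b then ((True, Suc (snd (fst st))), snd st)
       else ((False, snd (fst st)), snd st)
     else (fst st, (Suc (fst (snd st)), 2 * snd (snd st) + (if b then 1 else 0))))"

definition bin_val :: "bool list \<Rightarrow> nat" where
  "bin_val q = foldl (\<lambda>v b. 2 * v + (if b then 1 else 0)) 0 q"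

definition parse :: "bool list \<Rightarrow> nat \<times> nat \<times> nat" where
  "parse p = (let st = foldl parse_step ((True, 0), (0, 0)) p in (snd (fst st), snd st))"

lemma parse: "parse (replicate e True @ False # q) = (e, length q, bin_val q)"
proof -
  have 1: "foldl parse_step ((True, k), (0, 0)) (replicate e True) = ((True, k + e), (0, 0))" for k
    by (induction e arbitrary: k) (simp_all add: parse_step_def)
  have 2: "foldl parse_step ((False, e), (l, v)) q =
      ((False, e), (l + length q, foldl (\<lambda>v b. 2 * v + (if b then 1 else 0)) v q))" for l v
    by (induction q arbitrary: l v) (simp_all add: parse_step_def)
  have 3: "parse_step ((True, e), (0, 0)) False = ((False, e), (0, 0))"
    by (simp add: parse_step_def)
  show ?thesis by (simp add: parse_def Let_def 1 2 3 bin_val_def)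
qed

lemma computable_parse [comp_intros]:
  assumes "computable p"
  shows "computable (\<lambda>x. parse (p x))"
  unfolding parse_def Let_def parse_step_def by (intro comp_intros assms)

lemma bin_val_surj:
  assumes "v < 2 ^ k"
  obtains q where "length q = k" and "bin_val q = v"
proof -
  have "\<exists>q. length q = k \<and> bin_val q = v"
    using assms
  proof (induction k arbitrary: v)
    case (Suc k)
    then have "v div 2 < 2 ^ k" by simp
    with Suc.IH obtain q where q: "length q = k" "bin_val q = v div 2" by metis
    have "bin_val (q @ [odd v]) = v" using q(2) by (simp add: bin_val_def)
    with q(1) show ?case by (intro exI[of _ "q @ [odd v]"]) simp
  qed (simp add: bin_val_def)
  then show ?thesis using that by blast
qed

text \<open>A string is described by its index in the order of first appearance, which takes
  \<open>m + e\<close> bits, plus \<open>e + 1\<close> bits for \<open>e\<close>. One machine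
  handles all \<open>e\<close> and \<open>m\<close>, so \<open>a\<close> does not depend on them;
  this is what allows \<open>e\<close> to be chosen after \<open>a\<close>.\<close>

theorem enumeration_bound:
  fixes Q :: "nat \<times> nat \<Rightarrow> bool list \<Rightarrow> nat \<Rightarrow> bool"
  assumes "standard U" and Q: "computable (\<lambda>q. Q (fst q) (fst (snd q)) (snd (snd q)))"
  obtains a where "\<And>e m x t. Q (e, m) x t \<Longrightarrow> finite {x. \<exists>t. Q (e, m) x t} \<Longrightarrow>
    card {x. \<exists>t. Q (e, m) x t} \<le> 2 ^ (m + e) \<Longrightarrow> C U x \<le> m + 2 * e + a"
proof -
  define D :: "nat \<Rightarrow> bool list \<times> nat" where "D = dc"
  have cD: "computable D" unfolding D_def by (rule computable_dc)
  \<comment> \<open>\<open>z\<close> codes a string with a stage. Only the first code of each string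
    counts, so there are no more indices than strings.\<close>
  define new where "new em z \<longleftrightarrow> Q em (fst (D z)) (snd (D z)) \<and>
     \<not> (\<exists>z' \<in> set [0..<z]. Q em (fst (D z')) (snd (D z')) \<and> fst (D z') = fst (D z))" for em z
  define em where "em p = (fst (parse p), fst (snd (parse p)) - fst (parse p))" for p
  define sel where "sel p z \<longleftrightarrow> new (em p) z \<and>
     length (filter (new (em p)) [0..<z]) = snd (snd (parse p))" for p z
  have cnew: "computable (\<lambda>q. new (fst q) (snd q))"
    unfolding new_def by (intro comp_intros computable_comp3[OF Q] computable_comp[OF cD])
  have "computable (\<lambda>q. sel (fst q) (snd q))"
    unfolding sel_def em_def by (intro comp_intros computable_comp2[OF cnew])
  moreover have "computable (\<lambda>q. fst (D (snd (q :: bool list \<times> nat))))"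
    by (intro comp_intros computable_comp[OF cD])
  ultimately obtain V where V: "wf_tm V"
    "\<And>p. \<exists>z. sel p z \<Longrightarrow> tm_fun V p = Some (fst (D (LEAST z. sel p z)))"
    using machine_exists[of sel "\<lambda>_ z. fst (D z)"] by metis
  obtain d where d: "\<And>p x. tm_fun V p = Some x \<Longrightarrow> C U x \<le> length p + d"
    using standardE[OF assms(1) V(1)] by metis
  have "C U x \<le> m + 2 * e + (d + 1)"
    if Qx: "Q (e, m) x t" and fin: "finite {x. \<exists>t. Q (e, m) x t}"
      and card: "card {x. \<exists>t. Q (e, m) x t} \<le> 2 ^ (m + e)" for e m x t
  proof -
    define P where "P z \<longleftrightarrow> Q (e, m) (fst (D z)) (snd (D z)) \<and> fst (D z) = x" for z
    have "P (cd (x, t))" using Qx by (simp add: P_def D_def)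
    define zx where "zx = (LEAST z. P z)"
    have zx: "P zx" unfolding zx_def using \<open>P (cd (x, t))\<close> by (rule LeastI)
    have before: "\<not> P z" if "z < zx" for z
      using that unfolding zx_def by (rule not_less_Least)
    have nzx: "new (e, m) zx" using zx before by (auto simp: new_def P_def)
    define N where "N = {z. z < zx \<and> new (e, m) z}"
    have count: "length (filter (new (e, m)) [0..<z]) = card {z'. z' < z \<and> new (e, m) z'}" for z
    proof -
      have "{z'. z' < z \<and> new (e, m) z'} = set (filter (new (e, m)) [0..<z])" by auto
      then show ?thesis using distinct_card[of "filter (new (e, m)) [0..<z]"] by simp
    qed
    have "inj_on (\<lambda>z. fst (D z)) (insert zx N)"
    proof (rule linorder_inj_onI)
      fix z z'
      assume z: "z < z'" "z \<in> insert zx N" "z' \<in> insert zx N"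
      then have "new (e, m) z" "new (e, m) z'" using nzx by (auto simp: N_def)
      with z(1) show "fst (D z) \<noteq> fst (D z')" by (auto simp: new_def)
    qed auto
    moreover have "(\<lambda>z. fst (D z)) ` insert zx N \<subseteq> {x. \<exists>t. Q (e, m) x t}"
      using nzx by (auto simp: N_def new_def)
    ultimately have "card (insert zx N) \<le> card {x. \<exists>t. Q (e, m) x t}"
      by (rule card_inj_on_le[OF _ _ fin])
    moreover have "card (insert zx N) = Suc (card N)"
      by (rule card_insert_disjoint) (auto simp: N_def)
    ultimately have "card N < 2 ^ (m + e)" using card by linarith
    then obtain q where q: "length q = m + e" "bin_val q = card N" by (rule bin_val_surj)
    define p where "p = replicate e True @ False # q"
    have pp: "parse p = (e, m + e, card N)" using parse[of e q] q by (simp add: p_def)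
    then have em: "em p = (e, m)" by (simp add: em_def)
    have s: "sel p z \<longleftrightarrow> new (e, m) z \<and> card {z'. z' < z \<and> new (e, m) z'} = card N" for z
      by (simp add: sel_def em count pp)
    have sel: "sel p zx" using nzx by (simp add: s N_def)
    have "(LEAST z. sel p z) = zx"
    proof (rule Least_equality)
      show "sel p zx" by (rule sel)
      fix z
      assume z: "sel p z"
      show "zx \<le> z"
      proof (rule ccontr)
        assume "\<not> zx \<le> z"
        then have "insert z {z'. z' < z \<and> new (e, m) z'} \<subseteq> N"
          using z by (auto simp: s N_def)
        moreover have "finite N" by (simp add: N_def)
        ultimately have "card (insert z {z'. z' < z \<and> new (e, m) z'}) \<le> card N"
          by (intro card_mono)
        moreover have "card (insert z {z'. z' < z \<and> new (e, m) z'}) =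
            Suc (card {z'. z' < z \<and> new (e, m) z'})"
          by (rule card_insert_disjoint) auto
        ultimately show False using z by (simp add: s)
      qed
    qed
    then have "tm_fun V p = Some x" using V(2)[of p] sel zx by (auto simp: P_def)
    from d[OF this] show ?thesis by (simp add: p_def q)
  qed
  then show ?thesis using that by blast
qed

section \<open>A strategy that serves all candidates\<close>

fun words :: "nat \<Rightarrow> bool list list" where
  "words 0 = [[]]"
| "words (Suc n) = concat (map (\<lambda>w. [True # w, False # w]) (words n))"

lemma set_words: "set (words n) = {w. length w = n}"
proof (induction n)
  case (Suc n)
  have "w \<in> set (words (Suc n)) \<longleftrightarrow> length w = Suc n" for w
    by (cases w) (auto simp: Suc)
  then show ?case by blast
qed auto

lemma length_words: "length (words n) = 2 ^ n"
proof (induction n)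
  case (Suc n)
  have "length (concat (map (\<lambda>w. [True # w, False # w]) ws)) = 2 * length ws" for ws
    by (induction ws) auto
  with Suc show ?case by simp
qed simp

lemma card_length_eq: "card {w :: bool list. length w = n} = 2 ^ n"
  using card_lists_length_eq[of "UNIV :: bool set" n] by simp

lemma finite_length_eq: "finite {w :: bool list. length w = n}"
  using finite_lists_length_eq[of "UNIV :: bool set" n] by simp

lemma finite_length_le: "finite {w :: bool list. length w \<le> n}"
  using finite_lists_length_le[of "UNIV :: bool set" n] by simp

lemma card_length_le: "card {w :: bool list. length w \<le> n} < 2 ^ (n + 1)"
proof (induction n)
  case (Suc n)
  have "{w :: bool list. length w \<le> Suc n} = {w. length w \<le> n} \<union> {w. length w = Suc n}" by auto
  then have "card {w :: bool list. length w \<le> Suc n} \<le>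
      card {w :: bool list. length w \<le> n} + card {w :: bool list. length w = Suc n}"
    using card_Un_le by metis
  with Suc card_length_eq[of "Suc n"] show ?case by simp
qed simp

lemma distinct_words: "distinct (words n)"
  by (rule card_distinct) (simp add: set_words length_words card_length_eq)

lemma count_words: "length (filter P (words n)) = card {w. length w = n \<and> P w}"
proof -
  have "set (filter P (words n)) = {w. length w = n \<and> P w}" by (auto simp: set_words)
  then show ?thesis using distinct_card[OF distinct_filter[OF distinct_words], of P n] by simp
qed

lemma computable_words [comp_intros]:
  assumes "computable n"
  shows "computable (\<lambda>x. words (n x))"
proof -
  have "((\<lambda>ws. concat (map (\<lambda>w. [True # w, False # w]) ws)) ^^ k) [[]] = words k" for k
    by (induction k) auto
  moreover have "computable (\<lambda>x. ((\<lambda>ws. concat (map (\<lambda>w. [True # w, False # w]) ws)) ^^ n x) [[]])"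
    by (intro comp_intros assms)
  ultimately show ?thesis by simp
qed

text \<open>In use, \<open>k = m + 3 * e + cs e n\<close> bounds the length of the programs that are expected in the
  lists of an offered string, \<open>e\<close> being a large constant.\<close>

definition served :: "tm \<Rightarrow> (bool list \<Rightarrow> bool list \<Rightarrow> bool list list) \<Rightarrow> nat \<Rightarrow> nat \<Rightarrow> nat \<Rightarrow> bool list \<Rightarrow> bool"
  where "served U lst r m k x \<longleftrightarrow> (\<exists>q. length q \<le> m \<and> tm_fun U q = Some x) \<or>
    2 ^ r \<le> 2 * card {\<rho>. length \<rho> = r \<and> (\<exists>p \<in> set (lst x \<rho>). length p \<le> k \<and> tm_fun U p = Some x)}"

text \<open>Induction along the codes of one length: once its predecessors are served,
  \<open>x\<close> is enumerated. The summand \<open>4 * m + 1\<close> accounts for at most one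
  pending string per length, and \<open>a <= e\<close> turns the complexity bound
  \<open>m + 2 * e + a\<close> into \<open>m + 3 * e\<close>.\<close>

theorem serve_all:
  fixes U F :: tm and r cs :: "_" and cand :: "nat \<times> nat \<Rightarrow> bool list \<Rightarrow> bool"
  assumes U: "standard U"
    and r: "computable r"
    and lst: "computable (\<lambda>q. lst (fst q) (snd q))"
    and half: "\<And>x. 2 * card {\<rho>. length \<rho> = r (length x) \<and>
      (\<exists>p \<in> set (lst x \<rho>). short_program U (c (length x)) p x)} \<ge> 2 ^ r (length x)"
    and cs: "computable (\<lambda>q. cs (fst q) (snd q))"
    and cand: "computable (\<lambda>q. cand (fst q) (snd q))"
    and len: "\<And>e m x. cand (e, m) x \<Longrightarrow> length x \<le> 4 * m"
  obtains a where "\<And>e m x. a \<le> e \<Longrightarrow>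
    card {x. cand (e, m) x \<and> served U lst (r (length x)) m (m + 3 * e + cs e (length x)) x} + 4 * m + 1
      \<le> 2 ^ (m + e) \<Longrightarrow>
    cand (e, m) x \<Longrightarrow> c (length x) \<le> cs e (length x) \<Longrightarrow>
    served U lst (r (length x)) m (m + 3 * e + cs e (length x)) x"
proof -
  have wfU: "wf_tm U" using U by (simp add: standard_def)
  obtain R where R: "computable (\<lambda>q. R (fst q) (fst (snd q)) (snd (snd q)))"
    "\<And>p x. tm_fun U p = Some x \<longleftrightarrow> (\<exists>s::nat. R p x s)"
    by (rule computable_run[OF wfU]) (rule that; assumption)
  \<comment> \<open>Halting within \<open>t\<close> steps is monotone in \<open>t\<close>, so
    finitely many halting computations are all visible from some stage on; the filter
    \<open>sequentially\<close> expresses this.\<close>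
  define H where "H t p x \<longleftrightarrow> (\<exists>s \<in> set [0..<t]. R p x s)" for t p x
  define sv where "sv t m k x \<longleftrightarrow>
      (\<exists>l \<in> set [0..<Suc m]. \<exists>q \<in> set (words l). H t q x) \<or>
      2 ^ r (length x) \<le> 2 * length (filter (\<lambda>\<rho>. \<exists>p \<in> set (lst x \<rho>). length p \<le> k \<and> H t p x)
        (words (r (length x))))" for t m k x
  define kk where "kk em n = snd em + 3 * fst em + cs (fst em) n" for em n
  \<comment> \<open>The lengths are processed in parallel: a candidate waits only for those of its
    own length with smaller codes.\<close>
  define Q where "Q em x t \<longleftrightarrow> cand em x \<and> (\<forall>y \<in> set (words (length x)).
      cd y < cd x \<longrightarrow> cand em y \<longrightarrow> sv t (snd em) (kk em (length y)) y)" for em x t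
  have cH: "computable (\<lambda>q. H (fst q) (fst (snd q)) (snd (snd q)))"
    unfolding H_def by (intro comp_intros computable_comp3[OF R(1)])
  have csv: "computable (\<lambda>q. sv (fst (fst q)) (snd (fst q)) (fst (snd q)) (snd (snd q)))"
    unfolding sv_def
    by (intro comp_intros computable_comp3[OF cH] computable_comp[OF r] computable_comp2[OF lst])
  have csv': "computable (\<lambda>q. sv (f q) (g q) (h q) (i q))"
    if "computable f" "computable g" "computable h" "computable i" for f g h i :: "'z::cod \<Rightarrow> _"
    using computable_comp[OF csv computable_Pair[OF computable_Pair[OF that(1,2)] computable_Pair[OF that(3,4)]]]
    by simp
  have cQ: "computable (\<lambda>q. Q (fst q) (fst (snd q)) (snd (snd q)))"
    unfolding Q_def kk_def
    by (intro comp_intros computable_comp2[OF cand] csv' computable_comp2[OF cs])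
  have Hmono: "H t' p x" if "H t p x" "t \<le> t'" for t t' p x
  proof -
    from that(1) obtain s where "s < t" "R p x s" unfolding H_def by auto
    with that(2) show ?thesis unfolding H_def by (intro bexI[of _ s]) simp_all
  qed
  have H_ev: "eventually (\<lambda>t. H t p x) sequentially" if "tm_fun U p = Some x" for p x
  proof -
    from that[unfolded R(2)] obtain s where "R p x s" ..
    then have "H (Suc s) p x" by (auto simp: H_def)
    then show ?thesis
      by (auto simp: eventually_sequentially intro!: exI[of _ "Suc s"] elim: Hmono)
  qed
  have HU: "tm_fun U p = Some x" if "H t p x" for t p x
    using that unfolding R(2) H_def by blast
  define G where "G k x = {\<rho>. length \<rho> = r (length x) \<and>
      (\<exists>p \<in> set (lst x \<rho>). length p \<le> k \<and> tm_fun U p = Some x)}" for k x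
  have finG: "finite (G k x)" for k x
    unfolding G_def by (rule finite_subset[OF _ finite_length_eq]) auto
  have sv_served: "served U lst (r (length x)) m k x" if "sv t m k x" for t m k x
  proof -
    have "length (filter (\<lambda>\<rho>. \<exists>p \<in> set (lst x \<rho>). length p \<le> k \<and> H t p x) (words (r (length x))))
        \<le> card (G k x)"
      unfolding count_words by (rule card_mono[OF finG]) (auto simp: G_def dest: HU)
    with that show ?thesis
      unfolding sv_def served_def G_def[symmetric] set_words by (fastforce dest: HU)
  qed
  have served_sv: "eventually (\<lambda>t. sv t m k x) sequentially"
    if s: "served U lst (r (length x)) m k x" for m k x
  proof (cases "\<exists>q. length q \<le> m \<and> tm_fun U q = Some x")
    case True
    then obtain q where q: "length q \<le> m" "tm_fun U q = Some x" by blast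
    show ?thesis
      using H_ev[OF q(2)]
    proof eventually_elim
      case (elim t)
      then have "\<exists>l \<in> set [0..<Suc m]. \<exists>q \<in> set (words l). H t q x"
        using q(1) by (intro bexI[of _ "length q"] bexI[of _ q]) (auto simp: set_words)
      then show ?case unfolding sv_def by blast
    qed
  next
    case False
    with s[unfolded served_def] have big: "2 ^ r (length x) \<le> 2 * card (G k x)"
      unfolding G_def by (elim disjE) (erule notE, assumption, assumption)
    have "eventually (\<lambda>t. \<forall>\<rho> \<in> G k x. \<exists>p \<in> set (lst x \<rho>). length p \<le> k \<and> H t p x) sequentially"
    proof (rule eventually_ball_finite[OF finG], rule ballI)
      fix \<rho>
      assume "\<rho> \<in> G k x"
      then obtain p where p: "p \<in> set (lst x \<rho>)" "length p \<le> k" "tm_fun U p = Some x"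
        by (auto simp: G_def)
      from H_ev[OF p(3)] show "eventually (\<lambda>t. \<exists>p \<in> set (lst x \<rho>). length p \<le> k \<and> H t p x) sequentially"
        by eventually_elim (use p in blast)
    qed
    then show ?thesis
    proof eventually_elim
      case (elim t)
      have "card (G k x) \<le> length (filter (\<lambda>\<rho>. \<exists>p \<in> set (lst x \<rho>). length p \<le> k \<and> H t p x)
          (words (r (length x))))"
        unfolding count_words using elim
        by (intro card_mono finite_subset[OF _ finite_length_eq[of "r (length x)"]]) (auto simp: G_def)
      then show ?case using big unfolding sv_def by linarith
    qed
  qed
  define S where "S e m x \<longleftrightarrow> served U lst (r (length x)) m (m + 3 * e + cs e (length x)) x" for e m x
  have QS: "(\<exists>t. Q (e, m) x t) \<longleftrightarrow> cand (e, m) x \<and>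
      (\<forall>y. length y = length x \<longrightarrow> cd y < cd x \<longrightarrow> cand (e, m) y \<longrightarrow> S e m y)" (is "_ \<longleftrightarrow> ?r") for e m x
  proof
    assume "\<exists>t. Q (e, m) x t"
    then obtain t where t: "Q (e, m) x t" ..
    show ?r
    proof (intro conjI allI impI)
      show "cand (e, m) x" using t by (simp add: Q_def)
      fix y
      assume "length y = length x" "cd y < cd x" "cand (e, m) y"
      then have "sv t m (kk (e, m) (length y)) y" using t by (simp add: Q_def set_words)
      from sv_served[OF this] show "S e m y" by (simp add: S_def kk_def)
    qed
  next
    assume ?r
    have "finite {y. length y = length x \<and> cd y < cd x \<and> cand (e, m) y}"
      by (rule finite_subset[OF _ finite_length_eq]) auto
    moreover have "\<forall>y \<in> {y. length y = length x \<and> cd y < cd x \<and> cand (e, m) y}.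
        eventually (\<lambda>t. sv t m (kk (e, m) (length y)) y) sequentially"
      using \<open>?r\<close> served_sv by (auto simp: S_def kk_def)
    ultimately have "eventually (\<lambda>t. \<forall>y \<in> {y. length y = length x \<and> cd y < cd x \<and> cand (e, m) y}.
        sv t m (kk (e, m) (length y)) y) sequentially"
      by (rule eventually_ball_finite)
    then obtain t where "\<forall>y \<in> {y. length y = length x \<and> cd y < cd x \<and> cand (e, m) y}.
        sv t m (kk (e, m) (length y)) y"
      unfolding eventually_sequentially by blast
    then have "Q (e, m) x t" using \<open>?r\<close> by (auto simp: Q_def set_words)
    then show "\<exists>t. Q (e, m) x t" by blast
  qed
  obtain a where a: "\<And>e m x t. Q (e, m) x t \<Longrightarrow> finite {x. \<exists>t. Q (e, m) x t} \<Longrightarrow>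
    card {x. \<exists>t. Q (e, m) x t} \<le> 2 ^ (m + e) \<Longrightarrow> C U x \<le> m + 2 * e + a"
    by (rule enumeration_bound[OF U cQ]) (rule that; assumption)
  have "S e m x" if e: "a \<le> e" and few: "card {x. cand (e, m) x \<and> S e m x} + 4 * m + 1 \<le> 2 ^ (m + e)"
    and x: "cand (e, m) x" and c: "c (length x) \<le> cs e (length x)" for e m x
    using x c
  proof (induction "cd x" arbitrary: x rule: less_induct)
    case less
    define A where "A = {x. \<exists>t. Q (e, m) x t}"
    have cand_fin: "finite {x. cand (e, m) x}"
      by (rule finite_subset[OF _ finite_length_le[of "4 * m"]]) (auto dest: len)
    have finA: "finite A" by (rule finite_subset[OF _ cand_fin]) (auto simp: A_def QS)
    have "A \<subseteq> {x. cand (e, m) x \<and> S e m x} \<union> {x \<in> A. \<not> S e m x}"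
      by (auto simp: A_def QS)
    then have "card A \<le> card ({x. cand (e, m) x \<and> S e m x} \<union> {x \<in> A. \<not> S e m x})"
      by (intro card_mono finite_UnI finite_subset[OF _ cand_fin] finite_subset[OF _ finA]) auto
    also have "\<dots> \<le> card {x. cand (e, m) x \<and> S e m x} + card {x \<in> A. \<not> S e m x}"
      by (rule card_Un_le)
    \<comment> \<open>An unserved enumerated string is the first unserved candidate of its length
      and blocks all later ones of that length.\<close>
    also have "card {x \<in> A. \<not> S e m x} \<le> card {..4 * m}"
    proof (rule card_inj_on_le)
      show "inj_on length {x \<in> A. \<not> S e m x}"
      proof (rule inj_onI)
        fix u v
        assume uv: "u \<in> {x \<in> A. \<not> S e m x}" "v \<in> {x \<in> A. \<not> S e m x}" "length u = length v"
        then have "\<not> cd u < cd v" "\<not> cd v < cd u" by (auto simp: A_def QS)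
        then show "u = v" by (metis cd_inject linorder_neqE_nat)
      qed
      show "length ` {x \<in> A. \<not> S e m x} \<subseteq> {..4 * m}" by (auto simp: A_def QS dest: len)
    qed simp
    finally have "card A \<le> 2 ^ (m + e)" using few by simp
    moreover have "x \<in> A" unfolding A_def mem_Collect_eq QS
      using less.hyps less.prems by auto
    ultimately have "C U x \<le> m + 2 * e + a"
      using a[of e m x] finA unfolding A_def by blast
    then have C: "C U x + c (length x) \<le> m + 3 * e + cs e (length x)"
      using e less.prems(2) by linarith
    have "{\<rho>. length \<rho> = r (length x) \<and> (\<exists>p \<in> set (lst x \<rho>). short_program U (c (length x)) p x)}
        \<subseteq> G (m + 3 * e + cs e (length x)) x"
    proof (rule subsetI)
      fix \<rho>
      assume "\<rho> \<in> {\<rho>. length \<rho> = r (length x) \<and>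
        (\<exists>p \<in> set (lst x \<rho>). short_program U (c (length x)) p x)}"
      then obtain p where p: "length \<rho> = r (length x)" "p \<in> set (lst x \<rho>)"
        "short_program U (c (length x)) p x"
        by blast
      then have "length p \<le> m + 3 * e + cs e (length x)" "tm_fun U p = Some x"
        using C by (simp_all add: short_program_def)
      with p show "\<rho> \<in> G (m + 3 * e + cs e (length x)) x" unfolding G_def by blast
    qed
    then have "2 ^ r (length x) \<le> 2 * card (G (m + 3 * e + cs e (length x)) x)"
      using half[of x] card_mono[OF finG] by (meson le_trans mult_le_mono2)
    then show ?case by (simp add: S_def served_def G_def)
  qed
  then show ?thesis using that unfolding S_def by blast
qed

section \<open>Sets of positive measure in a product space are close to most points\<close>

definition ham :: "'p set \<Rightarrow> ('p \<Rightarrow> nat) \<Rightarrow> ('p \<Rightarrow> nat) \<Rightarrow> nat" where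
  "ham Y f g = card {p \<in> Y. f p \<noteq> g p}"

abbreviation cube :: "'p set \<Rightarrow> nat \<Rightarrow> ('p \<Rightarrow> nat) set" where
  "cube Y N \<equiv> PiE Y (\<lambda>_. {..<N})"

lemma card_cube: "finite Y \<Longrightarrow> card (cube Y N) = N ^ card Y"
  by (simp add: card_PiE)

lemma finite_cube: "finite Y \<Longrightarrow> finite (cube Y N)"
  by (simp add: finite_PiE)

lemma sum_cube_insert:
  fixes g :: "('p \<Rightarrow> nat) \<Rightarrow> real"
  assumes "y \<notin> Y"
  shows "(\<Sum>f \<in> cube (insert y Y) N. g f) = (\<Sum>w<N. \<Sum>f \<in> cube Y N. g (f(y := w)))"
proof -
  have inj: "inj_on (\<lambda>(w, f). f(y := w)) ({..<N} \<times> cube Y N)"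
    using inj_combinator[OF assms, of "\<lambda>_. {..<N}"] by simp
  have "(\<Sum>f \<in> cube (insert y Y) N. g f) = (\<Sum>z \<in> {..<N} \<times> cube Y N. g ((\<lambda>(w, f). f(y := w)) z))"
    unfolding PiE_insert_eq by (rule sum.reindex[OF inj, unfolded comp_def])
  also have "\<dots> = (\<Sum>w<N. \<Sum>f \<in> cube Y N. g (f(y := w)))"
    by (simp add: sum.cartesian_product case_prod_unfold)
  finally show ?thesis .
qed

lemma card_cube_insert:
  assumes "y \<notin> Y" and "finite Y" and "A \<subseteq> cube (insert y Y) N"
  shows "real (card A) = (\<Sum>w<N. real (card {f \<in> cube Y N. f(y := w) \<in> A}))"
proof -
  have ind: "real (card B) = (\<Sum>f \<in> cube Z N. if f \<in> B then 1 else 0)"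
    if "finite Z" "B \<subseteq> cube Z N" for Z B
    using that finite_cube[OF that(1), of N] by (simp add: sum.If_cases Int_absorb1)
  have "real (card A) = (\<Sum>f \<in> cube (insert y Y) N. if f \<in> A then 1 else 0)"
    using assms by (intro ind) auto
  also have "\<dots> = (\<Sum>w<N. \<Sum>f \<in> cube Y N. if f(y := w) \<in> A then 1 else 0)"
    by (rule sum_cube_insert[OF assms(1)])
  also have "\<dots> = (\<Sum>w<N. real (card {f \<in> cube Y N. f(y := w) \<in> A}))"
    using ind[OF assms(2), of "{f \<in> cube Y N. f(y := _) \<in> A}"]
    by (intro sum.cong refl) (simp add: ind[OF assms(2)] if_distrib cong: sum.cong)
  finally show ?thesis .
qed

lemma ham_insert:
  assumes "y \<notin> Y" and "finite Y"
  shows "ham (insert y Y) (f(y := v)) (g(y := w)) = ham Y f g + (if v = w then 0 else 1)"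
proof -
  have "{p \<in> insert y Y. (f(y := v)) p \<noteq> (g(y := w)) p} =
      (if v = w then {} else {y}) \<union> {p \<in> Y. f p \<noteq> g p}"
    using assms(1) by auto
  then show ?thesis using assms by (auto simp: ham_def card_insert_if)
qed

lemma exp_minus_le: "exp (- z) \<le> 1 - z + z\<^sup>2" if "0 \<le> z" for z :: real
proof -
  have "1 + z \<le> exp z" by (rule exp_ge_add_one_self)
  then have "exp (- z) \<le> 1 / (1 + z)"
    using that by (simp add: exp_minus field_simps)
  also have "1 / (1 + z) \<le> 1 - z + z\<^sup>2"
  proof -
    have "1 \<le> (1 - z + z\<^sup>2) * (1 + z)" using that by (simp add: algebra_simps power2_eq_square)
    then show ?thesis using that by (simp add: field_simps)
  qed
  finally show ?thesis .
qed

text \<open>One coordinate is treated at a time. In a section that is smaller than the largest section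
  by a factor of at most \<open>exp t\<close> the coordinate is kept, otherwise it is changed so as to enter
  the largest section.\<close>

theorem blow_up:
  fixes Y :: "'p set" and t :: real
  assumes "finite Y" and "A \<subseteq> cube Y N" and "A \<noteq> {}" and "t \<ge> 0"
  obtains \<phi> where "\<And>f. f \<in> cube Y N \<Longrightarrow> \<phi> f \<in> A"
    and "t * (\<Sum>f \<in> cube Y N. real (ham Y f (\<phi> f))) \<le>
      real N ^ card Y * (ln (real N ^ card Y / real (card A)) + real (card Y) * t\<^sup>2)"
proof -
  have "\<exists>\<phi>. (\<forall>f \<in> cube Y N. \<phi> f \<in> A) \<and>
    t * (\<Sum>f \<in> cube Y N. real (ham Y f (\<phi> f))) \<le>
      real N ^ card Y * (ln (real N ^ card Y / real (card A)) + real (card Y) * t\<^sup>2)"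
    using assms(1-3)
  proof (induction Y arbitrary: A rule: finite_induct)
    case empty
    then have "A = {\<lambda>_. undefined}" by auto
    then show ?case by (intro exI[of _ "\<lambda>_ _. undefined"]) (simp add: ham_def)
  next
    case (insert y Y)
    let ?P = "real N ^ card Y"
    define S where "S w = {f \<in> cube Y N. f(y := w) \<in> A}" for w
    have finS: "finite (S w)" for w
      unfolding S_def by (rule finite_subset[OF _ finite_cube[OF insert.hyps(1), of N]]) auto
    have finA: "finite A"
      using insert.prems(1) finite_cube[of "insert y Y" N] insert.hyps(1) finite_subset by blast
    have sumS: "real (card A) = (\<Sum>w<N. real (card (S w)))"
      unfolding S_def by (rule card_cube_insert[OF insert.hyps(2,1) insert.prems(1)])
    have posA: "real (card A) > 0" using insert.prems(2) finA by (simp add: card_gt_0_iff)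
    then have "N \<noteq> 0" using sumS by (cases "N = 0") auto
    define M where "M = Max ((\<lambda>w. card (S w)) ` {..<N})"
    have "M \<in> (\<lambda>w. card (S w)) ` {..<N}"
      unfolding M_def using \<open>N \<noteq> 0\<close> by (intro Max_in) auto
    then obtain w0 where w0: "w0 < N" "card (S w0) = M" by auto
    have le_M: "card (S w) \<le> M" if "w < N" for w
      unfolding M_def using that by (intro Max_ge) auto
    have "M \<noteq> 0"
    proof
      assume "M = 0"
      then have "\<forall>w<N. card (S w) = 0" using le_M by fastforce
      then show False using posA sumS by simp
    qed
    then have M: "real M > 0" by simp
    have posP: "?P > 0" using \<open>N \<noteq> 0\<close> by simp
    \<comment> \<open>\<open>z w\<close> is the charge for the value \<open>w\<close>: the
      logarithmic loss of staying in the section if that is at most \<open>t\<close>, otherwise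
      \<open>t\<close> for one changed coordinate. In both cases the section has relative size at
      most \<open>exp (- z w)\<close>.\<close>
    define z where "z w = (if card (S w) \<noteq> 0 \<and> ln (real M / real (card (S w))) \<le> t
       then ln (real M / real (card (S w))) else t)" for w
    have z0: "0 \<le> z w" "z w \<le> t" if "w < N" for w
      using le_M[OF that] assms(4) by (auto simp: z_def intro!: ln_ge_zero)
    have uz: "real (card (S w)) / real M \<le> exp (- z w)" if "w < N" for w
    proof (cases "card (S w) = 0")
      case False
      then have c: "real (card (S w)) > 0" by simp
      have "z w \<le> ln (real M / real (card (S w)))" using False by (auto simp: z_def)
      then have "exp (z w) \<le> real M / real (card (S w))"
        using M c by (metis divide_pos_pos exp_le_cancel_iff exp_ln)
      then show ?thesis using M c by (simp add: exp_minus field_simps)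
    qed simp
    have "\<exists>\<psi>. (\<forall>f \<in> cube Y N. \<psi> f \<in> A) \<and>
        t * (\<Sum>f \<in> cube Y N. real (ham (insert y Y) (f(y := w)) (\<psi> f))) \<le>
          ?P * (ln (?P / real M) + real (card Y) * t\<^sup>2 + z w)" if w: "w < N" for w
    proof (cases "card (S w) \<noteq> 0 \<and> ln (real M / real (card (S w))) \<le> t")
      case True
      have "S w \<subseteq> cube Y N" by (auto simp: S_def)
      moreover have "S w \<noteq> {}" using True by (metis card.empty)
      ultimately have "S w \<subseteq> cube Y N" "S w \<noteq> {}" by simp_all
      from insert.IH[OF this] obtain \<phi> where \<phi>: "\<forall>f \<in> cube Y N. \<phi> f \<in> S w"
        "t * (\<Sum>f \<in> cube Y N. real (ham Y f (\<phi> f))) \<le>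
          ?P * (ln (?P / real (card (S w))) + real (card Y) * t\<^sup>2)"
        by blast
      have "ln (?P / real (card (S w))) = ln (?P / real M) + z w"
      proof -
        have "z w = ln (real M / real (card (S w)))" using True by (simp add: z_def)
        then show ?thesis using True M posP by (simp add: ln_div)
      qed
      then show ?thesis
        using \<phi> by (intro exI[of _ "\<lambda>f. (\<phi> f)(y := w)"])
          (auto simp: S_def ham_insert[OF insert.hyps(2,1)] algebra_simps)
    next
      case False
      have "S w0 \<subseteq> cube Y N" by (auto simp: S_def)
      moreover have "S w0 \<noteq> {}" using w0(2) \<open>M \<noteq> 0\<close> by (metis card.empty)
      ultimately have "S w0 \<subseteq> cube Y N" "S w0 \<noteq> {}" by simp_all
      from insert.IH[OF this] obtain \<phi> where \<phi>: "\<forall>f \<in> cube Y N. \<phi> f \<in> S w0"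
        "t * (\<Sum>f \<in> cube Y N. real (ham Y f (\<phi> f))) \<le>
          ?P * (ln (?P / real M) + real (card Y) * t\<^sup>2)"
        unfolding w0(2) by blast
      have "(\<Sum>f \<in> cube Y N. real (ham (insert y Y) (f(y := w)) ((\<phi> f)(y := w0)))) \<le>
          (\<Sum>f \<in> cube Y N. real (ham Y f (\<phi> f)) + 1)"
        by (intro sum_mono) (simp add: ham_insert[OF insert.hyps(2,1)])
      also have "\<dots> = (\<Sum>f \<in> cube Y N. real (ham Y f (\<phi> f))) + ?P"
        using card_cube[OF insert.hyps(1), of N] by (simp add: sum.distrib)
      finally have "t * (\<Sum>f \<in> cube Y N. real (ham (insert y Y) (f(y := w)) ((\<phi> f)(y := w0)))) \<le>
          t * ((\<Sum>f \<in> cube Y N. real (ham Y f (\<phi> f))) + ?P)"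
        using assms(4) by (rule mult_left_mono)
      also have "\<dots> \<le> ?P * (ln (?P / real M) + real (card Y) * t\<^sup>2 + z w)"
      proof -
        have "z w = t" unfolding z_def by (rule if_not_P[OF False])
        then show ?thesis using \<phi>(2) by (simp add: algebra_simps)
      qed
      finally show ?thesis
        using \<phi>(1) by (intro exI[of _ "\<lambda>f. (\<phi> f)(y := w0)"]) (auto simp: S_def)
    qed
    then have "\<forall>w \<in> {..<N}. \<exists>\<psi>. (\<forall>f \<in> cube Y N. \<psi> f \<in> A) \<and>
        t * (\<Sum>f \<in> cube Y N. real (ham (insert y Y) (f(y := w)) (\<psi> f))) \<le>
          ?P * (ln (?P / real M) + real (card Y) * t\<^sup>2 + z w)"
      by simp
    then obtain \<psi> where "\<forall>w \<in> {..<N}. (\<forall>f \<in> cube Y N. \<psi> w f \<in> A) \<and>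
        t * (\<Sum>f \<in> cube Y N. real (ham (insert y Y) (f(y := w)) (\<psi> w f))) \<le>
          ?P * (ln (?P / real M) + real (card Y) * t\<^sup>2 + z w)"
      by (rule bchoice[THEN exE])
    then have \<psi>: "\<And>w f. w < N \<Longrightarrow> f \<in> cube Y N \<Longrightarrow> \<psi> w f \<in> A"
      "\<And>w. w < N \<Longrightarrow> t * (\<Sum>f \<in> cube Y N. real (ham (insert y Y) (f(y := w)) (\<psi> w f))) \<le>
          ?P * (ln (?P / real M) + real (card Y) * t\<^sup>2 + z w)"
      by auto
    define \<phi> where "\<phi> f = \<psi> (f y) (f(y := undefined))" for f
    have restrict: "f(y := undefined) = f" if "f \<in> cube Y N" for f
      using that insert.hyps(2) by (auto simp: fun_eq_iff PiE_def extensional_def)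
    have in_A: "\<phi> f \<in> A" if "f \<in> cube (insert y Y) N" for f
    proof -
      have "f y < N" using that by auto
      moreover have "f(y := undefined) \<in> cube Y N"
        using that insert.hyps(2) by (auto simp: PiE_def extensional_def)
      ultimately show ?thesis unfolding \<phi>_def by (rule \<psi>(1))
    qed
    let ?L = "ln (?P / real M) + real (card Y) * t\<^sup>2"
    have "t * (\<Sum>f \<in> cube (insert y Y) N. real (ham (insert y Y) f (\<phi> f))) =
        (\<Sum>w<N. t * (\<Sum>f \<in> cube Y N. real (ham (insert y Y) (f(y := w)) (\<psi> w f))))"
      unfolding sum_cube_insert[OF insert.hyps(2)] sum_distrib_left
      by (intro sum.cong refl) (simp add: \<phi>_def restrict)
    also have "\<dots> \<le> (\<Sum>w<N. ?P * (?L + z w))" by (intro sum_mono \<psi>(2)) simp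
    also have "\<dots> = ?P * (real N * ?L + (\<Sum>w<N. z w))"
      by (simp add: sum.distrib flip: sum_distrib_left)
    also have "\<dots> \<le> ?P * (real N * ?L + (real N * ln (real N * real M / real (card A)) + real N * t\<^sup>2))"
    proof -
      \<comment> \<open>\<open>u\<close> is the average relative size of the sections. Averaging
        \<open>exp (- z) <= 1 - z + z ^ 2\<close> bounds the mean charge by
        \<open>1 - u + t ^ 2\<close>, and \<open>1 - u <= ln (1 / u)\<close> makes the logarithms
        telescope with the loss for the largest section.\<close>
      define u where "u = real (card A) / (real N * real M)"
      have u: "u > 0" using posA M \<open>N \<noteq> 0\<close> by (simp add: u_def)
      have "real N * u = real (card A) / real M" using \<open>N \<noteq> 0\<close> by (simp add: u_def)
      also have "\<dots> = (\<Sum>w<N. real (card (S w)) / real M)"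
        by (simp only: sumS sum_divide_distrib)
      also have "\<dots> \<le> (\<Sum>w<N. 1 - z w + t\<^sup>2)"
      proof (intro sum_mono)
        fix w
        assume "w \<in> {..<N}"
        then have w: "w < N" by simp
        have "(z w)\<^sup>2 \<le> t\<^sup>2" using z0[OF w] by (intro power_mono) auto
        then show "real (card (S w)) / real M \<le> 1 - z w + t\<^sup>2"
          using uz[OF w] exp_minus_le[OF z0(1)[OF w]] by linarith
      qed
      also have "\<dots> = real N - (\<Sum>w<N. z w) + real N * t\<^sup>2"
        by (simp add: sum.distrib sum_subtractf)
      finally have "(\<Sum>w<N. z w) \<le> real N * (1 - u) + real N * t\<^sup>2" by (simp add: algebra_simps)
      also have "\<dots> \<le> real N * ln (1 / u) + real N * t\<^sup>2"
      proof -
        have "ln u \<le> u - 1" using u by (rule ln_le_minus_one)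
        then have "1 - u \<le> ln (1 / u)" using u by (simp add: ln_div)
        then show ?thesis by (simp add: mult_left_mono)
      qed
      also have "1 / u = real N * real M / real (card A)" by (simp add: u_def)
      finally show ?thesis using posP by (simp add: mult_left_mono)
    qed
    also have "\<dots> = real N ^ card (insert y Y) *
        (ln (real N ^ card (insert y Y) / real (card A)) + real (card (insert y Y)) * t\<^sup>2)"
    proof -
      have "ln (real N ^ card (insert y Y) / real (card A)) =
          ln (?P / real M) + ln (real N * real M / real (card A))"
        using posP M posA \<open>N \<noteq> 0\<close> insert.hyps by (simp add: ln_div ln_mult)
      then show ?thesis using insert.hyps by (simp add: algebra_simps)
    qed
    finally show ?case using in_A by blast
  qed
  then show ?thesis using that by blast
qed

lemma sum_cube_coordinate:
  fixes g :: "nat \<Rightarrow> real"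
  assumes "finite Y" and "p \<in> Y"
  shows "real N * (\<Sum>f \<in> cube Y N. g (f p)) = real N ^ card Y * (\<Sum>w<N. g w)"
proof -
  have "(\<Sum>f \<in> cube Y N. \<Prod>i \<in> Y. if i = p then g (f i) else 1) =
      (\<Prod>i \<in> Y. \<Sum>w<N. if i = p then g w else 1)"
    using assms(1) by (intro prod_sum_PiE[symmetric]) auto
  also have "(\<Sum>f \<in> cube Y N. \<Prod>i \<in> Y. if i = p then g (f i) else 1) = (\<Sum>f \<in> cube Y N. g (f p))"
    using assms by (intro sum.cong refl) (simp add: prod.delta)
  also have "(\<Prod>i \<in> Y. \<Sum>w<N. if i = p then g w else 1) = (\<Sum>w<N. g w) * (\<Prod>i \<in> Y - {p}. real N)"
    using assms by (subst prod.remove[of Y p]) auto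
  finally have "(\<Sum>f \<in> cube Y N. g (f p)) = (\<Sum>w<N. g w) * real N ^ (card Y - 1)"
    using assms by simp
  moreover have "card Y = Suc (card Y - 1)" using assms by (metis card_gt_0_iff empty_iff Suc_pred')
  ultimately show ?thesis by (metis mult.assoc mult.commute power_Suc)
qed

section \<open>Prices\<close>

text \<open>For a uniform \<open>w\<close> the value \<open>level h w\<close> is at least \<open>i\<close> with probability \<open>4 ^ - i\<close>.\<close>

definition level :: "nat \<Rightarrow> nat \<Rightarrow> nat" where
  "level h w = h - (LEAST j. w < 4 ^ j)"

lemma level_le: "level h w \<le> h"
  by (simp add: level_def)

lemma level_ge_iff:
  assumes "w < 4 ^ h" and "i \<le> h"
  shows "i \<le> level h w \<longleftrightarrow> w < 4 ^ (h - i)"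
proof -
  define j where "j = (LEAST j. w < (4::nat) ^ j)"
  have j: "w < 4 ^ j" unfolding j_def using assms(1) by (rule LeastI)
  have jh: "j \<le> h" unfolding j_def using assms(1) by (rule Least_le)
  have "w < 4 ^ (h - i) \<longleftrightarrow> j \<le> h - i"
  proof
    assume "w < 4 ^ (h - i)"
    then show "j \<le> h - i" unfolding j_def by (rule Least_le)
  next
    assume "j \<le> h - i"
    then have "(4::nat) ^ j \<le> 4 ^ (h - i)" by (intro power_increasing) auto
    with j show "w < 4 ^ (h - i)" by linarith
  qed
  then show ?thesis using assms(2) jh unfolding level_def j_def[symmetric] by linarith
qed

lemma card_level_ge:
  assumes "i \<le> h"
  shows "card {w \<in> {..<4 ^ h}. i \<le> level h w} = 4 ^ (h - i)"
proof -
  have "(4::nat) ^ (h - i) \<le> 4 ^ h" by (intro power_increasing) auto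
  then have "w < 4 ^ h \<and> i \<le> level h w \<longleftrightarrow> w < 4 ^ (h - i)" for w
    using level_ge_iff[OF _ assms, of w] by (meson less_le_trans)
  then have "{w \<in> {..<4 ^ h}. i \<le> level h w} = {..<4 ^ (h - i)}" by auto
  then show ?thesis by simp
qed

text \<open>Decomposition into layers, so that the sum of \<open>2 ^ level\<close> can be computed
  from the tails.\<close>

lemma power2_eq_sum: "k \<le> h \<Longrightarrow> (2::nat) ^ k = 1 + (\<Sum>i \<in> {1..h}. if i \<le> k then 2 ^ (i - 1) else 0)"
proof -
  assume k: "k \<le> h"
  have "(\<Sum>i \<in> {1..h}. if i \<le> k then 2 ^ (i - 1) else 0) = (\<Sum>i \<in> {1..k}. (2::nat) ^ (i - 1))"
    using k by (intro sum.mono_neutral_cong_right) auto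
  also have "\<dots> = (\<Sum>i<k. 2 ^ i)"
    by (rule sum.reindex_bij_witness[of _ Suc "\<lambda>i. i - 1"]) auto
  also have "1 + \<dots> = 2 ^ k" by (induction k) auto
  finally show "(2::nat) ^ k = 1 + (\<Sum>i \<in> {1..h}. if i \<le> k then 2 ^ (i - 1) else 0)" by simp
qed

text \<open>The mean of \<open>2 ^ level\<close> is at most 2, as the tails \<open>4 ^ - i\<close>
  outweigh the growth \<open>2 ^ i\<close>. With tails \<open>2 ^ - i\<close> the mean would grow
  linearly in \<open>h\<close>.\<close>

lemma sum_level_le: "(\<Sum>w<4 ^ h. 2 ^ level h w) \<le> (2 * 4 ^ h :: nat)"
proof -
  have "(\<Sum>w<4 ^ h. (2::nat) ^ level h w) =
      (\<Sum>w<4 ^ h. 1 + (\<Sum>i \<in> {1..h}. if i \<le> level h w then 2 ^ (i - 1) else 0))"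
    by (intro sum.cong refl power2_eq_sum level_le)
  also have "\<dots> = 4 ^ h + (\<Sum>i \<in> {1..h}. \<Sum>w<4 ^ h. if i \<le> level h w then 2 ^ (i - 1) else 0)"
  proof -
    have "(\<Sum>w<4 ^ h. \<Sum>i \<in> {1..h}. if i \<le> level h w then 2 ^ (i - 1) else 0) =
        (\<Sum>i \<in> {1..h}. \<Sum>w<4 ^ h. if i \<le> level h w then (2::nat) ^ (i - 1) else 0)"
      by (rule sum.swap)
    then show ?thesis by (simp only: sum.distrib) simp
  qed
  also have "(\<Sum>i \<in> {1..h}. \<Sum>w<4 ^ h. if i \<le> level h w then (2::nat) ^ (i - 1) else 0) =
      (\<Sum>i \<in> {1..h}. 2 ^ (i - 1) * 4 ^ (h - i))"
  proof (intro sum.cong refl)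
    fix i
    assume "i \<in> {1..h}"
    then have "card {w \<in> {..<4 ^ h}. i \<le> level h w} = 4 ^ (h - i)" by (intro card_level_ge) auto
    then show "(\<Sum>w<4 ^ h. if i \<le> level h w then 2 ^ (i - 1) else 0) = 2 ^ (i - 1) * (4::nat) ^ (h - i)"
      by (simp add: sum.inter_filter[symmetric])
  qed
  also have "\<dots> \<le> 4 ^ h"
  proof -
    have "2 * (\<Sum>i \<in> {1..h}. 2 ^ (i - 1) * 4 ^ (h - i)) + 2 ^ h = (4::nat) ^ h"
    proof (induction h)
      case (Suc h)
      have "(\<Sum>i \<in> {1..h}. 2 ^ (i - 1) * 4 ^ (Suc h - i)) =
          4 * (\<Sum>i \<in> {1..h}. 2 ^ (i - 1) * (4::nat) ^ (h - i))"
        unfolding sum_distrib_left by (intro sum.cong refl) (auto simp: Suc_diff_le)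
      with Suc show ?case by (simp add: algebra_simps)
    qed simp
    then show ?thesis by linarith
  qed
  finally show ?thesis by simp
qed

text \<open>The left-hand side is the number of lengths, times the surplus price, times the average
  number of moved coordinates. Its exponent is about \<open>m / 2 + 3 * w\<close>, and
  \<open>3 * w\<close> is at most \<open>3 * m / 64\<close>; \<open>1000 <= m\<close> lets the
  polynomial factors vanish in powers of \<open>2 ^ (m div 16)\<close>.\<close>

lemma price_error_bound:
  fixes m w h :: nat
  assumes "64 * w \<le> m" and "h \<le> 2 * w + 1" and "1000 \<le> m"
  shows "(2 * m + 1) * 2 ^ h * (m * 2 ^ (m div 2) + 2 ^ (m + w + 1 - m div 2)) \<le> (2::nat) ^ m"
proof -
  define k where "k = m div 16"
  define d where "d = m div 2"
  have big: "16 * (j + 1) \<le> (2::nat) ^ j" if "8 \<le> j" for j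
    using that by (induction j rule: dec_induct) auto
  have k: "62 \<le> k" "m < 16 * (k + 1)" using assms(3) by (auto simp: k_def)
  then have mk: "m \<le> 2 ^ k" using big[of k] by linarith
  have "m * 2 ^ d + 2 ^ (m + w + 1 - d) \<le> m * 2 ^ (d + w + 1) + m * 2 ^ (d + w + 1)"
  proof (rule add_mono)
    show "m * 2 ^ d \<le> m * 2 ^ (d + w + 1)" by (intro mult_le_mono2 power_increasing) auto
    have "m + w + 1 - d \<le> Suc (d + w + 1)" by (auto simp: d_def)
    then have "(2::nat) ^ (m + w + 1 - d) \<le> 2 ^ Suc (d + w + 1)" by (intro power_increasing) auto
    also have "\<dots> \<le> m * 2 ^ (d + w + 1)" using assms(3) by simp
    finally show "(2::nat) ^ (m + w + 1 - d) \<le> m * 2 ^ (d + w + 1)" .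
  qed
  also have "\<dots> \<le> 2 ^ k * 2 ^ (d + w + 2)" using mk by simp
  finally have 1: "m * 2 ^ d + 2 ^ (m + w + 1 - d) \<le> 2 ^ k * 2 ^ (d + w + 2)" .
  have 2: "2 * m + 1 \<le> 2 ^ (k + 2)" using mk assms(3) by simp
  have 3: "(2::nat) ^ h \<le> 2 ^ (2 * w + 1)" using assms(2) by (intro power_increasing) auto
  have "(2 * m + 1) * 2 ^ h * (m * 2 ^ d + 2 ^ (m + w + 1 - d)) \<le>
      2 ^ (k + 2) * 2 ^ (2 * w + 1) * (2 ^ k * 2 ^ (d + w + 2))"
    by (intro mult_le_mono 1 2 3)
  also have "\<dots> = 2 ^ ((k + 2) + (2 * w + 1) + (k + (d + w + 2)))" by (simp only: power_add)
  also have "(k + 2) + (2 * w + 1) + (k + (d + w + 2)) = 2 * k + 3 * w + d + 5" by simp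
  also have "2 ^ (2 * k + 3 * w + d + 5) \<le> (2::nat) ^ m"
  proof (intro power_increasing)
    have "16 * k \<le> m" "2 * d \<le> m" by (auto simp: k_def d_def)
    then show "2 * k + 3 * w + d + 5 \<le> m" using assms by linarith
  qed simp
  finally show ?thesis by (simp add: d_def)
qed

text \<open>The prices are the levels of a typical point of the cube. For every \<open>n \<in> J\<close> the point is
  moved, at few coordinates only, into the set of those points whose levels are affordable for
  many elements of \<open>B n\<close>; the moved coordinates get the maximal price \<open>h\<close>.\<close>

theorem prices:
  fixes Y :: "'p set" and lev :: "'x \<Rightarrow> 'p \<Rightarrow> nat" and B :: "'n \<Rightarrow> 'x set"
  assumes Y: "finite Y" "card Y \<le> 2 ^ (m + w + 1)"
    and w: "64 * w \<le> m" "h \<le> 2 * w + 1" "1000 \<le> m"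
    and lam: "(\<Sum>p \<in> Y. 2 ^ (h - lam p)) \<le> (2::nat) ^ (m + 1 + h)"
    and J: "finite J" "card J \<le> 2 * m + 1"
    and B: "\<And>n. n \<in> J \<Longrightarrow> finite (B n)"
    and lev_h: "\<And>n x p. n \<in> J \<Longrightarrow> x \<in> B n \<Longrightarrow> p \<in> Y \<Longrightarrow> lev x p \<le> h"
    and lev_sum: "\<And>n x. n \<in> J \<Longrightarrow> x \<in> B n \<Longrightarrow> 8 * (\<Sum>p \<in> Y. lev x p) \<le> m"
  obtains v where "\<And>p. p \<in> Y \<Longrightarrow> v p \<le> h"
    and "(\<Sum>p \<in> Y. 2 ^ v p * 2 ^ (h - lam p)) \<le> (2::nat) ^ (m + 4 + h)"
    and "\<And>n. n \<in> J \<Longrightarrow> card (B n) \<le> 2 ^ (m div 4 + 1) * card {x \<in> B n. \<forall>p \<in> Y. lev x p \<le> v p}"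
proof -
  define N :: nat where "N = 4 ^ h"
  define q where "q = m div 4 + 1"
  let ?\<Omega> = "cube Y N"
  let ?P = "real N ^ card Y"
  have posN: "real N > 0" by (simp add: N_def)
  have posP: "?P > 0" using posN by simp
  have finO: "finite ?\<Omega>" using Y(1) by (rule finite_cube)
  have cardO: "card ?\<Omega> = N ^ card Y" using Y(1) by (rule card_cube)
  define good where "good n f = {x \<in> B n. \<forall>p \<in> Y. lev x p \<le> level h (f p)}" for n f
  define A where "A n = {f \<in> ?\<Omega>. card (B n) \<le> 2 ^ q * card (good n f)}" for n
  \<comment> \<open>Each element of \<open>B n\<close> is affordable at a fraction of at least
    \<open>1 / 2 ^ (m div 4)\<close> of the points, so on average this fraction of
    \<open>B n\<close> is. The 1 in \<open>q\<close> permits discarding the points that reach less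
    than half the average.\<close>
  have A_large: "N ^ card Y \<le> 2 ^ q * card (A n)" if n: "n \<in> J" for n
  proof (cases "B n = {}")
    case True
    then have "A n = ?\<Omega>" by (auto simp: A_def)
    then show ?thesis by (simp add: cardO)
  next
    case False
    then have posB: "card (B n) > 0" using B[OF n] by (simp add: card_gt_0_iff)
    have E: "N ^ card Y \<le> 2 ^ (m div 4) * card {f \<in> ?\<Omega>. \<forall>p \<in> Y. lev x p \<le> level h (f p)}"
      if x: "x \<in> B n" for x
    proof -
      have "{f \<in> ?\<Omega>. \<forall>p \<in> Y. lev x p \<le> level h (f p)} =
          PiE Y (\<lambda>p. {w \<in> {..<4 ^ h}. lev x p \<le> level h w})"
        by (auto simp: N_def PiE_def Pi_def)
      then have "card {f \<in> ?\<Omega>. \<forall>p \<in> Y. lev x p \<le> level h (f p)} = (\<Prod>p \<in> Y. 4 ^ (h - lev x p))"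
        using card_PiE[OF Y(1), of "\<lambda>p. {w \<in> {..<4 ^ h}. lev x p \<le> level h w}"]
        by (simp only:) (intro prod.cong refl card_level_ge lev_h[OF n x])
      moreover have "(4::nat) ^ (\<Sum>p \<in> Y. lev x p) * (\<Prod>p \<in> Y. 4 ^ (h - lev x p)) = N ^ card Y"
      proof -
        have "(\<Prod>p \<in> Y. (4::nat) ^ lev x p * 4 ^ (h - lev x p)) = (\<Prod>p \<in> Y. 4 ^ h)"
          using lev_h[OF n x] by (intro prod.cong refl) (simp flip: power_add)
        then show ?thesis by (simp add: prod.distrib power_sum N_def)
      qed
      moreover have "(4::nat) ^ (\<Sum>p \<in> Y. lev x p) \<le> 2 ^ (m div 4)"
      proof -
        have "2 * (\<Sum>p \<in> Y. lev x p) \<le> m div 4" using lev_sum[OF n x] by linarith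
        then have "(2::nat) ^ (2 * (\<Sum>p \<in> Y. lev x p)) \<le> 2 ^ (m div 4)"
          by (intro power_increasing) auto
        then show ?thesis by (simp add: power_mult)
      qed
      ultimately show ?thesis by (metis mult_le_mono1)
    qed
    define \<Sigma> where "\<Sigma> = (\<Sum>f \<in> ?\<Omega>. card (good n f))"
    have "\<Sigma> = (\<Sum>x \<in> B n. card {f \<in> ?\<Omega>. \<forall>p \<in> Y. lev x p \<le> level h (f p)})"
      unfolding \<Sigma>_def good_def
      by (rule sum_multicount_gen[OF finO B[OF n]]) simp
    then have "card (B n) * N ^ card Y \<le> 2 ^ (m div 4) * \<Sigma>"
      using sum_mono[of "B n" "\<lambda>_. N ^ card Y", OF E] by (simp add: sum_distrib_left)
    then have 1: "2 * card (B n) * N ^ card Y \<le> 2 ^ q * \<Sigma>" by (simp add: q_def)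
    have "2 ^ q * \<Sigma> = (\<Sum>f \<in> ?\<Omega>. 2 ^ q * card (good n f))"
      by (simp add: \<Sigma>_def sum_distrib_left)
    also have "\<dots> \<le> (\<Sum>f \<in> ?\<Omega>. card (B n) + (if f \<in> A n then 2 ^ q * card (B n) else 0))"
    proof (intro sum_mono)
      fix f
      assume f: "f \<in> ?\<Omega>"
      have "card (good n f) \<le> card (B n)" using B[OF n] by (intro card_mono) (auto simp: good_def)
      then show "2 ^ q * card (good n f) \<le> card (B n) + (if f \<in> A n then 2 ^ q * card (B n) else 0)"
        using f by (auto simp: A_def intro: trans_le_add2)
    qed
    also have "\<dots> = card (B n) * N ^ card Y + card (A n) * (2 ^ q * card (B n))"
    proof -
      have "?\<Omega> \<inter> {f. f \<in> A n} = A n" by (auto simp: A_def)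
      then show ?thesis using finO by (simp add: sum.distrib sum.If_cases cardO)
    qed
    finally have "2 ^ q * \<Sigma> \<le> card (B n) * N ^ card Y + card (A n) * (2 ^ q * card (B n))" .
    with 1 have "card (B n) * N ^ card Y \<le> card (A n) * (2 ^ q * card (B n))" by linarith
    also have "\<dots> = card (B n) * (2 ^ q * card (A n))" by (simp only: mult_ac)
    finally show ?thesis using posB by (simp only: mult_le_cancel1)
  qed
  \<comment> \<open>The distance bound is \<open>m / t + card Y * t\<close> with
    \<open>card Y\<close> about \<open>2 ^ m\<close>; this \<open>t\<close> nearly balances the two
    terms.\<close>
  define t :: real where "t = 1 / 2 ^ (m div 2)"
  have t: "t > 0" by (simp add: t_def)
  have near: "\<exists>\<phi>. (\<forall>f \<in> ?\<Omega>. \<phi> f \<in> A n) \<and>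
      (\<Sum>f \<in> ?\<Omega>. real (ham Y f (\<phi> f))) \<le> ?P * real (m * 2 ^ (m div 2) + 2 ^ (m + w + 1 - m div 2))"
    if n: "n \<in> J" for n
  proof -
    have sub: "A n \<subseteq> ?\<Omega>" by (auto simp: A_def)
    have "0 < N ^ card Y" by (simp add: N_def)
    then have cA: "card (A n) > 0" using A_large[OF n] by (cases "card (A n) = 0") simp_all
    then have ne: "A n \<noteq> {}" by auto
    obtain \<phi> where \<phi>: "\<And>f. f \<in> ?\<Omega> \<Longrightarrow> \<phi> f \<in> A n"
      "t * (\<Sum>f \<in> ?\<Omega>. real (ham Y f (\<phi> f))) \<le> ?P * (ln (?P / real (card (A n))) + real (card Y) * t\<^sup>2)"
      by (rule blow_up[OF Y(1) sub ne less_imp_le[OF t]]) (rule that; assumption)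
    have "ln (?P / real (card (A n))) \<le> real m"
    proof -
      have "?P \<le> 2 ^ q * real (card (A n))"
        using of_nat_mono[OF A_large[OF n], where 'a=real] by simp
      then have "?P / real (card (A n)) \<le> 2 ^ q" using cA by (simp add: field_simps)
      moreover have "0 < ?P / real (card (A n))" using posP cA by simp
      ultimately have "ln (?P / real (card (A n))) \<le> ln (2 ^ q)" by (subst ln_le_cancel_iff) auto
      also have "\<dots> = real q * ln 2" by (simp add: ln_realpow)
      also have "\<dots> \<le> real q * 1" using ln_le_minus_one[of "2::real"] by (intro mult_left_mono) auto
      also have "\<dots> \<le> real m" using w(3) by (simp add: q_def)
      finally show ?thesis .
    qed
    moreover have "real (card Y) * t\<^sup>2 \<le> 2 ^ (m + w + 1) * t\<^sup>2"
      using of_nat_mono[OF Y(2), where 'a=real] by (intro mult_right_mono) simp_all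
    ultimately have "?P * (ln (?P / real (card (A n))) + real (card Y) * t\<^sup>2) \<le>
        ?P * (real m + 2 ^ (m + w + 1) * t\<^sup>2)"
      using posP by (intro mult_left_mono) auto
    with \<phi>(2) have "t * (\<Sum>f \<in> ?\<Omega>. real (ham Y f (\<phi> f))) \<le> ?P * (real m + 2 ^ (m + w + 1) * t\<^sup>2)"
      by linarith
    then have "(\<Sum>f \<in> ?\<Omega>. real (ham Y f (\<phi> f))) \<le> ?P * (real m / t + 2 ^ (m + w + 1) * t)"
      using t by (simp add: field_simps power2_eq_square)
    also have "real m / t + 2 ^ (m + w + 1) * t = real (m * 2 ^ (m div 2) + 2 ^ (m + w + 1 - m div 2))"
    proof -
      have "(2::real) ^ (m + w + 1) = 2 ^ (m + w + 1 - m div 2) * 2 ^ (m div 2)"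
        by (simp flip: power_add)
      then show ?thesis by (simp add: t_def)
    qed
    finally show ?thesis using \<phi>(1) by blast
  qed
  then have "\<forall>n \<in> J. \<exists>\<phi>. (\<forall>f \<in> ?\<Omega>. \<phi> f \<in> A n) \<and>
      (\<Sum>f \<in> ?\<Omega>. real (ham Y f (\<phi> f))) \<le> ?P * real (m * 2 ^ (m div 2) + 2 ^ (m + w + 1 - m div 2))"
    by blast
  then obtain \<phi> where "\<forall>n \<in> J. (\<forall>f \<in> ?\<Omega>. \<phi> n f \<in> A n) \<and>
      (\<Sum>f \<in> ?\<Omega>. real (ham Y f (\<phi> n f))) \<le> ?P * real (m * 2 ^ (m div 2) + 2 ^ (m + w + 1 - m div 2))"
    by (rule bchoice[THEN exE])
  then have \<phi>: "\<And>n f. n \<in> J \<Longrightarrow> f \<in> ?\<Omega> \<Longrightarrow> \<phi> n f \<in> A n"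
    "\<And>n. n \<in> J \<Longrightarrow> (\<Sum>f \<in> ?\<Omega>. real (ham Y f (\<phi> n f))) \<le>
        ?P * real (m * 2 ^ (m div 2) + 2 ^ (m + w + 1 - m div 2))"
    by auto
  define v where "v f p = (if \<exists>n \<in> J. \<phi> n f p \<noteq> f p then h else level h (f p))" for f p
  define cost where "cost f = (\<Sum>p \<in> Y. 2 ^ v f p * (2::nat) ^ (h - lam p))" for f
  have cost_le: "cost f \<le> (\<Sum>p \<in> Y. 2 ^ level h (f p) * 2 ^ (h - lam p)) +
      (\<Sum>n \<in> J. ham Y f (\<phi> n f)) * (2 ^ h * 2 ^ h)" for f
  proof -
    have "cost f \<le> (\<Sum>p \<in> Y. 2 ^ level h (f p) * 2 ^ (h - lam p) +
        (\<Sum>n \<in> J. if f p \<noteq> \<phi> n f p then 1 else 0) * (2 ^ h * 2 ^ h))"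
      unfolding cost_def
    proof (intro sum_mono)
      fix p
      show "2 ^ v f p * (2::nat) ^ (h - lam p) \<le> 2 ^ level h (f p) * 2 ^ (h - lam p) +
        (\<Sum>n \<in> J. if f p \<noteq> \<phi> n f p then 1 else 0) * (2 ^ h * 2 ^ h)"
      proof (cases "\<exists>n \<in> J. \<phi> n f p \<noteq> f p")
        case True
        then obtain n where n: "n \<in> J" "f p \<noteq> \<phi> n f p" by metis
        have "(1::nat) \<le> (\<Sum>n \<in> J. if f p \<noteq> \<phi> n f p then 1 else 0)"
          using member_le_sum[of n J "\<lambda>n. if f p \<noteq> \<phi> n f p then 1 else (0::nat)"] n J(1) by simp
        then have "1 * ((2::nat) ^ h * 2 ^ h) \<le> (\<Sum>n \<in> J. if f p \<noteq> \<phi> n f p then 1 else 0) * (2 ^ h * 2 ^ h)"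
          by (rule mult_le_mono1)
        moreover have "2 ^ v f p * (2::nat) ^ (h - lam p) \<le> 2 ^ h * 2 ^ h"
          using True by (auto simp: v_def intro!: mult_le_mono power_increasing)
        ultimately show ?thesis by linarith
      next
        case False
        then show ?thesis by (auto simp: v_def)
      qed
    qed
    also have "\<dots> = (\<Sum>p \<in> Y. 2 ^ level h (f p) * 2 ^ (h - lam p)) +
        (\<Sum>p \<in> Y. \<Sum>n \<in> J. if f p \<noteq> \<phi> n f p then 1 else 0) * (2 ^ h * 2 ^ h)"
      by (simp add: sum.distrib sum_distrib_right)
    also have "(\<Sum>p \<in> Y. \<Sum>n \<in> J. if f p \<noteq> \<phi> n f p then 1 else (0::nat)) = (\<Sum>n \<in> J. ham Y f (\<phi> n f))"
      unfolding sum.swap[of _ J Y] ham_def using Y(1) by (simp add: sum.If_cases Int_def)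
    finally show ?thesis .
  qed
  have "(\<Sum>f \<in> ?\<Omega>. real (cost f)) \<le> ?P * 2 ^ (m + 4 + h)"
  proof -
    have "(\<Sum>f \<in> ?\<Omega>. real (cost f)) \<le>
        (\<Sum>f \<in> ?\<Omega>. (\<Sum>p \<in> Y. 2 ^ level h (f p) * 2 ^ (h - lam p)) +
          (\<Sum>n \<in> J. real (ham Y f (\<phi> n f))) * (2 ^ h * 2 ^ h))"
    proof (intro sum_mono)
      fix f
      show "real (cost f) \<le> (\<Sum>p \<in> Y. 2 ^ level h (f p) * 2 ^ (h - lam p)) +
          (\<Sum>n \<in> J. real (ham Y f (\<phi> n f))) * (2 ^ h * 2 ^ h)"
        using of_nat_mono[OF cost_le[of f], where 'a=real] by simp
    qed
    also have "\<dots> = (\<Sum>p \<in> Y. 2 ^ (h - lam p) * (\<Sum>f \<in> ?\<Omega>. 2 ^ level h (f p))) +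
        (\<Sum>n \<in> J. \<Sum>f \<in> ?\<Omega>. real (ham Y f (\<phi> n f))) * (2 ^ h * 2 ^ h)"
      by (simp add: sum.distrib sum_distrib_right sum_distrib_left sum.swap[of _ ?\<Omega>] mult.commute)
    also have "\<dots> \<le> (\<Sum>p \<in> Y. 2 ^ (h - lam p) * (2 * ?P)) + ?P * 2 ^ m * 2 ^ h"
    proof (rule add_mono)
      show "(\<Sum>p \<in> Y. 2 ^ (h - lam p) * (\<Sum>f \<in> ?\<Omega>. 2 ^ level h (f p))) \<le>
          (\<Sum>p \<in> Y. 2 ^ (h - lam p) * (2 * ?P))"
      proof (intro sum_mono mult_left_mono)
        fix p
        assume p: "p \<in> Y"
        have "(\<Sum>w<N. (2::real) ^ level h w) \<le> 2 * real N"
          using of_nat_mono[OF sum_level_le[of h], where 'a=real] by (simp add: N_def)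
        then have "real N * (\<Sum>f \<in> ?\<Omega>. 2 ^ level h (f p)) \<le> ?P * (2 * real N)"
          unfolding sum_cube_coordinate[OF Y(1) p, of N "\<lambda>w. 2 ^ level h w"] using posP by (intro mult_left_mono) auto
        then have "real N * (\<Sum>f \<in> ?\<Omega>. 2 ^ level h (f p)) \<le> real N * (2 * ?P)" by (simp only: mult_ac)
        then show "(\<Sum>f \<in> ?\<Omega>. 2 ^ level h (f p)) \<le> 2 * ?P" using posN by simp
      qed simp
      let ?e = "m * 2 ^ (m div 2) + 2 ^ (m + w + 1 - m div 2)"
      have "(\<Sum>n \<in> J. \<Sum>f \<in> ?\<Omega>. real (ham Y f (\<phi> n f))) \<le> (\<Sum>n \<in> J. ?P * real ?e)"
        by (intro sum_mono \<phi>(2))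
      also have "\<dots> = ?P * real (card J * ?e)" by (simp add: algebra_simps)
      also have "\<dots> \<le> ?P * real ((2 * m + 1) * ?e)"
        using posP J(2) by (intro mult_left_mono of_nat_mono mult_le_mono1) auto
      finally have "(\<Sum>n \<in> J. \<Sum>f \<in> ?\<Omega>. real (ham Y f (\<phi> n f))) * (2 ^ h * 2 ^ h) \<le>
          ?P * real ((2 * m + 1) * ?e) * (2 ^ h * 2 ^ h)"
        by (intro mult_right_mono) auto
      also have "\<dots> = ?P * real ((2 * m + 1) * 2 ^ h * ?e) * 2 ^ h"
        by (simp only: of_nat_mult of_nat_power of_nat_numeral mult_ac)
      also have "\<dots> \<le> ?P * real (2 ^ m) * 2 ^ h"
        using posP by (intro mult_right_mono mult_left_mono of_nat_mono price_error_bound[OF w]) auto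
      finally show "(\<Sum>n \<in> J. \<Sum>f \<in> ?\<Omega>. real (ham Y f (\<phi> n f))) * (2 ^ h * 2 ^ h) \<le> ?P * 2 ^ m * 2 ^ h"
        by simp
    qed
    also have "(\<Sum>p \<in> Y. 2 ^ (h - lam p) * (2 * ?P)) \<le> 2 * ?P * 2 ^ (m + 1 + h)"
    proof -
      have "(\<Sum>p \<in> Y. (2::real) ^ (h - lam p)) \<le> 2 ^ (m + 1 + h)"
        using of_nat_mono[OF lam, where 'a=real] by simp
      then have "2 * ?P * (\<Sum>p \<in> Y. (2::real) ^ (h - lam p)) \<le> 2 * ?P * 2 ^ (m + 1 + h)"
        using posP by (intro mult_left_mono) auto
      then show ?thesis by (simp add: sum_distrib_left mult.commute)
    qed
    \<comment> \<open>The typical levels contribute \<open>4 * 2 ^ (m + h)\<close> and the moved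
      coordinates at most \<open>2 ^ (m + h)\<close>, on average.\<close>
    also have "2 * ?P * 2 ^ (m + 1 + h) + ?P * 2 ^ m * 2 ^ h \<le> ?P * 2 ^ (m + 4 + h)"
      using posP by (simp add: power_add)
    finally show ?thesis by simp
  qed
  \<comment> \<open>A point that costs no more than the average; \<open>v\<close> was built to
    dominate its moved versions for all lengths at once.\<close>
  then have "\<exists>f \<in> ?\<Omega>. cost f \<le> 2 ^ (m + 4 + h)"
  proof (rule contrapos_pp)
    assume "\<not> (\<exists>f \<in> ?\<Omega>. cost f \<le> 2 ^ (m + 4 + h))"
    then have gt: "real (cost f) > 2 ^ (m + 4 + h)" if "f \<in> ?\<Omega>" for f
    proof -
      have "2 ^ (m + 4 + h) < cost f"
        using that \<open>\<not> (\<exists>f \<in> ?\<Omega>. cost f \<le> 2 ^ (m + 4 + h))\<close> by (simp add: not_le)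
      then have "real (2 ^ (m + 4 + h)) < real (cost f)" by (simp only: of_nat_less_iff)
      then show ?thesis by simp
    qed
    have "?\<Omega> \<noteq> {}"
    proof
      assume "?\<Omega> = {}"
      then have "N ^ card Y = 0" using cardO by simp
      then show False by (simp add: N_def)
    qed
    then have "(\<Sum>f \<in> ?\<Omega>. (2::real) ^ (m + 4 + h)) < (\<Sum>f \<in> ?\<Omega>. real (cost f))"
      using finO gt by (intro sum_strict_mono) auto
    then show "\<not> (\<Sum>f \<in> ?\<Omega>. real (cost f)) \<le> ?P * 2 ^ (m + 4 + h)"
      by (simp add: cardO)
  qed
  then obtain f where f: "f \<in> ?\<Omega>" "cost f \<le> 2 ^ (m + 4 + h)" by blast
  show ?thesis
  proof (rule that[of "v f"])
    show "v f p \<le> h" for p by (simp add: v_def level_le)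
    show "(\<Sum>p \<in> Y. 2 ^ v f p * 2 ^ (h - lam p)) \<le> (2::nat) ^ (m + 4 + h)"
      using f(2) by (simp add: cost_def)
    fix n
    assume n: "n \<in> J"
    have "level h (\<phi> n f p) \<le> v f p" for p
      using n by (auto simp: v_def level_le)
    then have "good n (\<phi> n f) \<subseteq> {x \<in> B n. \<forall>p \<in> Y. lev x p \<le> v f p}"
      unfolding good_def by (blast intro: le_trans)
    then have "card (good n (\<phi> n f)) \<le> card {x \<in> B n. \<forall>p \<in> Y. lev x p \<le> v f p}"
      using B[OF n] by (intro card_mono) auto
    moreover have "card (B n) \<le> 2 ^ q * card (good n (\<phi> n f))"
      using \<phi>(1)[OF n f(1)] by (simp add: A_def)
    ultimately show "card (B n) \<le> 2 ^ (m div 4 + 1) * card {x \<in> B n. \<forall>p \<in> Y. lev x p \<le> v f p}"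
      unfolding q_def by (rule_tac le_trans[OF _ mult_le_mono2])
  qed
qed

section \<open>Strings that force heavy lists\<close>

lemma computable_lookup [comp_intros]:
  fixes vs :: "'a::cod \<Rightarrow> ('b::cod \<times> nat) list"
  assumes "computable vs" and "computable p"
  shows "computable (\<lambda>x. foldr (\<lambda>e a. if fst e = p x then snd e else a) (vs x) 0)"
  by (intro comp_intros computable_comp[OF assms(2)] assms)

locale short_lists =
  fixes U :: tm and r c T :: "nat \<Rightarrow> nat" and lst :: "bool list \<Rightarrow> bool list \<Rightarrow> bool list list"
  assumes U: "standard U" and r: "computable r"
    and lst: "computable (\<lambda>q. lst (fst q) (snd q))"
    and dist: "\<And>x \<rho>. distinct (lst x \<rho>)"
    and len: "\<And>x \<rho>. length \<rho> = r (length x) \<Longrightarrow> length (lst x \<rho>) = T (length x)"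
    and half: "\<And>x. 2 * card {\<rho>. length \<rho> = r (length x) \<and>
      (\<exists>p \<in> set (lst x \<rho>). short_program U (c (length x)) p x)} \<ge> 2 ^ r (length x)"
begin

definition freq :: "bool list \<Rightarrow> bool list \<Rightarrow> nat" where
  "freq x p = card {\<rho>. length \<rho> = r (length x) \<and> p \<in> set (lst x \<rho>)}"

text \<open>Up to rounding, \<open>lv x l p\<close> is the binary logarithm of the fraction of lists that contain \<open>p\<close>,
  measured from \<open>- (1 + l)\<close> and cut off at 0.\<close>

definition lv :: "bool list \<Rightarrow> nat \<Rightarrow> bool list \<Rightarrow> nat" where
  "lv x l p = (LEAST i. freq x p * 2 ^ (1 + l) \<le> 2 ^ (i + r (length x)))"

lemma computable_r [comp_intros]: "computable f \<Longrightarrow> computable (\<lambda>x. r (f x))"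
  by (rule computable_comp[OF r])

lemma computable_lst [comp_intros]:
  "computable f \<Longrightarrow> computable g \<Longrightarrow> computable (\<lambda>x. lst (f x) (g x))"
  by (rule computable_comp2[OF lst])

lemma freq_eq: "freq x p = length (filter (\<lambda>\<rho>. p \<in> set (lst x \<rho>)) (words (r (length x))))"
  by (simp add: freq_def count_words)

lemma computable_freq [comp_intros]:
  assumes "computable f" and "computable g"
  shows "computable (\<lambda>x. freq (f x) (g x))"
proof -
  have "computable (\<lambda>q. freq (fst q) (snd q))"
    unfolding freq_eq by (intro comp_intros)
  then show ?thesis using assms by (rule computable_comp2)
qed

lemma freq_le: "freq x p \<le> 2 ^ r (length x)"
  unfolding freq_eq by (metis length_filter_le length_words)

lemma lv_le: "lv x l p \<le> 1 + l"
  unfolding lv_def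
proof (rule Least_le)
  show "freq x p * 2 ^ (1 + l) \<le> 2 ^ (1 + l + r (length x))"
    using mult_le_mono1[OF freq_le[of x p], of "2 ^ (1 + l)"] by (simp add: power_add mult_ac)
qed

lemma lv_ex: "\<exists>i. freq x p * 2 ^ (1 + l) \<le> 2 ^ (i + r (length x))"
  using mult_le_mono1[OF freq_le[of x p], of "2 ^ (1 + l)"]
  by (intro exI[of _ "1 + l"]) (simp add: power_add mult_ac)

lemma freq_le_lv: "freq x p * 2 ^ (1 + l) \<le> 2 ^ (lv x l p + r (length x))"
  unfolding lv_def using lv_ex by (rule LeastI_ex)

text \<open>Since \<open>i + 1 <= 2 ^ i\<close>, a logarithmic level is also linearly bounded by the
  frequency. This allows sums of levels to be compared with the total size of the lists.\<close>

lemma lv_le_freq: "lv x l p * 2 ^ r (length x) \<le> freq x p * 2 ^ (1 + l)"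
proof (cases "lv x l p")
  case (Suc i)
  have "\<not> freq x p * 2 ^ (1 + l) \<le> 2 ^ (i + r (length x))"
    using Suc unfolding lv_def by (intro not_less_Least) simp
  moreover have "Suc i * 2 ^ r (length x) \<le> 2 ^ i * 2 ^ r (length x)"
    using less_exp[of i] by (intro mult_le_mono1) (simp add: Suc_le_eq)
  ultimately show ?thesis using Suc by (simp add: power_add)
qed simp

lemma lv_0: "freq x p = 0 \<Longrightarrow> lv x l p = 0"
  using lv_le_freq[of x l p] by simp

lemma computable_lv:
  assumes "computable f" and "computable g" and "computable h"
  shows "computable (\<lambda>x. lv (f x) (g x) (h x))"
proof -
  have "computable (\<lambda>q. lv (fst q) (fst (snd q)) (snd (snd q)))"
    unfolding lv_def
    by (rule computable_Least[OF _ lv_ex]) (intro comp_intros)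
  then show ?thesis using assms by (rule computable_comp3)
qed

lemma T_pos: "T n \<ge> 1"
proof -
  define x where "x = replicate n True"
  have "card {\<rho>. length \<rho> = r (length x) \<and>
      (\<exists>p \<in> set (lst x \<rho>). short_program U (c (length x)) p x)} \<noteq> 0"
    using half[of x] by (metis mult_0_right not_le zero_less_numeral zero_less_power)
  then have "{\<rho>. length \<rho> = r (length x) \<and>
      (\<exists>p \<in> set (lst x \<rho>). short_program U (c (length x)) p x)} \<noteq> {}"
    by (metis card.empty)
  then obtain \<rho> p where "length \<rho> = r (length x)" "p \<in> set (lst x \<rho>)" by blast
  then show ?thesis using len[of \<rho> x] by (cases "lst x \<rho>") (auto simp: x_def)
qed

text \<open>\<open>T\<close> is not assumed to be computable, but it can be read off from any single
  list.\<close>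

lemma computable_T [comp_intros]:
  assumes "computable f"
  shows "computable (\<lambda>x. T (f x))"
proof -
  let ?u = "\<lambda>n. map (\<lambda>_. True) [0..<n]"
  have "T n = length (lst (?u n) (?u (r n)))" for n
    using len[of "?u (r n)" "?u n"] by simp
  then have "T = (\<lambda>n. length (lst (?u n) (?u (r n))))" by blast
  moreover have "computable (\<lambda>n. length (lst (?u n) (?u (r n))))" by (intro comp_intros)
  ultimately have "computable T" by (simp only:)
  then show ?thesis using assms by (rule computable_comp)
qed

lemma sum_freq_le:
  assumes "finite S"
  shows "(\<Sum>p \<in> S. freq x p) \<le> T (length x) * 2 ^ r (length x)"
proof -
  let ?W = "{\<rho> :: bool list. length \<rho> = r (length x)}"
  have "(\<Sum>\<rho> \<in> ?W. card {p \<in> S. p \<in> set (lst x \<rho>)}) = (\<Sum>p \<in> S. freq x p)"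
    by (rule sum_multicount_gen[OF finite_length_eq assms]) (simp add: freq_def)
  moreover have "(\<Sum>\<rho> \<in> ?W. card {p \<in> S. p \<in> set (lst x \<rho>)}) \<le> (\<Sum>\<rho> \<in> ?W. T (length x))"
  proof (rule sum_mono)
    fix \<rho> :: "bool list"
    assume "\<rho> \<in> ?W"
    then have "card (set (lst x \<rho>)) = T (length x)" using len distinct_card[OF dist] by simp
    then show "card {p \<in> S. p \<in> set (lst x \<rho>)} \<le> T (length x)"
      using card_mono[of "set (lst x \<rho>)" "{p \<in> S. p \<in> set (lst x \<rho>)}"] by auto
  qed
  ultimately show ?thesis by (simp add: card_length_eq mult.commute)
qed

text \<open>For the bound on \<open>r\<close> only the number of distinct entries of all lists
  matters, not their frequencies.\<close>

lemma card_support_le: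
  assumes "finite S" and "\<And>p. p \<in> S \<Longrightarrow> freq x p \<noteq> 0"
  shows "card S \<le> T (length x) * 2 ^ r (length x)"
proof -
  have "card S = (\<Sum>p \<in> S. 1)" by simp
  also have "\<dots> \<le> (\<Sum>p \<in> S. freq x p)" using assms(2) by (intro sum_mono) (simp add: Suc_le_eq)
  finally show ?thesis using sum_freq_le[OF assms(1), of x] by linarith
qed

definition band :: "nat \<Rightarrow> nat \<Rightarrow> bool list set" where
  "band m w = {p. m < length p \<and> length p \<le> m + w}"

definition band_list :: "nat \<Rightarrow> nat \<Rightarrow> bool list list" where
  "band_list m w = concat (map words [Suc m..<Suc (m + w)])"

lemma set_band_list: "set (band_list m w) = band m w"
  by (auto simp: band_list_def band_def set_words)

lemma distinct_band_list: "distinct (band_list m w)"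
proof -
  have "inj_on words {Suc m..<Suc (m + w)}"
    by (rule inj_onI) (metis length_words nat_power_eq_Suc_0_iff power_inject_exp one_less_numeral_iff semiring_norm(76))
  then have "distinct (map words [Suc m..<Suc (m + w)])"
    by (simp only: distinct_map set_upt distinct_upt)
  then show ?thesis
    unfolding band_list_def
    by (intro distinct_concat) (auto simp: distinct_words set_words simp del: upt_Suc)
qed

lemma finite_band: "finite (band m w)"
  unfolding set_band_list[symmetric] by simp

lemma computable_band_list [comp_intros]:
  assumes "computable f" and "computable g"
  shows "computable (\<lambda>x. band_list (f x) (g x))"
  unfolding band_list_def by (intro comp_intros assms)

lemma sum_band: "(\<Sum>p \<in> band m w. g (length p)) = (\<Sum>d \<in> {1..w}. 2 ^ (m + d) * (g (m + d) :: nat))"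
proof -
  have "(\<Sum>p \<in> band m w. g (length p)) = (\<Sum>d \<in> {1..w}. \<Sum>p \<in> {p :: bool list. length p = m + d}. g (length p))"
  proof -
    have "band m w = (\<Union>d \<in> {1..w}. {p. length p = m + d})"
    proof (intro set_eqI iffI)
      fix p :: "bool list"
      assume "p \<in> band m w"
      then show "p \<in> (\<Union>d \<in> {1..w}. {p. length p = m + d})"
        by (intro UN_I[of "length p - m"]) (auto simp: band_def)
    qed (auto simp: band_def)
    then show ?thesis by (simp only:) (rule sum.UNION_disjoint, auto simp: finite_length_eq)
  qed
  then show ?thesis by (simp add: card_length_eq)
qed

text \<open>Here \<open>cs e n\<close> is a computable guess for \<open>c n\<close>, and \<open>act e m n\<close> says that \<open>m\<close> is used for the
  length \<open>n\<close>. All lengths share the prices for \<open>m\<close>, so \<open>wid\<close> and \<open>lam\<close> must not depend on \<open>n\<close>.\<close>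

theorem exists_heavy:
  fixes cs wid :: "nat \<Rightarrow> nat \<Rightarrow> nat" and lam :: "nat \<Rightarrow> nat \<Rightarrow> nat \<Rightarrow> nat"
    and act :: "nat \<Rightarrow> nat \<Rightarrow> nat \<Rightarrow> bool"
  assumes cs: "computable (\<lambda>q. cs (fst q) (snd q))"
    and wid: "computable (\<lambda>q. wid (fst q) (snd q))"
    and lam: "computable (\<lambda>q. lam (fst q) (fst (snd q)) (snd (snd q)))"
    and act: "computable (\<lambda>q. act (fst q) (fst (snd q)) (snd (snd q)))"
    and lam_le: "\<And>e m d. d \<le> wid e m \<Longrightarrow> lam e m d \<le> 2 * wid e m"
    and lam_sum: "\<And>e m. (\<Sum>d \<in> {1..wid e m}. 2 ^ (m + d) * 2 ^ (2 * wid e m + 1 - lam e m d))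
      \<le> (2::nat) ^ (m + 1 + (2 * wid e m + 1))"
    and act_imp: "\<And>e m n. act e m n \<Longrightarrow> 1000 \<le> m \<and> 64 * wid e m \<le> m \<and> 3 * e + cs e n \<le> wid e m"
  obtains a where "\<And>e n. a \<le> e \<Longrightarrow> 1 \<le> n \<Longrightarrow> c n \<le> cs e n \<Longrightarrow>
    \<exists>x. length x = n \<and> (\<forall>m. 2 * m \<le> n \<longrightarrow> n \<le> 4 * m \<longrightarrow> act e m n \<longrightarrow>
      m < 8 * (\<Sum>p \<in> band m (3 * e + cs e n). lv x (lam e m (length p - m)) p))"
proof -
  \<comment> \<open>The largest possible level: \<open>lv x l p <= 1 + l\<close>, and the cutoffs
    \<open>lam\<close> are at most \<open>2 * wid\<close>.\<close>
  define h where "h e m = 2 * wid e m + 1" for e m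
  \<comment> \<open>The prices cover the width \<open>wid e m\<close>, common to all lengths,
    whereas only programs of length at most \<open>m + 3 * e + cs e n\<close> can serve a string of
    length \<open>n\<close>. The others get level 0.\<close>
  define lev where "lev e m x p = (if length p \<le> m + (3 * e + cs e (length x))
     then lv x (lam e m (length p - m)) p else 0)" for e m x p
  define bad where "bad e m x \<longleftrightarrow> 2 * m \<le> length x \<and> length x \<le> 4 * m \<and> act e m (length x) \<and>
     8 * sum_list (map (lev e m x) (band_list m (wid e m))) \<le> m" for e m x
  define look where "look vs p = foldr (\<lambda>e a. if fst e = p then snd e else a) vs (0::nat)"
    for vs :: "(bool list \<times> nat) list" and p
  \<comment> \<open>Prices are kept as an association list, a finite object, and \<open>R\<close> is
    decidable, so valid prices can be found by search once \<open>prices\<close> shows that they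
    exist. The guard makes the search succeed for every \<open>em\<close>.\<close>
  define R where "R em vs \<longleftrightarrow> (1000 \<le> snd em \<and> 64 * wid (fst em) (snd em) \<le> snd em \<longrightarrow>
     sum_list (map (\<lambda>p. (2::nat) ^ look vs p * 2 ^ (h (fst em) (snd em) - lam (fst em) (snd em) (length p - snd em)))
       (band_list (snd em) (wid (fst em) (snd em)))) \<le> 2 ^ (snd em + 4 + h (fst em) (snd em)) \<and>
     (\<forall>n \<in> set [2 * snd em..<Suc (4 * snd em)].
       length (filter (bad (fst em) (snd em)) (words n)) \<le> 2 ^ (snd em div 4 + 1) *
         length (filter (\<lambda>x. bad (fst em) (snd em) x \<and>
           (\<forall>p \<in> set (band_list (snd em) (wid (fst em) (snd em))). lev (fst em) (snd em) x p \<le> look vs p))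
           (words n))))" for em vs
  have clev: "computable (\<lambda>q. lev (f q) (g q) (k q) (l q))"
    if "computable f" "computable g" "computable k" "computable l" for f g k l :: "'z::cod \<Rightarrow> _"
    unfolding lev_def
    by (intro comp_intros computable_lv computable_comp3[OF lam] computable_comp2[OF cs] that)
  have cwid: "computable (\<lambda>q. wid (f q) (g q))" if "computable f" "computable g" for f g :: "'z::cod \<Rightarrow> _"
    using that by (rule computable_comp2[OF wid])
  have cbad: "computable (\<lambda>q. bad (f q) (g q) (k q))"
    if "computable f" "computable g" "computable k" for f g k :: "'z::cod \<Rightarrow> _"
  proof -
    have "computable (\<lambda>q. bad (fst q) (fst (snd q)) (snd (snd q)))"
      unfolding bad_def by (intro comp_intros computable_comp3[OF act] clev cwid)
    then show ?thesis using that by (rule computable_comp3)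
  qed
  have clook: "computable (\<lambda>q. look (f q) (g q))" if "computable f" "computable g" for f g :: "'z::cod \<Rightarrow> _"
    unfolding look_def using that by (rule computable_lookup)
  have "computable (\<lambda>q. R (fst q) (snd q))"
    unfolding R_def h_def
    by (intro comp_intros clev cbad clook cwid computable_comp3[OF lam])
  moreover have exR: "\<exists>vs. R em vs" for em
  proof (cases "1000 \<le> snd em \<and> 64 * wid (fst em) (snd em) \<le> snd em")
    case True
    obtain e m where em: "em = (e, m)" by (cases em)
    let ?w = "wid e m" and ?h = "h e m"
    have w: "64 * ?w \<le> m" "?h \<le> 2 * ?w + 1" "1000 \<le> m" using True by (auto simp: em h_def)
    have cardY: "card (band m ?w) \<le> 2 ^ (m + ?w + 1)"
    proof -
      have "card (band m ?w) \<le> card {p :: bool list. length p \<le> m + ?w}"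
        by (intro card_mono finite_length_le) (auto simp: band_def)
      then show ?thesis using card_length_le[of "m + ?w"] by simp
    qed
    have lamY: "(\<Sum>p \<in> band m ?w. 2 ^ (?h - lam e m (length p - m))) \<le> (2::nat) ^ (m + 1 + ?h)"
      using lam_sum[where e=e and m=m] sum_band[of "\<lambda>l. 2 ^ (?h - lam e m (l - m))" m ?w]
      by (simp add: h_def)
    have lev_h: "lev e m x p \<le> ?h" if "p \<in> band m ?w" for x p
    proof -
      have "lam e m (length p - m) \<le> 2 * ?w" using that by (intro lam_le) (auto simp: band_def)
      then show ?thesis using lv_le[of x "lam e m (length p - m)" p] by (auto simp: lev_def h_def)
    qed
    let ?B = "\<lambda>n. {x. length x = n \<and> bad e m x}"
    have lev_sum: "8 * (\<Sum>p \<in> band m ?w. lev e m x p) \<le> m" if "bad e m x" for x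
      using that sum_list_distinct_conv_sum_set[OF distinct_band_list, of "lev e m x" m ?w]
      by (simp add: bad_def set_band_list)
    have finB: "finite (?B n)" for n by (rule finite_subset[OF _ finite_length_eq[of n]]) auto
    obtain v where v: "\<And>p. p \<in> band m ?w \<Longrightarrow> v p \<le> ?h"
      "(\<Sum>p \<in> band m ?w. 2 ^ v p * 2 ^ (?h - lam e m (length p - m))) \<le> (2::nat) ^ (m + 4 + ?h)"
      "\<And>n. n \<in> {2 * m..4 * m} \<Longrightarrow> card (?B n) \<le> 2 ^ (m div 4 + 1) *
         card {x \<in> ?B n. \<forall>p \<in> band m ?w. lev e m x p \<le> v p}"
    proof (rule prices[OF finite_band cardY w lamY, of "{2 * m..4 * m}" ?B "lev e m"])
      show "card {2 * m..4 * m} \<le> 2 * m + 1" by simp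
    qed (use lev_h lev_sum finB in \<open>auto intro: that\<close>)
    define vs where "vs = map (\<lambda>p. (p, v p)) (band_list m ?w)"
    have look: "look vs p = v p" if "p \<in> band m ?w" for p
    proof -
      have "look (map (\<lambda>p. (p, v p)) ps) p = v p" if "p \<in> set ps" for ps
        using that by (induction ps) (auto simp: look_def)
      then show ?thesis using that by (simp add: vs_def set_band_list)
    qed
    have "sum_list (map (\<lambda>p. 2 ^ look vs p * 2 ^ (?h - lam e m (length p - m))) (band_list m ?w))
        \<le> (2::nat) ^ (m + 4 + ?h)"
      unfolding sum_list_distinct_conv_sum_set[OF distinct_band_list] set_band_list
      using v(2) by (simp add: look cong: sum.cong)
    moreover have "length (filter (bad e m) (words n)) \<le> 2 ^ (m div 4 + 1) *
         length (filter (\<lambda>x. bad e m x \<and> (\<forall>p \<in> set (band_list m ?w). lev e m x p \<le> look vs p)) (words n))"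
      if "n \<in> {2 * m..4 * m}" for n
    proof -
      have "{x. length x = n \<and> bad e m x \<and> (\<forall>p \<in> band m ?w. lev e m x p \<le> look vs p)} =
          {x \<in> ?B n. \<forall>p \<in> band m ?w. lev e m x p \<le> v p}"
        by (auto simp: look)
      then show ?thesis using v(3)[OF that] by (simp only: count_words set_band_list)
    qed
    ultimately have "R em vs"
      unfolding R_def em fst_conv snd_conv by (simp add: less_Suc_eq_le)
    then show ?thesis by blast
  next
    case False
    then have "R em []" unfolding R_def by (rule notE[THEN impI])
    then show ?thesis by blast
  qed
  ultimately obtain vv where vv: "computable vv" "\<And>em. R em (vv em)"
    using computable_choice by blast
  define cand where "cand em x \<longleftrightarrow> bad (fst em) (snd em) x \<and>
     (\<forall>p \<in> set (band_list (snd em) (wid (fst em) (snd em))).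
        lev (fst em) (snd em) x p \<le> look (vv em) p)" for em x
  have ccand: "computable (\<lambda>q. cand (fst q) (snd q))"
    unfolding cand_def by (intro comp_intros clev cbad clook cwid computable_comp[OF vv(1)])
  have cand_len: "length x \<le> 4 * m" if "cand (e, m) x" for e m x
    using that by (simp add: cand_def bad_def)
  obtain a where a: "\<And>e m x. a \<le> e \<Longrightarrow>
    card {x. cand (e, m) x \<and> served U lst (r (length x)) m (m + 3 * e + cs e (length x)) x} + 4 * m + 1
      \<le> 2 ^ (m + e) \<Longrightarrow>
    cand (e, m) x \<Longrightarrow> c (length x) \<le> cs e (length x) \<Longrightarrow>
    served U lst (r (length x)) m (m + 3 * e + cs e (length x)) x"
    by (rule serve_all[OF U r lst half cs ccand]) (erule cand_len, rule that, assumption)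
  define S where "S e m = {x. cand (e, m) x \<and> served U lst (r (length x)) m (m + 3 * e + cs e (length x)) x}"
    for e m
  \<comment> \<open>At most \<open>2 * 2 ^ m\<close> strings have a program of length at most
    \<open>m\<close>. Every other served string uses weight \<open>2 ^ h\<close> out of a total of
    \<open>2 ^ (m + 4 + h)\<close>, which gives \<open>16 * 2 ^ m\<close> more.\<close>
  have S_le: "card (S e m) \<le> 18 * 2 ^ m" and finS: "finite (S e m)" for e m
  proof -
    have finc: "finite {x. cand (e, m) x}"
      by (rule finite_subset[OF _ finite_length_le[of "4 * m"]]) (auto dest: cand_len)
    then show "finite (S e m)" by (rule rev_finite_subset) (auto simp: S_def)
    define S1 where "S1 = {x. \<exists>q. length q \<le> m \<and> tm_fun U q = Some x}"
    define S2 where "S2 = S e m - S1"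
    have "S1 \<subseteq> (\<lambda>q. the (tm_fun U q)) ` {q. length q \<le> m}"
      unfolding S1_def by force
    then have "card S1 \<le> card {q :: bool list. length q \<le> m}" and fin1: "finite S1"
      using finite_length_le[of m] by (auto intro: surj_card_le finite_surj)
    then have S1: "card S1 \<le> 2 * 2 ^ m" using card_length_le[of m] by simp
    have S2: "card S2 \<le> 16 * 2 ^ m"
    proof (cases "S2 = {}")
      case False
      then obtain x0 where "x0 \<in> S2" by blast
      then have valid: "1000 \<le> m" "64 * wid e m \<le> m"
        using act_imp[of e m "length x0"] by (auto simp: S2_def S_def cand_def bad_def)
      let ?g = "\<lambda>p. 2 ^ look (vv (e, m)) p * (2::nat) ^ (h e m - lam e m (length p - m))"
      have total: "(\<Sum>p \<in> band m (wid e m). ?g p) \<le> 2 ^ (m + 4 + h e m)"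
        using vv(2)[of "(e, m)"] valid
          sum_list_distinct_conv_sum_set[OF distinct_band_list, of ?g m "wid e m"]
        by (simp add: R_def set_band_list)
      define P where "P x = {p \<in> band m (3 * e + cs e (length x)). tm_fun U p = Some x}" for x
      \<comment> \<open>Half of the lists contain a program from \<open>P x\<close>, so the
        frequencies add up to at least one half; as \<open>x\<close> is a candidate, each frequency
        is covered by the price of its program. The sets \<open>P x\<close> are disjoint for
        different \<open>x\<close>.\<close>
      have each: "2 ^ h e m \<le> (\<Sum>p \<in> P x. ?g p)" and sub: "P x \<subseteq> band m (wid e m)" if x: "x \<in> S2" for x
      proof -
        have cx: "cand (e, m) x" and nx: "x \<notin> S1"
          and sx: "served U lst (r (length x)) m (m + 3 * e + cs e (length x)) x"
          using x by (auto simp: S2_def S_def)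
        have act_x: "3 * e + cs e (length x) \<le> wid e m"
          using cx act_imp by (auto simp: cand_def bad_def)
        then show sub: "P x \<subseteq> band m (wid e m)" by (auto simp: P_def band_def)
        have finP: "finite (P x)" by (rule finite_subset[OF sub finite_band])
        let ?r = "r (length x)"
        let ?G = "{\<rho>. length \<rho> = ?r \<and> (\<exists>p \<in> set (lst x \<rho>).
            length p \<le> m + 3 * e + cs e (length x) \<and> tm_fun U p = Some x)}"
        have "2 ^ ?r \<le> 2 * card ?G"
          using sx nx unfolding served_def S1_def by blast
        also have "?G \<subseteq> (\<Union>p \<in> P x. {\<rho>. length \<rho> = ?r \<and> p \<in> set (lst x \<rho>)})"
          using nx by (auto simp: P_def band_def S1_def not_le[symmetric])
        then have "card ?G \<le> card (\<Union>p \<in> P x. {\<rho>. length \<rho> = ?r \<and> p \<in> set (lst x \<rho>)})"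
          by (rule card_mono[rotated])
            (use finP in \<open>auto intro: finite_subset[OF _ finite_length_eq[of ?r]]\<close>)
        also have "\<dots> \<le> (\<Sum>p \<in> P x. freq x p)"
          unfolding freq_def by (rule card_UN_le[OF finP])
        finally have "2 ^ ?r * 2 ^ h e m \<le> 2 * (\<Sum>p \<in> P x. freq x p) * 2 ^ h e m"
          by (intro mult_le_mono1) simp
        also have "\<dots> = (\<Sum>p \<in> P x. 2 * freq x p * 2 ^ h e m)"
          by (simp add: sum_distrib_left sum_distrib_right)
        also have "\<dots> \<le> (\<Sum>p \<in> P x. ?g p * 2 ^ ?r)"
        proof (rule sum_mono)
          fix p
          assume p: "p \<in> P x"
          then have pb: "p \<in> band m (wid e m)" and pl: "length p \<le> m + (3 * e + cs e (length x))"
            using sub by (auto simp: P_def band_def)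
          let ?l = "lam e m (length p - m)"
          have "?l \<le> 2 * wid e m" using pb by (intro lam_le) (auto simp: band_def)
          then have "?l \<le> h e m" by (simp add: h_def)
          then have "2 * freq x p * 2 ^ h e m = freq x p * 2 ^ (1 + ?l) * 2 ^ (h e m - ?l)"
            by (simp add: mult.assoc flip: power_add)
          also have "\<dots> \<le> 2 ^ (lv x ?l p + ?r) * 2 ^ (h e m - ?l)"
            by (intro mult_le_mono1 freq_le_lv)
          also have "\<dots> \<le> 2 ^ (look (vv (e, m)) p + ?r) * 2 ^ (h e m - ?l)"
          proof (intro mult_le_mono1 power_increasing)
            have "lev e m x p \<le> look (vv (e, m)) p" using cx pb by (simp add: cand_def set_band_list)
            then show "lv x ?l p + ?r \<le> look (vv (e, m)) p + ?r" using pl by (simp add: lev_def)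
          qed simp
          finally show "2 * freq x p * 2 ^ h e m \<le> ?g p * 2 ^ ?r"
            by (simp add: power_add mult_ac)
        qed
        also have "\<dots> = 2 ^ ?r * (\<Sum>p \<in> P x. ?g p)" by (simp add: sum_distrib_left mult.commute)
        finally show "2 ^ h e m \<le> (\<Sum>p \<in> P x. ?g p)" by simp
      qed
      have fin2: "finite S2" using \<open>finite (S e m)\<close> by (simp add: S2_def)
      have "card S2 * 2 ^ h e m = (\<Sum>x \<in> S2. 2 ^ h e m)" by simp
      also have "\<dots> \<le> (\<Sum>x \<in> S2. \<Sum>p \<in> P x. ?g p)" by (rule sum_mono) (rule each)
      also have "\<dots> = (\<Sum>p \<in> (\<Union>x \<in> S2. P x). ?g p)"
        by (rule sum.UNION_disjoint[symmetric])
          (use fin2 sub in \<open>auto intro: finite_subset[OF _ finite_band] simp: P_def\<close>)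
      also have "\<dots> \<le> (\<Sum>p \<in> band m (wid e m). ?g p)"
        using sub by (intro sum_mono2 finite_band) auto
      also have "\<dots> \<le> 16 * 2 ^ m * 2 ^ h e m" using total by (simp add: power_add)
      finally show ?thesis by simp
    qed simp
    have "card (S e m) \<le> card (S1 \<union> S2)"
      using fin1 \<open>finite (S e m)\<close> by (intro card_mono) (auto simp: S2_def)
    also have "\<dots> \<le> card S1 + card S2" by (rule card_Un_le)
    finally show "card (S e m) \<le> 18 * 2 ^ m" using S1 S2 by linarith
  qed
  have "\<exists>x. length x = n \<and> (\<forall>m. 2 * m \<le> n \<longrightarrow> n \<le> 4 * m \<longrightarrow> act e m n \<longrightarrow>
      m < 8 * (\<Sum>p \<in> band m (3 * e + cs e n). lv x (lam e m (length p - m)) p))"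
    \<comment> \<open>The 5 is due to \<open>18 * 2 ^ m + 4 * m + 1 <= 23 * 2 ^ m\<close>, which is
      below \<open>2 ^ (m + 5)\<close>.\<close>
    if e: "a + 5 \<le> e" and n: "1 \<le> n" and c: "c n \<le> cs e n" for e n
  proof -
    define Bad where "Bad m = {x. length x = n \<and> bad e m x}" for m
    have finBad: "finite (Bad m)" for m
      unfolding Bad_def by (rule finite_subset[OF _ finite_length_eq[of n]]) auto
    \<comment> \<open>All candidates of length \<open>n\<close> are served, hence few. The light
      strings outnumber them by a factor of at most \<open>2 ^ (m div 4 + 1)\<close>, so there are
      at most about \<open>2 ^ (5 * m / 4 + 6)\<close>, far below \<open>2 ^ n / n\<close> as
      \<open>2 * m <= n\<close>. A union bound over \<open>m\<close> then leaves a heavy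
      string.\<close>
    have small: "n * card (Bad m) < 2 ^ n" if m: "2 * m \<le> n" "n \<le> 4 * m" and act: "act e m n" for m
    proof -
      have valid: "1000 \<le> m" "64 * wid e m \<le> m" using act_imp[OF act] by auto
      have lin: "4 * m + 1 \<le> 5 * 2 ^ m" using less_exp[of m] by linarith
      have "(2::nat) ^ (m + 5) \<le> 2 ^ (m + e)" using e by (intro power_increasing) auto
      then have few: "card (S e m) + 4 * m + 1 \<le> 2 ^ (m + e)"
      proof -
        have "(2::nat) ^ (m + 5) = 32 * 2 ^ m" by (simp add: power_add)
        with \<open>(2::nat) ^ (m + 5) \<le> 2 ^ (m + e)\<close> show ?thesis
          using S_le[of e m] lin by linarith
      qed
      have "{x. length x = n \<and> cand (e, m) x} \<subseteq> S e m"
        using a[of e m] e few c unfolding S_def by auto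
      then have "card {x. length x = n \<and> cand (e, m) x} \<le> 18 * 2 ^ m"
        using card_mono[OF finS] S_le le_trans by blast
      moreover have "card (Bad m) \<le> 2 ^ (m div 4 + 1) * card {x. length x = n \<and> cand (e, m) x}"
      proof -
        have "n \<in> set [2 * m..<Suc (4 * m)]"
          using m by (simp only: set_upt atLeastLessThan_iff less_Suc_eq_le)
        then show ?thesis
          using vv(2)[of "(e, m)"] valid
          unfolding R_def Bad_def count_words cand_def fst_conv snd_conv by blast
      qed
      ultimately have "card (Bad m) \<le> 2 ^ (m div 4 + 1) * (18 * 2 ^ m)"
        by (meson le_trans mult_le_mono2)
      also have "\<dots> \<le> 2 ^ (m div 4 + 6 + m)" by (simp add: power_add)
      finally have "n * card (Bad m) \<le> (4 * m) * 2 ^ (m div 4 + 6 + m)"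
        using m by (intro mult_le_mono)
      also have "\<dots> < 2 ^ (m div 2) * 2 ^ (m div 4 + 6 + m)"
      proof -
        have "16 * j < 2 ^ (j::nat)" if "7 \<le> j" for j
          using that by (induction j rule: dec_induct) auto
        from this[of "m div 2"] have "4 * m < 2 ^ (m div 2)" using valid(1) by linarith
        then show ?thesis by (rule mult_less_mono1) simp
      qed
      also have "\<dots> = 2 ^ (m div 2 + (m div 4 + 6 + m))" by (simp only: power_add)
      also have "\<dots> \<le> 2 ^ n"
        using m valid(1) by (intro power_increasing) linarith+
      finally show ?thesis .
    qed
    define I where "I = {m. 2 * m \<le> n \<and> n \<le> 4 * m \<and> act e m n}"
    have I: "I \<subseteq> {1..n}" using n by (auto simp: I_def)
    then have finI: "finite I" and cardI: "card I \<le> n"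
      using card_mono[OF _ I] by (auto intro: finite_subset)
    have "card (\<Union>m \<in> I. Bad m) < 2 ^ n"
    proof (cases "I = {}")
      case False
      have "n * card (\<Union>m \<in> I. Bad m) \<le> n * (\<Sum>m \<in> I. card (Bad m))"
        by (intro mult_le_mono2 card_UN_le finI)
      also have "\<dots> = (\<Sum>m \<in> I. n * card (Bad m))" by (rule sum_distrib_left)
      also have "\<dots> < (\<Sum>m \<in> I. 2 ^ n)"
        using finI False small by (intro sum_strict_mono) (auto simp: I_def)
      also have "\<dots> \<le> n * 2 ^ n" using cardI by simp
      finally show ?thesis by simp
    qed simp
    moreover have "finite (\<Union>m \<in> I. Bad m)" using finI finBad by blast
    ultimately have "\<not> {x. length x = n} \<subseteq> (\<Union>m \<in> I. Bad m)"
      using card_mono[of "\<Union>m \<in> I. Bad m" "{x. length x = n}"] card_length_eq[of n] by auto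
    then obtain x where x: "length x = n" "\<And>m. m \<in> I \<Longrightarrow> x \<notin> Bad m" by blast
    have "m < 8 * (\<Sum>p \<in> band m (3 * e + cs e n). lv x (lam e m (length p - m)) p)" if "m \<in> I" for m
    proof -
      have act: "2 * m \<le> n" "n \<le> 4 * m" "act e m n" using that by (auto simp: I_def)
      have "m < 8 * (\<Sum>p \<in> band m (wid e m). lev e m x p)"
        using x(2)[OF that] x(1) act
          sum_list_distinct_conv_sum_set[OF distinct_band_list, of "lev e m x" m "wid e m"]
        by (simp add: Bad_def bad_def set_band_list)
      also have "(\<Sum>p \<in> band m (wid e m). lev e m x p) =
          (\<Sum>p \<in> band m (3 * e + cs e n). lv x (lam e m (length p - m)) p)"
        using act_imp[OF act(3)] x(1)
        by (intro sum.mono_neutral_cong_right finite_band) (auto simp: band_def lev_def)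
      finally show ?thesis .
    qed
    then show ?thesis using x(1) unfolding I_def by blast
  qed
  then show ?thesis by (rule that)
qed

end

text \<open>Here \<open>P k\<close> will say that the claimed bound fails when \<open>c n\<close> is
  replaced by \<open>k\<close>. The count minus 1 is then the largest such \<open>k\<close> below
  \<open>n\<close>: a computable guess, at least \<open>c n\<close> if the bound fails for
  \<open>c n\<close>, for which it still fails.\<close>

lemma last_true:
  fixes P :: "nat \<Rightarrow> bool"
  assumes anti: "\<And>j k. P k \<Longrightarrow> j \<le> k \<Longrightarrow> P j" and "P k" and "k < n"
  shows "k \<le> length (filter P [0..<n]) - 1" and "P (length (filter P [0..<n]) - 1)"
proof -
  define K where "K = length (filter P [0..<n])"
  have K: "K = card {j. j < n \<and> P j}"
    using distinct_card[of "filter P [0..<n]"] by (simp add: K_def conj_commute)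
  have "card {..k} \<le> K"
    unfolding K using assms by (intro card_mono) (auto intro: anti)
  then have k: "Suc k \<le> K" by simp
  then show "k \<le> length (filter P [0..<n]) - 1" by (simp add: K_def)
  show "P (length (filter P [0..<n]) - 1)"
  proof (rule ccontr)
    assume "\<not> P (length (filter P [0..<n]) - 1)"
    then have no: "\<not> P (K - 1)" by (simp add: K_def)
    have "j < K - 1" if "P j" for j
      using anti[OF that, of "K - 1"] no by (meson not_le)
    then have "{j. j < n \<and> P j} \<subseteq> {..<K - 1}" by auto
    then have "K \<le> K - 1" unfolding K using card_mono[of "{..<K - 1}"] K by fastforce
    then show False using k by linarith
  qed
qed

lemma power_half_sum: "(\<Sum>d \<in> {1..w}. 2 ^ (w - d)) < (2::nat) ^ w"
proof (induction w)
  case (Suc w)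
  have "(\<Sum>d \<in> {1..w}. 2 ^ (Suc w - d)) = 2 * (\<Sum>d \<in> {1..w}. (2::nat) ^ (w - d))"
    unfolding sum_distrib_left by (intro sum.cong refl) (auto simp: Suc_diff_le)
  with Suc show ?case by simp
qed simp

lemma power_sum: "(\<Sum>d \<in> {1..w}. 2 ^ d) < (2::nat) ^ (w + 1)"
  by (induction w) auto

text \<open>Bounds how many of the bands that start in an arithmetic progression contain a program
  of length \<open>l\<close>: the starts of these bands lie within a distance less than
  \<open>W\<close>.\<close>

lemma progression_window:
  fixes M W :: nat
  assumes "M > 0"
  shows "card {t \<in> K. M * t + \<rho> < l \<and> l \<le> M * t + \<rho> + W} \<le> W div M + 1"
    (is "card ?A \<le> _")
proof (cases "?A = {}")
  case False
  define s where "s = (LEAST t. t \<in> ?A)"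
  have s: "s \<in> ?A" unfolding s_def using False by (metis (mono_tags, lifting) LeastI ex_in_conv)
  have "?A \<subseteq> {s..s + W div M}"
  proof
    fix t
    assume t: "t \<in> ?A"
    then have st: "s \<le> t" unfolding s_def by (rule Least_le)
    have "M * t < M * s + W" using s t by auto
    then have "M * (t - s) \<le> W" using st by (simp add: diff_mult_distrib2)
    then have "t - s \<le> W div M" using assms by (simp add: less_eq_div_iff_mult_less_eq mult.commute)
    then show "t \<in> {s..s + W div M}" using st by auto
  qed
  then have "card ?A \<le> card {s..s + W div M}" by (intro card_mono) auto
  then show ?thesis by simp
next
  case True
  show ?thesis unfolding True by simp
qed

text \<open>A periodic labelling of the positive integers in which the label \<open>k\<close> has density of order
  \<open>1 / (k + 1) ^ 2\<close>: write \<open>k + 1 = 2 ^ i + j\<close> with \<open>j < 2 ^ i\<close>; the integers with this label are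
  those congruent to \<open>2 ^ i + 2 ^ (i + 1) * j\<close> modulo \<open>2 ^ (2 * i + 1)\<close>.\<close>

definition val2 :: "nat \<Rightarrow> nat" where
  "val2 m = (LEAST i. m mod 2 ^ (i + 1) \<noteq> 0 \<or> m = 0)"

definition label :: "nat \<Rightarrow> nat" where
  "label m = 2 ^ val2 m + (m div 2 ^ (val2 m + 1)) mod 2 ^ val2 m - 1"

lemma val2_ex: "\<exists>i. m mod 2 ^ (i + 1) \<noteq> 0 \<or> m = (0::nat)"
proof -
  have "m < 2 ^ (m + 1)" using less_exp[of "m + 1"] by linarith
  then have "m mod 2 ^ (m + 1) = m" by simp
  then show ?thesis by (metis neq0_conv)
qed

lemma computable_label [comp_intros]:
  assumes "computable f"
  shows "computable (\<lambda>x. label (f x))"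
proof -
  have "computable val2"
    unfolding val2_def by (rule computable_Least[OF _ val2_ex]) (intro comp_intros)
  note v = computable_comp[OF this]
  have "computable label" unfolding label_def by (intro comp_intros v)
  then show ?thesis using assms by (rule computable_comp)
qed

lemma val2_eq: "val2 (2 ^ i * (2 * s + 1)) = i"
  unfolding val2_def
proof (rule Least_equality)
  have "2 ^ i * (2 * s + 1) mod 2 ^ (i + 1) = (2 ^ i * ((2 * s + 1) mod 2) :: nat)"
    by (simp only: power_add power_one_right mult_mod_right)
  then have "2 ^ i * (2 * s + 1) mod 2 ^ (i + 1) = (2 ^ i :: nat)" by simp
  then show "2 ^ i * (2 * s + 1) mod 2 ^ (i + 1) \<noteq> (0::nat) \<or> 2 ^ i * (2 * s + 1) = (0::nat)" by simp
  fix j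
  assume j: "2 ^ i * (2 * s + 1) mod 2 ^ (j + 1) \<noteq> (0::nat) \<or> 2 ^ i * (2 * s + 1) = (0::nat)"
  show "i \<le> j"
  proof (rule ccontr)
    assume "\<not> i \<le> j"
    then have "(2::nat) ^ (j + 1) dvd 2 ^ i" by (intro le_imp_power_dvd) simp
    then have "(2::nat) ^ (j + 1) dvd 2 ^ i * (2 * s + 1)" by (rule dvd_mult2)
    then show False using j by (simp add: mod_eq_0_iff_dvd del: power_Suc)
  qed
qed

lemma label_progression:
  obtains M \<rho> :: nat where "M > 0" "\<rho> < M" "M \<le> 2 * (k + 1)\<^sup>2" "\<And>t. label (M * t + \<rho>) = k"
proof -
  obtain i where i: "2 ^ i \<le> k + 1" "k + 1 < 2 ^ (i + 1)"
    using ex_power_ivl1[of 2 "k + 1"] by auto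
  define j where "j = k + 1 - 2 ^ i"
  have j: "k + 1 = 2 ^ i + j" "j < 2 ^ i" using i by (auto simp: j_def)
  show ?thesis
  proof (rule that[of "2 ^ (2 * i + 1)" "2 ^ i + 2 ^ (i + 1) * j"])
    have "j + 1 \<le> 2 ^ i" using j by simp
    then have "2 ^ (i + 1) * (j + 1) \<le> 2 ^ (i + 1) * (2::nat) ^ i" by (rule mult_le_mono2)
    moreover have "2 ^ (i + 1) * (2::nat) ^ i = 2 ^ (2 * i + 1)"
    proof -
      have "(i + 1) + i = 2 * i + 1" by simp
      then show ?thesis by (simp only: power_add[symmetric])
    qed
    moreover have "2 ^ (i + 1) * (j + 1) = 2 ^ i + 2 ^ (i + 1) * j + (2::nat) ^ i"
      by (simp add: algebra_simps)
    ultimately show "2 ^ i + 2 ^ (i + 1) * j < (2::nat) ^ (2 * i + 1)"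
      using zero_less_power[of "2::nat" i] by linarith
    have "(2::nat) ^ (2 * i + 1) = 2 * (2 ^ i)\<^sup>2" by (simp add: power_even_eq)
    also have "\<dots> \<le> 2 * (k + 1)\<^sup>2" using i(1) by (intro mult_le_mono2 power_mono) auto
    finally show "(2::nat) ^ (2 * i + 1) \<le> 2 * (k + 1)\<^sup>2" .
    fix t
    define s where "s = 2 ^ i * t + j"
    have m: "2 ^ (2 * i + 1) * t + (2 ^ i + 2 ^ (i + 1) * j) = 2 ^ i * (2 * s + 1)"
    proof -
      have "(2::nat) ^ (2 * i + 1) = 2 * (2 ^ i * 2 ^ i)" by (simp add: power_even_eq power2_eq_square)
      moreover have "(2::nat) ^ (i + 1) = 2 * 2 ^ i" by simp
      ultimately show ?thesis unfolding s_def by (simp only:) (simp add: algebra_simps)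
    qed
    have "2 ^ i * (2 * s + 1) div 2 ^ (i + 1) = s"
    proof -
      have "2 ^ i * (2 * s + 1) div (2 ^ i * 2) = (2 * s + 1) div 2"
        by (rule div_mult_mult1) simp
      then show ?thesis by (simp add: mult.commute)
    qed
    moreover have "s mod 2 ^ i = j" using j(2) by (simp add: s_def)
    ultimately show "label (2 ^ (2 * i + 1) * t + (2 ^ i + 2 ^ (i + 1) * j)) = k"
      unfolding m label_def val2_eq using j(1) by simp
  qed simp
qed

section \<open>The three bounds in product form\<close>

context short_lists
begin

lemma sum_bands:
  fixes f :: "nat \<Rightarrow> nat" and g :: "nat \<Rightarrow> bool list \<Rightarrow> nat"
  assumes "finite K"
  shows "(\<Sum>t \<in> K. \<Sum>p \<in> band (f t) B. g t p) =
    (\<Sum>p \<in> (\<Union>t \<in> K. band (f t) B). \<Sum>t \<in> {t \<in> K. p \<in> band (f t) B}. g t p)"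
proof -
  let ?S = "\<Union>t \<in> K. band (f t) B"
  have fin: "finite ?S" using assms finite_band by blast
  have "(\<Sum>t \<in> K. \<Sum>p \<in> band (f t) B. g t p) = (\<Sum>t \<in> K. \<Sum>p \<in> ?S. if p \<in> band (f t) B then g t p else 0)"
    by (intro sum.cong refl sum.mono_neutral_cong_left fin) auto
  also have "\<dots> = (\<Sum>p \<in> ?S. \<Sum>t \<in> K. if p \<in> band (f t) B then g t p else 0)" by (rule sum.swap)
  also have "\<dots> = (\<Sum>p \<in> ?S. \<Sum>t \<in> {t \<in> K. p \<in> band (f t) B}. g t p)"
    by (intro sum.cong refl sum.inter_filter[OF assms, symmetric])
  finally show ?thesis .
qed

text \<open>Each list element is counted at most \<open>B\<close> times, with \<open>lv \<le> 1 + 2 * (length p - m)\<close>; this gives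
  the factor \<open>(c + 1) ^ 2\<close>.\<close>

theorem random_bits_bound: "\<exists>A N. \<forall>n \<ge> N. n\<^sup>2 \<le> T n * 2 ^ r n * (c n + 1)\<^sup>2 * 2 ^ A"
proof -
  define P where "P e n k \<longleftrightarrow> T n * 2 ^ r n * (k + 1)\<^sup>2 * 2 ^ e < n\<^sup>2" for e n k
  define cs where "cs e n = length (filter (P e n) [0..<n]) - 1" for e n
  define wid where "wid e m = m div 64" for e m :: nat
  \<comment> \<open>There are \<open>2 ^ (m + d)\<close> programs of length \<open>m + d\<close>,
    and the weight \<open>2 ^ (- 2 * d)\<close> turns their total into a geometric series. It is
    \<open>O(2 ^ m)\<close> whatever the width, so \<open>wid\<close> may be as large as
    \<open>prices\<close> admits and need not follow \<open>cs\<close>.\<close>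
  define lam where "lam e m d = 2 * d" for e m d :: nat
  define act where "act e m n \<longleftrightarrow> P e n (cs e n) \<and> 1000 \<le> m \<and> 3 * e + cs e n \<le> m div 64" for e m n
  have ccs: "computable (\<lambda>q. cs (f q) (g q))" if "computable f" "computable g" for f g :: "'z::cod \<Rightarrow> _"
  proof -
    have "computable (\<lambda>q. cs (fst q) (snd q))"
      unfolding cs_def P_def by (intro comp_intros)
    then show ?thesis using that by (rule computable_comp2)
  qed
  have cact: "computable (\<lambda>q. act (fst q) (fst (snd q)) (snd (snd q)))"
    unfolding act_def P_def by (intro comp_intros ccs)
  have cwid: "computable (\<lambda>q. wid (fst q) (snd q))" unfolding wid_def by (intro comp_intros)
  have clam: "computable (\<lambda>q. lam (fst q) (fst (snd q)) (snd (snd q)))"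
    unfolding lam_def by (intro comp_intros)
  have lam_sum: "(\<Sum>d \<in> {1..wid e m}. 2 ^ (m + d) * 2 ^ (2 * wid e m + 1 - lam e m d))
      \<le> (2::nat) ^ (m + 1 + (2 * wid e m + 1))" for e m
  proof -
    define w where "w = wid e m"
    have "(\<Sum>d \<in> {1..w}. (2::nat) ^ (m + d) * 2 ^ (2 * w + 1 - lam e m d)) =
        (\<Sum>d \<in> {1..w}. 2 ^ (m + w + 1) * 2 ^ (w - d))"
    proof (intro sum.cong refl)
      fix d
      assume "d \<in> {1..w}"
      then have "m + d + (2 * w + 1 - lam e m d) = m + w + 1 + (w - d)" by (auto simp: lam_def)
      then show "(2::nat) ^ (m + d) * 2 ^ (2 * w + 1 - lam e m d) = 2 ^ (m + w + 1) * 2 ^ (w - d)"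
        by (metis power_add)
    qed
    also have "\<dots> \<le> 2 ^ (m + w + 1) * 2 ^ w"
      unfolding sum_distrib_left[symmetric] by (intro mult_le_mono2 less_imp_le power_half_sum)
    also have "\<dots> \<le> 2 ^ (m + 1 + (2 * w + 1))"
      unfolding power_add[symmetric] by (intro power_increasing) auto
    finally show ?thesis unfolding w_def .
  qed
  obtain a where a: "\<And>e n. a \<le> e \<Longrightarrow> 1 \<le> n \<Longrightarrow> c n \<le> cs e n \<Longrightarrow>
    \<exists>x. length x = n \<and> (\<forall>m. 2 * m \<le> n \<longrightarrow> n \<le> 4 * m \<longrightarrow> act e m n \<longrightarrow>
      m < 8 * (\<Sum>p \<in> band m (3 * e + cs e n). lv x (lam e m (length p - m)) p))"
  proof (rule exists_heavy[OF ccs[OF computable_fst[OF computable_id] computable_snd[OF computable_id]]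
        cwid clam cact _ lam_sum])
    show "lam e m d \<le> 2 * wid e m" if "d \<le> wid e m" for e m d using that by (simp add: lam_def)
    show "1000 \<le> m \<and> 64 * wid e m \<le> m \<and> 3 * e + cs e n \<le> wid e m" if "act e m n" for e m n
      using that by (auto simp: act_def wid_def)
  qed (rule that; assumption)
  define E where "E = a + 15"
  \<comment> \<open>An even exponent makes \<open>2 ^ e\<close> a square, so that a root can be
    taken in \<open>sq\<close>.\<close>
  define e where "e = 2 * E"
  have e_big: "256 * (3 * e + 1)\<^sup>2 \<le> 2 ^ e"
  proof -
    have "30 \<le> e" by (simp add: e_def E_def)
    then show ?thesis
    proof (induction e rule: dec_induct)
      case (step e)
      have "(3 * Suc e + 1)\<^sup>2 \<le> 2 * (3 * e + 1)\<^sup>2"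
      proof -
        have "(3 * Suc e + 1)\<^sup>2 = 9 * (e * e) + 24 * e + 16" "2 * (3 * e + 1)\<^sup>2 = 18 * (e * e) + 12 * e + 2"
          by (simp_all add: power2_eq_square algebra_simps)
        moreover have "30 * e \<le> e * e" using step(1) by (rule mult_le_mono1)
        ultimately show ?thesis using step(1) by linarith
      qed
      then show ?case using step by simp
    qed simp
  qed
  have "n\<^sup>2 \<le> T n * 2 ^ r n * (c n + 1)\<^sup>2 * 2 ^ e" if N: "4000 + 1536 * e \<le> n" for n
  proof (rule ccontr)
    assume "\<not> n\<^sup>2 \<le> T n * 2 ^ r n * (c n + 1)\<^sup>2 * 2 ^ e"
    then have Pc: "P e n (c n)" by (simp add: P_def)
    have anti: "P e n j" if "P e n k" "j \<le> k" for j k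
    proof -
      have "T n * 2 ^ r n * (j + 1)\<^sup>2 * 2 ^ e \<le> T n * 2 ^ r n * (k + 1)\<^sup>2 * 2 ^ e"
        using that(2) by (intro mult_le_mono power_mono) auto
      then show ?thesis using that(1) unfolding P_def by linarith
    qed
    have sq: "(k + 1) * 2 ^ E < n" if "P e n k" for k
    proof -
      have "1 * ((k + 1)\<^sup>2 * 2 ^ e) \<le> (T n * 2 ^ r n) * ((k + 1)\<^sup>2 * 2 ^ e)"
        using T_pos[of n] by (intro mult_le_mono1) (simp add: Suc_le_eq)
      then have "(k + 1)\<^sup>2 * 2 ^ e \<le> T n * 2 ^ r n * (k + 1)\<^sup>2 * 2 ^ e" by (simp only: mult_1 mult_ac)
      then have "(k + 1)\<^sup>2 * 2 ^ e < n\<^sup>2" using that unfolding P_def by linarith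
      moreover have "((k + 1) * 2 ^ E)\<^sup>2 = (k + 1)\<^sup>2 * 2 ^ e"
        unfolding e_def mult.commute[of 2 E] power_mult power_mult_distrib by (rule refl)
      ultimately have "((k + 1) * 2 ^ E)\<^sup>2 < n\<^sup>2" by (simp only:)
      then show ?thesis by (rule power_less_imp_less_base) simp
    qed
    have "c n * 1 \<le> (c n + 1) * 2 ^ E" by (intro mult_le_mono) auto
    then have "c n < n" using sq[OF Pc] by linarith
    note cs = last_true[of "P e n", OF anti Pc this, folded cs_def]
    define k where "k = cs e n"
    have Pk: "P e n k" and ck: "c n \<le> cs e n" using cs by (auto simp: k_def)
    have "(k + 1) * 2 ^ 15 \<le> (k + 1) * 2 ^ E"
      by (intro mult_le_mono2 power_increasing) (auto simp: E_def)
    then have "32768 * k + 32768 < n" using sq[OF Pk] by simp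
    then have kn: "512 * k \<le> n" by linarith
    define B where "B = 3 * e + k"
    obtain x where x: "length x = n" "\<And>m. 2 * m \<le> n \<Longrightarrow> n \<le> 4 * m \<Longrightarrow> act e m n \<Longrightarrow>
        m < 8 * (\<Sum>p \<in> band m B. lv x (lam e m (length p - m)) p)"
      using a[OF _ _ ck] N unfolding B_def k_def by (auto simp: e_def E_def)
    define I where "I = {m. 2 * m \<le> n \<and> n \<le> 4 * m}"
    have finI: "finite I" by (rule finite_subset[of _ "{..n}"]) (auto simp: I_def)
    let ?S = "\<Union>m \<in> I. band m B"
    have finS: "finite ?S" using finI finite_band by blast
    have "(\<Sum>m \<in> I. m) \<le> (\<Sum>m \<in> I. 8 * (\<Sum>p \<in> band m B. lv x (lam e m (length p - m)) p))"
    proof (rule sum_mono)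
      fix m
      assume "m \<in> I"
      then have m: "2 * m \<le> n" "n \<le> 4 * m" by (auto simp: I_def)
      have "192 * e + 64 * k \<le> m" using N kn m by linarith
      then have "3 * e + k \<le> m div 64" by linarith
      then have "act e m n" unfolding act_def using Pk N m by (simp add: k_def)
      from x(2)[OF m this] show "m \<le> 8 * (\<Sum>p \<in> band m B. lv x (lam e m (length p - m)) p)"
        by (rule less_imp_le)
    qed
    also have "\<dots> = 8 * (\<Sum>m \<in> I. \<Sum>p \<in> band m B. lv x (lam e m (length p - m)) p)"
      by (rule sum_distrib_left[symmetric])
    also have "(\<Sum>m \<in> I. \<Sum>p \<in> band m B. lv x (lam e m (length p - m)) p) =
        (\<Sum>p \<in> ?S. \<Sum>m \<in> {m \<in> I. p \<in> band m B}. lv x (lam e m (length p - m)) p)"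
      by (rule sum_bands[OF finI])
    also have "\<dots> \<le> (\<Sum>p \<in> ?S. if freq x p = 0 then 0 else (B + 1)\<^sup>2)"
    proof (rule sum_mono)
      fix p
      let ?I = "{m \<in> I. p \<in> band m B}"
      show "(\<Sum>m \<in> ?I. lv x (lam e m (length p - m)) p) \<le> (if freq x p = 0 then 0 else (B + 1)\<^sup>2)"
      proof (cases "freq x p = 0")
        case True
        then show ?thesis by (simp add: lv_0)
      next
        case False
        have inj: "inj_on (\<lambda>m. length p - m) ?I" by (rule inj_onI) (auto simp: band_def)
        have "(\<Sum>m \<in> ?I. lv x (lam e m (length p - m)) p) \<le> (\<Sum>m \<in> ?I. 1 + 2 * (length p - m))"
          using lv_le by (intro sum_mono) (simp add: lam_def)
        also have "\<dots> = (\<Sum>d \<in> (\<lambda>m. length p - m) ` ?I. 1 + 2 * d)"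
          by (simp add: sum.reindex[OF inj])
        also have "\<dots> \<le> (\<Sum>d \<in> {1..B}. 1 + 2 * d)"
          by (rule sum_mono2) (auto simp: band_def)
        \<comment> \<open>A sum of consecutive odd numbers, short of \<open>(B + 1) ^ 2\<close> by
          the missing first term 1.\<close>
        also have "\<dots> \<le> (B + 1)\<^sup>2" by (induction B) (auto simp: power2_eq_square)
        finally show ?thesis using False by simp
      qed
    qed
    also have "\<dots> = card {p \<in> ?S. freq x p \<noteq> 0} * (B + 1)\<^sup>2"
    proof -
      have "(\<Sum>p \<in> ?S. if freq x p = 0 then 0 else (B + 1)\<^sup>2) = (\<Sum>p \<in> {p \<in> ?S. freq x p \<noteq> 0}. (B + 1)\<^sup>2)"
        using finS by (intro sum.mono_neutral_cong_right) auto
      then show ?thesis by simp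
    qed
    also have "\<dots> \<le> T n * 2 ^ r n * (B + 1)\<^sup>2"
    proof (rule mult_le_mono1)
      have "finite {p \<in> ?S. freq x p \<noteq> 0}" by (rule finite_subset[OF _ finS]) blast
      then show "card {p \<in> ?S. freq x p \<noteq> 0} \<le> T n * 2 ^ r n"
        unfolding x(1)[symmetric] by (rule card_support_le) blast
    qed
    finally have up: "(\<Sum>m \<in> I. m) \<le> 8 * (T n * 2 ^ r n * (B + 1)\<^sup>2)" by simp
    \<comment> \<open>About \<open>n / 4\<close> values of \<open>m\<close> occur, each at least
      \<open>n / 4\<close>; 32 in place of 16 absorbs the rounding.\<close>
    have low: "n\<^sup>2 \<le> 32 * (\<Sum>m \<in> I. m)"
    proof -
      have "{n div 4 + 1..n div 2} \<subseteq> I" by (auto simp: I_def)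
      then have "card {n div 4 + 1..n div 2} \<le> card I" by (rule card_mono[OF finI])
      then have "n div 2 - n div 4 \<le> card I" by simp
      then have cI: "n - 2 \<le> 4 * card I" by linarith
      have "(n - 2) * n \<le> 4 * card I * n" using cI by (rule mult_le_mono1)
      also have "\<dots> = 4 * (\<Sum>m \<in> I. n)" by simp
      also have "\<dots> \<le> 4 * (\<Sum>m \<in> I. 4 * m)" by (intro mult_le_mono2 sum_mono) (auto simp: I_def)
      finally have "(n - 2) * n \<le> 16 * (\<Sum>m \<in> I. m)" by (simp add: sum_distrib_left)
      moreover have "n\<^sup>2 \<le> 2 * ((n - 2) * n)"
      proof -
        have "n * n \<le> (2 * (n - 2)) * n" using N by (intro mult_le_mono1) linarith
        then show ?thesis by (simp add: power2_eq_square)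
      qed
      ultimately show ?thesis by linarith
    qed
    have "(B + 1)\<^sup>2 \<le> ((3 * e + 1) * (k + 1))\<^sup>2" by (intro power_mono) (auto simp: B_def)
    then have "256 * (T n * 2 ^ r n * (B + 1)\<^sup>2) \<le> 256 * (T n * 2 ^ r n * ((3 * e + 1) * (k + 1))\<^sup>2)"
      by (intro mult_le_mono2)
    also have "\<dots> = (T n * 2 ^ r n * (k + 1)\<^sup>2) * (256 * (3 * e + 1)\<^sup>2)"
      by (simp only: power_mult_distrib mult_ac)
    also have "\<dots> \<le> (T n * 2 ^ r n * (k + 1)\<^sup>2) * 2 ^ e" using e_big by (rule mult_le_mono2)
    also have "\<dots> < n\<^sup>2" using Pk by (simp add: P_def)
    finally show False using up low by linarith
  qed
  then show ?thesis by blast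
qed

text \<open>The width of the band for \<open>m\<close> has to be guessed from \<open>m\<close> alone; only the \<open>m\<close> whose label is the
  right guess are used, which costs the factor \<open>(c + 1) ^ 2\<close>.\<close>

theorem closeness_bound: "\<exists>A N. \<forall>n \<ge> N. n\<^sup>2 \<le> T n * 2 ^ c n * (c n + 1)\<^sup>2 * 2 ^ A"
proof -
  \<comment> \<open>Of the exponent \<open>5 * e\<close>, a part \<open>3 * e\<close> pays for
    \<open>2 ^ W\<close> with \<open>W = 3 * e + k\<close>, and \<open>2 * e\<close> pays for the
    remaining constants.\<close>
  define P where "P e n k \<longleftrightarrow> T n * 2 ^ k * (k + 1)\<^sup>2 * 2 ^ (5 * e) < n\<^sup>2" for e n k
  define cs where "cs e n = length (filter (P e n) [0..<n]) - 1" for e n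
  define wid where "wid e m = 3 * e + label m" for e m :: nat
  \<comment> \<open>One cutoff for the whole band bounds levels by frequencies uniformly, with the
    factor \<open>2 ^ (1 + W)\<close>. The longest programs now dominate the total weight, so the
    band may be no wider than the cutoff; hence the width has to be guessed.\<close>
  define lam where "lam e m d = 3 * e + label m" for e m d :: nat
  define act where "act e m n \<longleftrightarrow> P e n (cs e n) \<and> cs e n = label m \<and> 1000 \<le> m \<and>
    64 * (3 * e + label m) \<le> m" for e m n
  have ccs: "computable (\<lambda>q. cs (f q) (g q))" if "computable f" "computable g" for f g :: "'z::cod \<Rightarrow> _"
  proof -
    have "computable (\<lambda>q. cs (fst q) (snd q))"
      unfolding cs_def P_def by (intro comp_intros)
    then show ?thesis using that by (rule computable_comp2)
  qed
  have cact: "computable (\<lambda>q. act (fst q) (fst (snd q)) (snd (snd q)))"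
    unfolding act_def P_def by (intro comp_intros ccs)
  have cwid: "computable (\<lambda>q. wid (fst q) (snd q))" unfolding wid_def by (intro comp_intros)
  have clam: "computable (\<lambda>q. lam (fst q) (fst (snd q)) (snd (snd q)))"
    unfolding lam_def by (intro comp_intros)
  have lam_sum: "(\<Sum>d \<in> {1..wid e m}. 2 ^ (m + d) * 2 ^ (2 * wid e m + 1 - lam e m d))
      \<le> (2::nat) ^ (m + 1 + (2 * wid e m + 1))" for e m
  proof -
    define w where "w = wid e m"
    have "(\<Sum>d \<in> {1..w}. (2::nat) ^ (m + d) * 2 ^ (2 * w + 1 - lam e m d)) =
        (\<Sum>d \<in> {1..w}. 2 ^ (m + w + 1) * 2 ^ d)"
    proof (intro sum.cong refl)
      fix d
      have "m + d + (2 * w + 1 - lam e m d) = m + w + 1 + d" by (auto simp: lam_def wid_def w_def)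
      then show "(2::nat) ^ (m + d) * 2 ^ (2 * w + 1 - lam e m d) = 2 ^ (m + w + 1) * 2 ^ d"
        by (metis power_add)
    qed
    also have "\<dots> \<le> 2 ^ (m + w + 1) * 2 ^ (w + 1)"
      unfolding sum_distrib_left[symmetric] by (intro mult_le_mono2 less_imp_le power_sum)
    also have "\<dots> \<le> 2 ^ (m + 1 + (2 * w + 1))"
      unfolding power_add[symmetric] by (intro power_increasing) auto
    finally show ?thesis unfolding w_def .
  qed
  obtain a where a: "\<And>e n. a \<le> e \<Longrightarrow> 1 \<le> n \<Longrightarrow> c n \<le> cs e n \<Longrightarrow>
    \<exists>x. length x = n \<and> (\<forall>m. 2 * m \<le> n \<longrightarrow> n \<le> 4 * m \<longrightarrow> act e m n \<longrightarrow>
      m < 8 * (\<Sum>p \<in> band m (3 * e + cs e n). lv x (lam e m (length p - m)) p))"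
  proof (rule exists_heavy[OF ccs[OF computable_fst[OF computable_id] computable_snd[OF computable_id]]
        cwid clam cact _ lam_sum])
    show "lam e m d \<le> 2 * wid e m" if "d \<le> wid e m" for e m d by (simp add: lam_def wid_def)
    show "1000 \<le> m \<and> 64 * wid e m \<le> m \<and> 3 * e + cs e n \<le> wid e m" if "act e m n" for e m n
      using that by (auto simp: act_def wid_def)
  qed (rule that; assumption)
  define e where "e = a + 11"
  have e_big: "512 * (3 * e + 3) \<le> (2::nat) ^ (2 * e)"
  proof -
    have "3 * e + 3 \<le> 4 * 2 ^ e" using less_exp[of e] by linarith
    then have "512 * (3 * e + 3) \<le> 2 ^ (11 + e)" by (simp add: power_add)
    also have "\<dots> \<le> 2 ^ (2 * e)" by (intro power_increasing) (auto simp: e_def)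
    finally show ?thesis .
  qed
  have sq_le: "(k + 1)\<^sup>2 \<le> 4 * (2::nat) ^ k" for k
  proof (induction k rule: less_induct)
    case (less k)
    consider "k = 0" | "k = 1" | "k = 2" | "k \<ge> 3" by linarith
    then show ?case
    proof cases
      case 4
      then obtain j where j: "k = Suc j" "2 \<le> j" by (cases k) auto
      have "(k + 1)\<^sup>2 = j * j + 4 * j + 4" "2 * (j + 1)\<^sup>2 = 2 * (j * j) + 4 * j + 2"
        unfolding j(1) by (simp_all add: power2_eq_square algebra_simps)
      moreover have "2 * j \<le> j * j" using j(2) by (rule mult_le_mono1)
      ultimately have "(k + 1)\<^sup>2 \<le> 2 * (j + 1)\<^sup>2" using j(2) by linarith
      with less[of j] j show ?thesis by simp
    qed (simp_all add: power2_eq_square)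
  qed
  have "n\<^sup>2 \<le> T n * 2 ^ c n * (c n + 1)\<^sup>2 * 2 ^ (5 * e)" if N: "4000 + 1536 * e \<le> n" for n
  proof (rule ccontr)
    assume "\<not> n\<^sup>2 \<le> T n * 2 ^ c n * (c n + 1)\<^sup>2 * 2 ^ (5 * e)"
    then have Pc: "P e n (c n)" by (simp add: P_def)
    have anti: "P e n j" if "P e n k" "j \<le> k" for j k
    proof -
      have "T n * 2 ^ j * (j + 1)\<^sup>2 * 2 ^ (5 * e) \<le> T n * 2 ^ k * (k + 1)\<^sup>2 * 2 ^ (5 * e)"
        using that(2) by (intro mult_le_mono power_mono power_increasing) auto
      then show ?thesis using that(1) unfolding P_def by linarith
    qed
    \<comment> \<open>Since \<open>(k + 1) ^ 2 <= 4 * 2 ^ k\<close>, failure of the claim bounds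
      \<open>(k + 1) ^ 4\<close> by a small multiple of \<open>n ^ 2\<close>. So the period
      \<open>M <= 2 * (k + 1) ^ 2\<close> of the label is small compared with
      \<open>n\<close>.\<close>
    have sq: "(k + 1)\<^sup>2 * 2 ^ (2 * e) < 2 * n" if "P e n k" for k
    proof -
      have "((k + 1)\<^sup>2 * 2 ^ (2 * e))\<^sup>2 = (k + 1)\<^sup>2 * ((k + 1)\<^sup>2 * 2 ^ (4 * e))"
      proof -
        have X: "((2::nat) ^ (2 * e))\<^sup>2 = 2 ^ (4 * e)" by (simp flip: power_mult)
        show ?thesis
          unfolding X[symmetric] power_mult_distrib[of "(k + 1)\<^sup>2"] power2_eq_square[of "(k + 1)\<^sup>2"]
            mult.assoc by (rule refl)
      qed
      also have "\<dots> \<le> (4 * 2 ^ k) * ((k + 1)\<^sup>2 * 2 ^ (5 * e))"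
        using sq_le by (intro mult_le_mono power_increasing) auto
      also have "\<dots> \<le> T n * ((4 * 2 ^ k) * ((k + 1)\<^sup>2 * 2 ^ (5 * e)))"
        using T_pos[of n] by (simp add: Suc_le_eq)
      also have "\<dots> = 4 * (T n * 2 ^ k * (k + 1)\<^sup>2 * 2 ^ (5 * e))" by (simp only: mult_ac)
      also have "\<dots> < 4 * n\<^sup>2" using that by (simp add: P_def)
      also have "4 * n\<^sup>2 = (2 * n)\<^sup>2" by (simp add: power_mult_distrib)
      finally show ?thesis by (rule power_less_imp_less_base) simp
    qed
    have e20: "(2::nat) ^ 20 \<le> 2 ^ (2 * e)" by (intro power_increasing) (auto simp: e_def)
    have small: "524288 * (k + 1)\<^sup>2 < n" if "P e n k" for k
    proof -
      have "(k + 1)\<^sup>2 * 1048576 \<le> (k + 1)\<^sup>2 * 2 ^ (2 * e)"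
        using e20 by (intro mult_le_mono2) simp
      then show ?thesis using sq[OF that] by linarith
    qed
    have le_sq: "k + 1 \<le> (k + 1)\<^sup>2" for k :: nat by (simp add: power2_eq_square)
    have "c n < n" using small[OF Pc] le_sq[of "c n"] by linarith
    note cs = last_true[of "P e n", OF anti Pc this, folded cs_def]
    define k where "k = cs e n"
    have Pk: "P e n k" and ck: "c n \<le> cs e n" using cs by (auto simp: k_def)
    define W where "W = 3 * e + k"
    obtain x where x: "length x = n" "\<And>m. 2 * m \<le> n \<Longrightarrow> n \<le> 4 * m \<Longrightarrow> act e m n \<Longrightarrow>
        m < 8 * (\<Sum>p \<in> band m W. lv x (lam e m (length p - m)) p)"
      using a[OF _ _ ck] N unfolding W_def k_def by (auto simp: e_def)
    obtain M \<rho> :: nat where M: "M > 0" "\<rho> < M" "M \<le> 2 * (k + 1)\<^sup>2" "\<And>t. label (M * t + \<rho>) = k"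
      by (rule label_progression) (rule that; assumption)
    define K where "K = {t. n \<le> 4 * (M * t + \<rho>) \<and> 2 * (M * t + \<rho>) \<le> n}"
    have finK: "finite K"
    proof (rule finite_subset)
      show "K \<subseteq> {..n}"
      proof
        fix t
        assume "t \<in> K"
        then have "M * t \<le> n" by (auto simp: K_def)
        moreover have "1 * t \<le> M * t" using M(1) by (intro mult_le_mono1) simp
        ultimately show "t \<in> {..n}" unfolding atMost_iff mult_1 by (rule le_trans[rotated])
      qed
    qed simp
    let ?f = "\<lambda>t. M * t + \<rho>"
    let ?S = "\<Union>t \<in> K. band (?f t) W"
    have finS: "finite ?S" using finK finite_band by blast
    have heavy: "?f t \<le> 8 * (\<Sum>p \<in> band (?f t) W. lv x W p)" if "t \<in> K" for t
    proof -
      have t: "2 * ?f t \<le> n" "n \<le> 4 * ?f t" using that by (auto simp: K_def)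
      have "512 * k \<le> 524288 * (k + 1)\<^sup>2"
        using le_sq[of k] by (intro mult_le_mono) linarith+
      then have kn: "512 * k \<le> n" using small[OF Pk] by linarith
      define m where "m = ?f t"
      have "192 * e + 64 * k \<le> m" using N kn t unfolding m_def[symmetric] by linarith
      then have "192 * e + 64 * k \<le> ?f t" by (simp only: m_def)
      then have "64 * (3 * e + k) \<le> ?f t" by simp
      then have "act e (?f t) n" unfolding act_def using Pk N t by (simp add: k_def M(4)[unfolded k_def])
      from x(2)[OF t this] show ?thesis by (simp add: lam_def M(4) W_def)
    qed
    have "(\<Sum>t \<in> K. ?f t) * 2 ^ r n \<le> (\<Sum>t \<in> K. 8 * (\<Sum>p \<in> band (?f t) W. lv x W p)) * 2 ^ r n"
      by (intro mult_le_mono1 sum_mono heavy)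
    also have "\<dots> = 8 * (\<Sum>t \<in> K. \<Sum>p \<in> band (?f t) W. lv x W p * 2 ^ r n)"
      by (simp add: sum_distrib_left sum_distrib_right mult.assoc)
    also have "\<dots> \<le> 8 * (\<Sum>t \<in> K. \<Sum>p \<in> band (?f t) W. freq x p * 2 ^ (1 + W))"
      using lv_le_freq[of x W] x(1) by (intro mult_le_mono2 sum_mono) simp
    also have "(\<Sum>t \<in> K. \<Sum>p \<in> band (?f t) W. freq x p * 2 ^ (1 + W)) =
        (\<Sum>p \<in> ?S. \<Sum>t \<in> {t \<in> K. p \<in> band (?f t) W}. freq x p * 2 ^ (1 + W))"
      by (rule sum_bands[OF finK])
    also have "\<dots> \<le> (\<Sum>p \<in> ?S. (W div M + 1) * (freq x p * 2 ^ (1 + W)))"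
    proof (rule sum_mono)
      fix p
      show "(\<Sum>t \<in> {t \<in> K. p \<in> band (?f t) W}. freq x p * 2 ^ (1 + W)) \<le>
          (W div M + 1) * (freq x p * 2 ^ (1 + W))"
        using progression_window[OF M(1), of K \<rho> "length p" W]
        by (simp only: band_def mem_Collect_eq sum_constant of_nat_id) (rule mult_le_mono1)
    qed
    also have "\<dots> = (W div M + 1) * 2 ^ (1 + W) * (\<Sum>p \<in> ?S. freq x p)"
      unfolding sum_distrib_left by (intro sum.cong refl) (simp only: mult_ac)
    also have "\<dots> \<le> (W div M + 1) * 2 ^ (1 + W) * (T n * 2 ^ r n)"
      using sum_freq_le[OF finS, of x] x(1) by (intro mult_le_mono2) simp
    finally have "(\<Sum>t \<in> K. ?f t) * 2 ^ r n \<le> (8 * ((W div M + 1) * 2 ^ (1 + W) * T n)) * 2 ^ r n"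
      by (simp only: mult_ac)
    then have up: "(\<Sum>t \<in> K. ?f t) \<le> 8 * ((W div M + 1) * 2 ^ (1 + W) * T n)" by simp
    have Mn: "100 * M \<le> n" using M(3) small[OF Pk] by linarith
    \<comment> \<open>The progression has about \<open>n / (4 * M)\<close> members in
      \<open>[n / 4, n / 2]\<close>; \<open>100 * M <= n\<close> covers the losses at both
      ends.\<close>
    have "n \<le> 8 * M * card K"
    proof -
      define t1 where "t1 = n div (4 * M) + 1"
      define t2 where "t2 = n div (2 * M)"
      have t1: "n < 4 * M * t1" "4 * M * t1 \<le> n + 4 * M"
      proof -
        have "4 * M * (n div (4 * M)) + n mod (4 * M) = n" by (rule mult_div_mod_eq)
        moreover have "n mod (4 * M) < 4 * M" using M(1) by (intro mod_less_divisor) simp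
        moreover have "4 * M * t1 = 4 * M * (n div (4 * M)) + 4 * M" by (simp add: t1_def)
        ultimately show "n < 4 * M * t1" "4 * M * t1 \<le> n + 4 * M" by linarith+
      qed
      have t2: "2 * M * t2 \<le> n" "n < 2 * M * t2 + 2 * M"
      proof -
        have "2 * M * t2 + n mod (2 * M) = n" unfolding t2_def by (rule mult_div_mod_eq)
        moreover have "n mod (2 * M) < 2 * M" using M(1) by (intro mod_less_divisor) simp
        ultimately show "2 * M * t2 \<le> n" "n < 2 * M * t2 + 2 * M" by linarith+
      qed
      have "{t1..<t2} \<subseteq> K"
      proof
        fix t
        assume t: "t \<in> {t1..<t2}"
        define p1 p p2 where "p1 = M * t1" and "p = M * t" and "p2 = M * t2"
        have "p1 \<le> p" using t by (auto simp: p1_def p_def)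
        moreover have "p + M \<le> p2" using mult_le_mono2[of "t + 1" t2 M] t by (simp add: p_def p2_def)
        moreover have "n < 4 * p1" "2 * p2 \<le> n" using t1(1) t2(1) by (simp_all add: p1_def p2_def mult.assoc)
        ultimately have "n \<le> 4 * p + 4 * \<rho>" "2 * p + 2 * \<rho> \<le> n" using M(2) by linarith+
        then show "t \<in> K" by (simp add: K_def p_def)
      qed
      then have "t2 - t1 \<le> card K" using card_mono[OF finK, of "{t1..<t2}"] by simp
      then have "4 * M * t2 \<le> 4 * M * (t1 + card K)" by (intro mult_le_mono2) linarith
      then have "4 * M * t2 \<le> 4 * M * t1 + 4 * M * card K" by (simp only: distrib_left)
      then show ?thesis using t1(2) t2(2) Mn by linarith
    qed
    then have "n * n \<le> 8 * M * card K * n" by (rule mult_le_mono1)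
    also have "\<dots> = 8 * M * (\<Sum>t \<in> K. n)" by simp
    also have "\<dots> \<le> 8 * M * (\<Sum>t \<in> K. 4 * ?f t)"
      by (intro mult_le_mono2 sum_mono) (auto simp: K_def)
    also have "\<dots> = 32 * M * (\<Sum>t \<in> K. ?f t)" by (simp add: sum_distrib_left mult_ac)
    also have "\<dots> \<le> 32 * M * (8 * ((W div M + 1) * 2 ^ (1 + W) * T n))"
      using up by (rule mult_le_mono2)
    also have "\<dots> = 512 * (M * (W div M + 1)) * (2 ^ W * T n)" by (simp add: algebra_simps)
    also have "\<dots> \<le> 512 * ((3 * e + 3) * (k + 1)\<^sup>2) * (2 ^ W * T n)"
    proof (intro mult_le_mono1 mult_le_mono2)
      \<comment> \<open>The sparsity \<open>M\<close> of the bands is compensated by the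
        multiplicity \<open>W div M + 1\<close>, except for a summand \<open>M\<close>; this is
        where \<open>(k + 1) ^ 2\<close> comes from.\<close>
      have "M * (W div M + 1) \<le> W + M" using M(1) by (simp add: algebra_simps)
      also have "\<dots> \<le> 3 * e * 1 + (k + 1)\<^sup>2 + 2 * (k + 1)\<^sup>2" using le_sq[of k] M(3) by (simp add: W_def)
      also have "\<dots> \<le> 3 * e * (k + 1)\<^sup>2 + (k + 1)\<^sup>2 + 2 * (k + 1)\<^sup>2"
        by (intro add_mono mult_le_mono2 order_refl) simp
      also have "\<dots> = (3 * e + 3) * (k + 1)\<^sup>2" by (simp only: distrib_right)
      finally show "M * (W div M + 1) \<le> (3 * e + 3) * (k + 1)\<^sup>2" .
    qed
    also have "\<dots> = (T n * 2 ^ k * (k + 1)\<^sup>2) * ((512 * (3 * e + 3)) * 2 ^ (3 * e))"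
      by (simp only: W_def power_add mult_ac)
    also have "\<dots> \<le> (T n * 2 ^ k * (k + 1)\<^sup>2) * (2 ^ (2 * e) * 2 ^ (3 * e))"
      using e_big by (intro mult_le_mono2 mult_le_mono1)
    also have "(2::nat) ^ (2 * e) * 2 ^ (3 * e) = 2 ^ (5 * e)" by (simp flip: power_add)
    also have "T n * 2 ^ k * (k + 1)\<^sup>2 * 2 ^ (5 * e) < n\<^sup>2" using Pk by (simp add: P_def)
    finally show False by (simp add: power2_eq_square)
  qed
  then show ?thesis by blast
qed

theorem list_size_bound: "\<exists>A. \<forall>n \<ge> 1. n \<le> T n * (c n + 1) * 2 ^ A"
proof -
  define P where "P e n k \<longleftrightarrow> T n * (k + 1) * 2 ^ e < n" for e n k
  define cs where "cs e n = length (filter (P e n) [0..<n]) - 1" for e n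
  have ccs: "computable (\<lambda>q. cs (f q) (g q))" if "computable f" "computable g" for f g :: "'z::cod \<Rightarrow> _"
  proof -
    have "computable (\<lambda>q. cs (fst q) (snd q))"
      unfolding cs_def P_def by (intro comp_intros)
    then show ?thesis using that by (rule computable_comp2)
  qed
  define hits where "hits m w x = length (filter (\<lambda>\<rho>. \<exists>p \<in> set (lst x \<rho>). m < length p \<and> length p \<le> m + w)
     (words (r (length x))))" for m w x
  define cand where "cand em x \<longleftrightarrow> 2 * snd em \<le> length x \<and> length x \<le> 4 * snd em \<and>
     2 * hits (snd em) (3 * fst em + cs (fst em) (length x)) x < 2 ^ r (length x)" for em x
  have ccand: "computable (\<lambda>q. cand (fst q) (snd q))"
    unfolding cand_def hits_def by (intro comp_intros ccs)
  have cand_len: "length x \<le> 4 * m" if "cand (e, m) x" for e m x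
    using that by (simp add: cand_def)
  obtain a where a: "\<And>e m x. a \<le> e \<Longrightarrow>
    card {x. cand (e, m) x \<and> served U lst (r (length x)) m (m + 3 * e + cs e (length x)) x} + 4 * m + 1
      \<le> 2 ^ (m + e) \<Longrightarrow>
    cand (e, m) x \<Longrightarrow> c (length x) \<le> cs e (length x) \<Longrightarrow>
    served U lst (r (length x)) m (m + 3 * e + cs e (length x)) x"
    by (rule serve_all[OF U r lst half ccs[OF computable_fst[OF computable_id] computable_snd[OF computable_id]]
        ccand]) (erule cand_len, rule that, assumption)
  \<comment> \<open>Without a program of length at most \<open>m\<close>, every list that serves
    \<open>x\<close> contains a program in the band, and a candidate has too few lists of this
    kind.\<close>
  have cheap: "\<exists>q. length q \<le> m \<and> tm_fun U q = Some x"
    if "cand (e, m) x" and s: "served U lst (r (length x)) m (m + 3 * e + cs e (length x)) x" for e m x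
  proof (rule ccontr)
    assume no: "\<not> (\<exists>q. length q \<le> m \<and> tm_fun U q = Some x)"
    let ?G = "{\<rho>. length \<rho> = r (length x) \<and> (\<exists>p \<in> set (lst x \<rho>).
      length p \<le> m + 3 * e + cs e (length x) \<and> tm_fun U p = Some x)}"
    have "2 ^ r (length x) \<le> 2 * card ?G" using s no unfolding served_def by blast
    also have "card ?G \<le> hits m (3 * e + cs e (length x)) x"
      unfolding hits_def count_words
    proof (rule card_mono)
      show "finite {w. length w = r (length x) \<and>
         (\<exists>p \<in> set (lst x w). m < length p \<and> length p \<le> m + (3 * e + cs e (length x)))}"
        by (rule finite_subset[OF _ finite_length_eq[of "r (length x)"]]) blast
      have "m < length p" if "tm_fun U p = Some x" for p using no that not_le by blast
      then show "?G \<subseteq> {w. length w = r (length x) \<and>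
         (\<exists>p \<in> set (lst x w). m < length p \<and> length p \<le> m + (3 * e + cs e (length x)))}"
        by (auto simp: add.assoc)
    qed
    finally show False using that(1) by (simp add: cand_def)
  qed
  \<comment> \<open>\<open>54 * 9 <= 2 ^ 9\<close>; the factor 54 is \<open>18 * 3\<close> from the
    final estimate.\<close>
  define e where "e = a + 9"
  have e_big: "54 * e \<le> 2 ^ e"
  proof -
    have "9 \<le> e" by (simp add: e_def)
    then show ?thesis by (induction e rule: dec_induct) auto
  qed
  have few: "card {x. cand (e, m) x \<and> served U lst (r (length x)) m (m + 3 * e + cs e (length x)) x} +
      4 * m + 1 \<le> 2 ^ (m + e)" for m
  proof -
    have "{x. cand (e, m) x \<and> served U lst (r (length x)) m (m + 3 * e + cs e (length x)) x} \<subseteq>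
        (\<lambda>q. the (tm_fun U q)) ` {q. length q \<le> m}"
      using cheap by force
    then have "card {x. cand (e, m) x \<and> served U lst (r (length x)) m (m + 3 * e + cs e (length x)) x} \<le>
        card {q :: bool list. length q \<le> m}"
      by (rule surj_card_le[OF finite_length_le])
    then have "card {x. cand (e, m) x \<and> served U lst (r (length x)) m (m + 3 * e + cs e (length x)) x} \<le>
        2 * 2 ^ m"
      using card_length_le[of m] by simp
    moreover have "4 * m + 1 \<le> 5 * 2 ^ m" using less_exp[of m] by linarith
    moreover have "(2::nat) ^ (m + 3) \<le> 2 ^ (m + e)" by (intro power_increasing) (auto simp: e_def)
    moreover have "(2::nat) ^ (m + 3) = 8 * 2 ^ m" by (simp add: power_add)
    ultimately show ?thesis by linarith
  qed
  have "n \<le> T n * (c n + 1) * 2 ^ e" if n: "1 \<le> n" for n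
  proof (rule ccontr)
    assume "\<not> n \<le> T n * (c n + 1) * 2 ^ e"
    then have Pc: "P e n (c n)" by (simp add: P_def)
    have anti: "P e n j" if "P e n k" "j \<le> k" for j k
    proof -
      have "T n * (j + 1) * 2 ^ e \<le> T n * (k + 1) * 2 ^ e"
        using that(2) by (intro mult_le_mono) auto
      then show ?thesis using that(1) unfolding P_def by linarith
    qed
    have "1 * (c n + 1) * 1 \<le> T n * (c n + 1) * 2 ^ e"
      using T_pos[of n] by (intro mult_le_mono) auto
    then have "c n + 1 \<le> T n * (c n + 1) * 2 ^ e" by (simp only: mult_1 mult_1_right)
    then have "c n < n" using Pc[unfolded P_def] le_less_trans by fastforce
    note cs = last_true[of "P e n", OF anti Pc this, folded cs_def]
    define k where "k = cs e n"
    have Pk: "P e n k" and ck: "c n \<le> cs e n" using cs by (auto simp: k_def)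
    define B where "B = 3 * e + k"
    have B0: "B > 0" by (simp add: B_def e_def)
    have "\<exists>x. length x = n \<and> n \<le> C U x"
    proof (rule ccontr)
      assume no: "\<nexists>x. length x = n \<and> n \<le> C U x"
      have "{x. length x = n} \<subseteq> (\<lambda>q. the (tm_fun U q)) ` {q. length q \<le> n - 1}"
      proof
        fix x :: "bool list"
        assume "x \<in> {x. length x = n}"
        then have "C U x < n" using no by (simp add: not_le[symmetric])
        moreover obtain q where "tm_fun U q = Some x" "length q = C U x"
          by (rule C_attained[OF U])
        ultimately show "x \<in> (\<lambda>q. the (tm_fun U q)) ` {q. length q \<le> n - 1}"
          by (intro image_eqI[of _ _ q]) auto
      qed
      then have "card {x :: bool list. length x = n} \<le> card {q :: bool list. length q \<le> n - 1}"
        by (rule surj_card_le[OF finite_length_le])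
      then show False using card_length_le[of "n - 1"] n by (simp add: card_length_eq)
    qed
    then obtain x where x: "length x = n" "n \<le> C U x" by blast
    \<comment> \<open>Otherwise \<open>x\<close> would be a candidate, hence served, hence have a
      program of length \<open>m <= n / 2\<close>, contrary to \<open>n <= C U x\<close>.\<close>
    have heavy: "2 ^ r n \<le> 2 * hits m B x" if m: "2 * m \<le> n" "n \<le> 4 * m" for m
    proof (rule ccontr)
      assume "\<not> 2 ^ r n \<le> 2 * hits m B x"
      then have cx: "cand (e, m) x" using m x(1) by (simp add: cand_def B_def k_def)
      then have "served U lst (r (length x)) m (m + 3 * e + cs e (length x)) x"
        using few ck x(1) by (intro a) (auto simp: e_def)
      from cheap[OF cx this] obtain q where "length q \<le> m" "tm_fun U q = Some x" by blast
      then show False using C_le[of U q x] x(2) m n by linarith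
    qed
    define lo where "lo = n div 4 + 1"
    \<comment> \<open>The number of adjacent bands of width \<open>B\<close> that fit between
      \<open>lo\<close> and \<open>n div 2\<close>.\<close>
    define J where "J = (n div 2 - lo) div B"
    let ?W = "{\<rho> :: bool list. length \<rho> = r n}"
    have "J * 2 ^ r n = (\<Sum>j<J. 2 ^ r n)" by simp
    also have "\<dots> \<le> (\<Sum>j<J. 2 * hits (lo + j * B) B x)"
    proof (rule sum_mono, rule heavy)
      fix j
      assume "j \<in> {..<J}"
      then have "j * B \<le> J * B" by (intro mult_le_mono1) simp
      also have "J * B \<le> n div 2 - lo" unfolding J_def by (rule div_times_less_eq_dividend)
      finally have jb: "j * B \<le> n div 2 - lo" .
      have "J \<noteq> 0" using \<open>j \<in> {..<J}\<close> by auto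
      then have "lo \<le> n div 2" by (auto simp: J_def intro: ccontr)
      with jb have "lo + j * B \<le> n div 2" by linarith
      then have "2 * (lo + j * B) \<le> 2 * (n div 2)" by (rule mult_le_mono2)
      then show "2 * (lo + j * B) \<le> n" by (rule le_trans) simp
      have "n \<le> 4 * lo" unfolding lo_def by presburger
      also have "\<dots> \<le> 4 * (lo + j * B)" by (intro mult_le_mono2) simp
      finally show "n \<le> 4 * (lo + j * B)" .
    qed
    also have "\<dots> = 2 * (\<Sum>j<J. card {\<rho> \<in> ?W. \<exists>p \<in> set (lst x \<rho>). p \<in> band (lo + j * B) B})"
      by (simp add: sum_distrib_left hits_def count_words band_def x(1))
    also have "(\<Sum>j<J. card {\<rho> \<in> ?W. \<exists>p \<in> set (lst x \<rho>). p \<in> band (lo + j * B) B}) =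
        (\<Sum>\<rho> \<in> ?W. card {j \<in> {..<J}. \<exists>p \<in> set (lst x \<rho>). p \<in> band (lo + j * B) B})"
      by (rule sum_multicount_gen[OF finite_lessThan finite_length_eq]) simp
    also have "\<dots> \<le> (\<Sum>\<rho> \<in> ?W. T n)"
    proof (rule sum_mono)
      fix \<rho> :: "bool list"
      assume "\<rho> \<in> ?W"
      then have T: "card (set (lst x \<rho>)) = T n" using len[of \<rho> x] x(1) distinct_card[OF dist] by simp
      \<comment> \<open>The bands are left-open and right-closed, so the 1 must be subtracted for
        the quotient to recover \<open>j\<close>. Thus each list element meets at most one
        band.\<close>
      have "{j \<in> {..<J}. \<exists>p \<in> set (lst x \<rho>). p \<in> band (lo + j * B) B} \<subseteq>
          (\<lambda>p. (length p - lo - 1) div B) ` set (lst x \<rho>)"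
      proof
        fix j
        assume "j \<in> {j \<in> {..<J}. \<exists>p \<in> set (lst x \<rho>). p \<in> band (lo + j * B) B}"
        then obtain p where p: "p \<in> set (lst x \<rho>)" "lo + j * B < length p" "length p \<le> lo + j * B + B"
          by (auto simp: band_def)
        define d where "d = length p - lo - 1 - j * B"
        have "length p - lo - 1 = j * B + d" "d < B" using p(2,3) by (auto simp: d_def)
        then have "(length p - lo - 1) div B = j" using B0 by simp
        with p(1) show "j \<in> (\<lambda>p. (length p - lo - 1) div B) ` set (lst x \<rho>)" by blast
      qed
      then have "card {j \<in> {..<J}. \<exists>p \<in> set (lst x \<rho>). p \<in> band (lo + j * B) B} \<le> card (set (lst x \<rho>))"
        by (intro surj_card_le) auto
      then show "card {j \<in> {..<J}. \<exists>p \<in> set (lst x \<rho>). p \<in> band (lo + j * B) B} \<le> T n" by (simp add: T)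
    qed
    also have "\<dots> = 2 ^ r n * T n" by (simp add: card_length_eq)
    finally have "J * 2 ^ r n \<le> (2 * T n) * 2 ^ r n" by simp
    then have J: "J \<le> 2 * T n" by simp
    have "n div 2 - lo < (J + 1) * B"
    proof -
      have "J * B + (n div 2 - lo) mod B = n div 2 - lo" unfolding J_def by (rule div_mult_mod_eq)
      moreover have "(n div 2 - lo) mod B < B" using B0 by (rule mod_less_divisor)
      moreover have "(J + 1) * B = J * B + B" by simp
      ultimately show ?thesis by linarith
    qed
    also have "\<dots> \<le> (3 * T n) * B" using J T_pos[of n] by (intro mult_le_mono1) linarith
    finally have 1: "n div 2 - lo < 3 * (T n * B)" by simp
    have 2: "1 \<le> T n * B" using B0 T_pos[of n] by (simp add: Suc_le_eq)
    have "n \<le> 18 * (T n * B)" using 1 2 unfolding lo_def by linarith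
    also have "\<dots> \<le> 18 * (T n * (3 * e * (k + 1)))"
    proof (intro mult_le_mono2)
      have "1 * k \<le> 3 * e * k" by (intro mult_le_mono1) (simp add: e_def)
      then show "B \<le> 3 * e * (k + 1)" by (simp add: B_def)
    qed
    also have "\<dots> = T n * (k + 1) * (54 * e)" by (simp add: algebra_simps)
    also have "\<dots> \<le> T n * (k + 1) * 2 ^ e" using e_big by (rule mult_le_mono2)
    also have "\<dots> < n" using Pk by (simp add: P_def)
    finally show False by simp
  qed
  then show ?thesis by blast
qed

end

section \<open>From products to logarithms\<close>

lemma bound_everywhere:
  fixes f :: "nat \<Rightarrow> nat"
  assumes "\<forall>n \<ge> N. n\<^sup>2 \<le> f n * 2 ^ A" and "\<And>n. 1 \<le> f n"
  shows "n\<^sup>2 \<le> f n * 2 ^ (A + N\<^sup>2)"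
proof (cases "N \<le> n")
  case True
  then have "n\<^sup>2 \<le> f n * 2 ^ A" using assms(1) by blast
  also have "\<dots> \<le> f n * 2 ^ (A + N\<^sup>2)" by (intro mult_le_mono2 power_increasing) auto
  finally show ?thesis .
next
  case False
  \<comment> \<open>Below \<open>N\<close> the factor \<open>2 ^ (N ^ 2)\<close> alone exceeds
    \<open>n ^ 2\<close>, because \<open>f\<close> is positive.\<close>
  then have "n\<^sup>2 \<le> N\<^sup>2" by (intro power_mono) auto
  also have "\<dots> \<le> 2 ^ N\<^sup>2" using less_exp[of "N\<^sup>2"] by (rule less_imp_le)
  also have "\<dots> \<le> 2 ^ (A + N\<^sup>2)" by (intro power_increasing) auto
  also have "\<dots> \<le> f n * 2 ^ (A + N\<^sup>2)" using assms(2)[of n] by simp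
  finally show ?thesis .
qed

theorem theorem5p1:
  fixes U F :: tm and T r c :: "nat \<Rightarrow> nat"
  assumes "standard U"
    and "list_approximates U F T r c"
  shows
    "(\<exists>A::real. \<forall>n\<ge>1. real (r n) \<ge>
        2 * log 2 (real n) - log 2 (real (T n)) - 2 * log 2 (real (max 1 (c n))) - A)
     \<and> ((\<forall>\<^sub>F n in sequentially. T n = n) \<and> (\<lambda>n. real (c n)) \<in> O(\<lambda>n. log 2 (real n))
        \<longrightarrow> (\<exists>g. g \<in> O(\<lambda>n. log 2 (log 2 (real n))) \<and>
              (\<forall>\<^sub>F n in sequentially. real (r n) \<ge> log 2 (real n) - g n)))
     \<and> (\<exists>A::real. \<forall>n\<ge>1. real n ^ 2 / real (T n) \<ge> 2 \<longrightarrow> real (c n) \<ge>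
        log 2 (real n ^ 2 / real (T n)) - 2 * log 2 (log 2 (real n ^ 2 / real (T n))) - A)
     \<and> ((\<lambda>n. real (T n)) \<in> O(\<lambda>n. real n)
        \<longrightarrow> (\<exists>A::real. \<forall>n\<ge>2. real (c n) \<ge>
              log 2 (real n) - 2 * log 2 (log 2 (real n)) - A))
     \<and> (\<lambda>n. real (T n)) \<in> \<Omega>(\<lambda>n. real n / (real (c n) + 1))"
proof -
  obtain lst :: "bool list \<Rightarrow> bool list \<Rightarrow> bool list list"
    where lst: "computable (\<lambda>q. lst (fst q) (snd q))"
    "\<And>x \<rho>. distinct (lst x \<rho>)"
    "\<And>x \<rho>. length \<rho> = r (length x) \<Longrightarrow> length (lst x \<rho>) = T (length x)"
    "\<And>x. 2 * card {\<rho>. length \<rho> = r (length x) \<and>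
      (\<exists>p \<in> set (lst x \<rho>). short_program U (c (length x)) p x)} \<ge> 2 ^ r (length x)"
    by (rule computable_lists[OF assms(2)]) (rule that; assumption)
  have r: "computable r" using assms(2) unfolding list_approximates_def by (blast intro: computable_of_tm)
  interpret short_lists U r c T lst
    by (rule short_lists.intro[OF assms(1) r lst(1,2)]) (erule lst(3), rule lst(4))
  have T1: "1 \<le> real (T n)" for n using T_pos[of n] by linarith
  obtain A where A: "\<And>n. n\<^sup>2 \<le> T n * 2 ^ r n * (c n + 1)\<^sup>2 * 2 ^ A"
  proof -
    from random_bits_bound obtain A N where "\<forall>n \<ge> N. n\<^sup>2 \<le> T n * 2 ^ r n * (c n + 1)\<^sup>2 * 2 ^ A" by blast
    from bound_everywhere[OF this] show ?thesis using T_pos by (intro that) (simp add: Suc_le_eq)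
  qed
  obtain B where B: "\<And>n. n\<^sup>2 \<le> T n * 2 ^ c n * (c n + 1)\<^sup>2 * 2 ^ B"
  proof -
    from closeness_bound obtain A N where "\<forall>n \<ge> N. n\<^sup>2 \<le> T n * 2 ^ c n * (c n + 1)\<^sup>2 * 2 ^ A" by blast
    from bound_everywhere[OF this] show ?thesis using T_pos by (intro that) (simp add: Suc_le_eq)
  qed
  obtain D where D: "\<And>n. 1 \<le> n \<Longrightarrow> n \<le> T n * (c n + 1) * 2 ^ D"
    using list_size_bound by blast
  have log_bound: "2 * log 2 (real n) \<le> log 2 (real (T n)) + real s + 2 * log 2 (real (c n + 1)) + real A"
    if "1 \<le> n" "n\<^sup>2 \<le> T n * 2 ^ s * (c n + 1)\<^sup>2 * 2 ^ A" for n s A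
  proof -
    have "real (n\<^sup>2) \<le> real (T n * 2 ^ s * (c n + 1)\<^sup>2 * 2 ^ A)" using that(2) by (simp only: of_nat_le_iff)
    then have le: "real n ^ 2 \<le> real (T n) * 2 ^ s * real (c n + 1) ^ 2 * 2 ^ A" by simp
    have pos: "real n > 0" "real (T n) > 0" "real (c n + 1) > 0" using that(1) T1[of n] by auto
    have "log 2 (real n ^ 2) \<le> log 2 (real (T n) * 2 ^ s * real (c n + 1) ^ 2 * 2 ^ A)"
      using le pos by (subst log_le_cancel_iff) auto
    moreover have "log 2 (real n ^ 2) = 2 * log 2 (real n)"
      using log_nat_power[OF less_imp_le[OF pos(1)], of 2 2] by simp
    moreover have "log 2 (real (T n) * 2 ^ s * real (c n + 1) ^ 2 * 2 ^ A) =
        log 2 (real (T n)) + log 2 (2 ^ s) + log 2 (real (c n + 1) ^ 2) + log 2 (2 ^ A)"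
      using pos by (simp add: log_mult del: of_nat_add of_nat_Suc)
    moreover have "log 2 (real (c n + 1) ^ 2) = 2 * log 2 (real (c n + 1))"
      using log_nat_power[OF less_imp_le[OF pos(3)], of 2 2] by simp
    moreover have "log 2 ((2::real) ^ k) = real k" for k by (simp add: log_nat_power)
    ultimately show ?thesis by simp
  qed
  have one: "real (r n) \<ge> 2 * log 2 (real n) - log 2 (real (T n)) - 2 * log 2 (real (max 1 (c n))) - (real A + 2)"
    if "1 \<le> n" for n
  proof -
    \<comment> \<open>\<open>c n + 1 <= 2 * max 1 (c n)\<close> accounts for the 2 added to the
      constant.\<close>
    have "log 2 (real (c n + 1)) \<le> log 2 (2 * real (max 1 (c n)))"
      by (subst log_le_cancel_iff) auto
    also have "\<dots> = 1 + log 2 (real (max 1 (c n)))"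
      by (subst log_mult) auto
    finally show ?thesis using log_bound[OF that A] by linarith
  qed
  have absorb: "Z \<le> real s + 2 * log 2 Z + b + 2"
    if "1 \<le> Z" "Z \<le> real s + 2 * log 2 (real (s + 1)) + b" "0 \<le> b" for Z b :: real and s
  proof (cases "real s \<le> Z")
    case True
    have "log 2 (real (s + 1)) \<le> log 2 (2 * Z)"
      using that(1) True by (subst log_le_cancel_iff) auto
    also have "\<dots> = 1 + log 2 Z" using that(1) by (subst log_mult) auto
    finally show ?thesis using that(2) by linarith
  next
    case False
    moreover have "0 \<le> log 2 Z" using that(1) by simp
    ultimately show ?thesis using that(3) by linarith
  qed
  have two: "real (c n) \<ge> log 2 (real n ^ 2 / real (T n)) -
      2 * log 2 (log 2 (real n ^ 2 / real (T n))) - (real B + 2)"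
    if n: "1 \<le> n" and ge: "real n ^ 2 / real (T n) \<ge> 2" for n
  proof -
    let ?Y = "log 2 (real n ^ 2 / real (T n))"
    have "?Y = 2 * log 2 (real n) - log 2 (real (T n))"
      using n T1[of n] log_nat_power[of "real n" 2 2] by (subst log_divide) auto
    then have "?Y \<le> real (c n) + 2 * log 2 (real (c n + 1)) + real B"
      using log_bound[OF n B] by linarith
    moreover have "1 \<le> ?Y" using ge by (subst le_log_iff) auto
    ultimately have "?Y \<le> real (c n) + 2 * log 2 ?Y + real B + 2" by (intro absorb) auto
    then show ?thesis by linarith
  qed
  have first: "\<exists>g. g \<in> O(\<lambda>n. log 2 (log 2 (real n))) \<and>
      (\<forall>\<^sub>F n in sequentially. real (r n) \<ge> log 2 (real n) - g n)"
    if Tn: "\<forall>\<^sub>F n in sequentially. T n = n" and cO: "(\<lambda>n. real (c n)) \<in> O(\<lambda>n. log 2 (real n))"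
  proof -
    define g where "g n = 2 * log 2 (real (max 1 (c n))) + (real A + 2)" for n
    obtain K0 where K0: "\<forall>\<^sub>F n in sequentially. norm (real (c n)) \<le> K0 * norm (log 2 (real n))"
      using cO by (rule landau_o.bigE)
    define K where "K = max 1 K0"
    have "g \<in> O(\<lambda>n. log 2 (log 2 (real n)))"
    proof (rule bigoI)
      show "\<forall>\<^sub>F n in sequentially. norm (g n) \<le> (2 * log 2 K + 2 + (real A + 2)) * norm (log 2 (log 2 (real n)))"
        using K0 eventually_ge_at_top[of 4]
      proof eventually_elim
        case (elim n)
        \<comment> \<open>From \<open>n = 4\<close> on the iterated logarithm is at least 1 and
          absorbs additive constants.\<close>
        have L: "2 \<le> log 2 (real n)" using elim(2) by (subst le_log_iff) auto
        then have LL: "1 \<le> log 2 (log 2 (real n))" by (subst le_log_iff) auto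
        have "real (c n) \<le> K0 * log 2 (real n)" using elim(1) L by simp
        also have "\<dots> \<le> K * log 2 (real n)" using L by (intro mult_right_mono) (auto simp: K_def)
        finally have "real (c n) \<le> K * log 2 (real n)" .
        moreover have "1 * 1 \<le> K * log 2 (real n)" using L by (intro mult_mono) (auto simp: K_def)
        ultimately have "real (max 1 (c n)) \<le> K * log 2 (real n)" by (simp add: max_def)
        then have "log 2 (real (max 1 (c n))) \<le> log 2 (K * log 2 (real n))"
          by (subst log_le_cancel_iff) (use L in \<open>auto simp: K_def\<close>)
        also have "\<dots> = log 2 K + log 2 (log 2 (real n))"
          using L by (subst log_mult) (auto simp: K_def)
        finally have "g n \<le> (2 * log 2 K + (real A + 2)) * 1 + 2 * log 2 (log 2 (real n))"
          by (simp add: g_def)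
        also have "\<dots> \<le> (2 * log 2 K + (real A + 2)) * log 2 (log 2 (real n)) + 2 * log 2 (log 2 (real n))"
          using LL by (intro add_right_mono mult_left_mono) (auto simp: K_def)
        also have "\<dots> = (2 * log 2 K + 2 + (real A + 2)) * log 2 (log 2 (real n))"
          by (simp add: algebra_simps)
        finally have "g n \<le> (2 * log 2 K + 2 + (real A + 2)) * log 2 (log 2 (real n))" .
        moreover have "0 \<le> g n" by (simp add: g_def)
        ultimately show ?case using LL by simp
      qed
    qed
    moreover have "\<forall>\<^sub>F n in sequentially. real (r n) \<ge> log 2 (real n) - g n"
      using Tn eventually_ge_at_top[of 1]
    proof eventually_elim
      case (elim n)
      then show ?case using one[of n] unfolding g_def by simp
    qed
    ultimately show ?thesis by blast
  qed
  have second: "\<exists>A::real. \<forall>n\<ge>2. real (c n) \<ge> log 2 (real n) - 2 * log 2 (log 2 (real n)) - A"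
    if TO: "(\<lambda>n. real (T n)) \<in> O(\<lambda>n. real n)"
  proof -
    obtain K0 where "\<forall>\<^sub>F n in sequentially. norm (real (T n)) \<le> K0 * norm (real n)"
      using TO by (rule landau_o.bigE)
    then obtain N where N: "\<And>n. N \<le> n \<Longrightarrow> real (T n) \<le> K0 * real n"
      unfolding eventually_sequentially by auto
    define K where "K = max 1 K0"
    \<comment> \<open>For \<open>n < N\<close> the summand \<open>log 2 N'\<close> of the constant
      is enough; \<open>max 1\<close> keeps it nonnegative.\<close>
    define N' where "N' = max 1 N"
    have "real (c n) \<ge> log 2 (real n) - 2 * log 2 (log 2 (real n)) - (log 2 K + real B + 2 + log 2 (real N'))"
      if n: "2 \<le> n" for n
    proof -
      have L: "1 \<le> log 2 (real n)" using n by (subst le_log_iff) auto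
      have K: "0 \<le> log 2 K" "0 < K" by (auto simp: K_def)
      have N': "0 \<le> log 2 (real N')" by (simp add: N'_def)
      show ?thesis
      proof (cases "N \<le> n")
        case True
        have "real (T n) \<le> K0 * real n" using True by (rule N)
        also have "\<dots> \<le> K * real n" by (intro mult_right_mono) (auto simp: K_def)
        finally have "log 2 (real (T n)) \<le> log 2 (K * real n)"
          using T1[of n] K n by (subst log_le_cancel_iff) auto
        also have "\<dots> = log 2 K + log 2 (real n)" using K n by (subst log_mult) auto
        finally have "log 2 (real n) \<le> real (c n) + 2 * log 2 (real (c n + 1)) + (log 2 K + real B)"
          using log_bound[OF _ B, of n] n by linarith
        from absorb[OF L this] K N' show ?thesis by linarith
      next
        case False
        then have "log 2 (real n) \<le> log 2 (real N')" using n by (subst log_le_cancel_iff) (auto simp: N'_def)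
        moreover have "0 \<le> log 2 (log 2 (real n))" using L by simp
        ultimately show ?thesis using K by linarith
      qed
    qed
    then show ?thesis by blast
  qed
  have third: "(\<lambda>n. real (T n)) \<in> \<Omega>(\<lambda>n. real n / (real (c n) + 1))"
  proof (rule landau_omega.bigI[of "1 / 2 ^ D"])
    show "\<forall>\<^sub>F n in sequentially. norm (real (T n)) \<ge> 1 / 2 ^ D * norm (real n / (real (c n) + 1))"
      using eventually_ge_at_top[of 1]
    proof eventually_elim
      case (elim n)
      have "real n \<le> real (T n * (c n + 1) * 2 ^ D)" using D[OF elim] by (simp only: of_nat_le_iff)
      then have "real n \<le> real (T n) * (real (c n) + 1) * 2 ^ D" by (simp add: algebra_simps)
      then have le: "real n \<le> real (T n) * ((real (c n) + 1) * 2 ^ D)" by (simp only: mult.assoc)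
      have "0 < (real (c n) + 1) * 2 ^ D" by (intro mult_pos_pos) auto
      from pos_divide_le_eq[OF this, THEN iffD2, OF le]
      have "real n / ((real (c n) + 1) * 2 ^ D) \<le> real (T n)" .
      moreover have "1 / 2 ^ D * norm (real n / (real (c n) + 1)) = real n / ((real (c n) + 1) * 2 ^ D)"
        by simp
      ultimately show ?case by (simp only: real_norm_def abs_of_nat)
    qed
  qed simp
  show ?thesis
  proof (intro conjI impI)
    show "\<exists>A::real. \<forall>n\<ge>1. real (r n) \<ge>
        2 * log 2 (real n) - log 2 (real (T n)) - 2 * log 2 (real (max 1 (c n))) - A"
      using one by blast
    show "\<exists>A::real. \<forall>n\<ge>1. real n ^ 2 / real (T n) \<ge> 2 \<longrightarrow> real (c n) \<ge>
        log 2 (real n ^ 2 / real (T n)) - 2 * log 2 (log 2 (real n ^ 2 / real (T n))) - A"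
      using two by blast
  qed (use first second third in blast)+
qed

end
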